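(* Consider the fixed-design linear model, estimators and assumptions described in the context, and suppose Assumptions 1–7 hold. Let $\xi_1,\dots,\xi_r$ be independent $N(0,\sigma^2)$ random variables and define $$H(x)=\mathrm{Prob}\Big(\max_{i\in\mathcal M}\frac{1}{\tau_i}\Big|\sum_{k=1}^r c_{ik}w_k\xi_k\Big|\le x\Big).$$ Then $$\lim_{n\to\infty}\sup_{x\ge0}\Big|\mathrm{Prob}\Big(\max_{i=1,\dots,p_1}\frac{|\widehat\gamma_i-\gamma_i|}{\widehat\tau_i}\le x\Big)-H(x)\Big|=0.$$
   Context: Model: $y=X\beta+\epsilon$, $y\in\mathbb R^n$, with deterministic $n\times p$ design matrix $X=(x_{ij})$ of rank $r$, unknown $\beta\in\mathbb R^p$, errors $\epsilon=(\epsilon_1,\dots,\epsilon_n)^T$. All quantities ($p,r,X,\beta,M,p_1,\rho_n,b_n,\dots$) may depend on $n$; all asymptotic statements are as $n\to\infty$. $M=(m_{ij})$ is a known $p_1\times p$ matrix and $\gamma=(\gamma_1,\dots,\gamma_{p_1})^T=M\beta$. Let $X=P\Lambda Q^T$ be a thin SVD: $P=(p_{lk})$ is $n\times r$, $Q=(q_{jk})$ is $p\times r$, $P^TP=Q^TQ=I_r$, $\Lambda=\mathrm{diag}(\lambda_1,\dots,\lambda_r)$ with $\lambda_1\ge\dots\ge\lambda_r>0$. Let $Q_\perp$ be a $p\times(p-r)$ matrix with $Q_\perp^TQ_\perp=I_{p-r}$, $Q^TQ_\perp=0$, $QQ^T+Q_\perp Q_\perp^T=I_p$. Set $\zeta=Q^T\beta$,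 $\theta=(\theta_1,\dots,\theta_p)^T=QQ^T\beta$, $\theta_\perp=Q_\perp Q_\perp^T\beta$ (with $\theta_\perp=0$ if $r=p$). Given a ridge parameter $\rho_n>0$ and threshold $b_n>0$, let $\mathcal N_{b_n}=\{i:|\theta_i|>b_n\}$, $c_{ik}=\sum_{j\in\mathcal N_{b_n}}m_{ij}q_{jk}$, $\mathcal M=\{i:\sum_{k=1}^r c_{ik}^2>0\}$, $w_k=\frac{\lambda_k}{\lambda_k^2+\rho_n}+\frac{\rho_n\lambda_k}{(\lambda_k^2+\rho_n)^2}$, $\tau_i=\sqrt{\sum_{k=1}^r c_{ik}^2w_k^2+1/n}$. Estimators: $\widetilde\theta^\star=(X^TX+\rho_nI_p)^{-1}X^Ty$, $\widetilde\theta=\widetilde\theta^\star+\rho_nQ(\Lambda^2+\rho_nI_r)^{-1}Q^T\widetilde\theta^\star$, $\widehat{\mathcal N}_{b_n}=\{i:|\widetilde\theta_i|>b_n\}$, $\widehat\theta_i=\widetilde\theta_i\mathbf 1_{i\in\widehat{\mathcal N}_{b_n}}$, $\widehat\gamma=M\widehat\theta$, $\widehat\tau_i=\sqrt{\sum_{k=1}^r(\sum_{j\in\widehat{\mathcal N}_{b_n}}m_{ij}q_{jk})^2w_k^2+1/n}$; $\sigma^2=\mathbf E\epsilon_1^2$. Assumption 1: $X$ deterministic; constants $c_\lambda,C_\lambda>0$, $0<\eta\le1/2$ with $C_\lambda n^{1/2}\ge\lambda_1\ge\dots\ge\lambda_r\ge c_\lambda n^{\eta}$; $\|\theta\|_2=O(n^{\alpha_\theta})$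 with $0<\alpha_\theta<3\eta$. Assumption 2: $\rho_n=O(n^{2\eta-\delta})$ with $\frac{\eta+\alpha_\theta}{2}<\delta<2\eta$. Assumption 3: $\epsilon_i$ i.i.d., $\mathbf E\epsilon_1=0$, $\mathbf E|\epsilon_1|^m<\infty$ for some $m>4$. Assumption 4: $p=O(n^{\alpha_p})$, $\alpha_p\in[0,m\eta)$; $b_n=C_bn^{-\nu_b}$, $C_b,\nu_b>0$, $\nu_b+\alpha_p/m-\eta<0$; a constant $0<c_b<1$ with $\max_{i\notin\mathcal N_{b_n}}|\theta_i|\le c_bb_n$, $\min_{i\in\mathcal N_{b_n}}|\theta_i|\ge b_n/c_b$. Assumption 5: $\mathcal M\ne\emptyset$, $|\mathcal M|=O(n^{\alpha_{\mathcal M}})$ with $\alpha_{\mathcal M}<m\eta$; constants $0<c_{\mathcal M}<\sum_kc_{ik}^2\le C_{\mathcal M}$ for $i\in\mathcal M$; $\max_{i\le p_1}|\sum_{j\notin\mathcal N_{b_n}}m_{ij}\theta_j|=o(1/\sqrt{n\log n})$ and $\max_{i\le p_1}|\sum_{j=1}^pm_{ij}\theta_{\perp,j}|=o(1/\sqrt{n\log n})$. Assumption 6: a constant $0<\alpha_\sigma\le\eta$ with $n^{-\nu_b}\sum_{j\notin\mathcal N_{b_n}}|\theta_j|=O(n^{-\alpha_\sigma})$ and $\sqrt{|\mathcal N_{b_n}|}/n^\eta=O(n^{-\alpha_\sigma})$. Assumption 7: $|\mathcal M|\le r$, the matrix $(c_{ik})_{i\in\mathcal M,k=1,\dots,r}$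 has rank $|\mathcal M|$, and, writing $t_{il}=\tau_i^{-1}\sum_{k=1}^rc_{ik}p_{lk}w_k$, one of: (7.1) $\max_{i\in\mathcal M,l\le n}|t_{il}|=o\big(\min(n^{(\alpha_\sigma-1)/2}\log^{-3/2}n,\ n^{-1/3}\log^{-3/2}n)\big)$; or (7.2) $\alpha_\sigma<1/2$, $|\mathcal M|=o(n^{\alpha_\sigma}\log^{-3}n)$ and $\max_{i\in\mathcal M,l\le n}|t_{il}|=O(n^{-\alpha_\sigma}\log^{-3/2}n)$.
   Formalization: The formal theorem additionally assumes that the error variance σ² is strictly positive; with σ² = 0 the claim fails at x = 0, where H(0) = 1 but the ridge bias makes the statistic positive. *)

theory Defs
  imports "Jordan_Normal_Form.Gauss_Jordan_Elimination" "Jordan_Normal_Form.DL_Rank"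
    "HOL-Probability.Probability" "HOL-Library.Landau_Symbols"
begin

text \<open>Fixed-design ridge model.  Matrices/vectors are JNF matrices/vectors; indices start at 0.
  X : n x p design, beta : p-vector, M : p1 x p, and a thin SVD  X = P Lambda Q^T  with
  P : n x r, Q : p x r, Lambda = diag(lam 0, ..., lam (r-1)).\<close>

definition Lam_mat :: "nat \<Rightarrow> (nat \<Rightarrow> real) \<Rightarrow> real Matrix.mat" where
  "Lam_mat r lam = mat_diag r lam"

text \<open>Matrix inverse (the matrices inverted below are symmetric positive definite when rho > 0).\<close>
definition inv_mat :: "real Matrix.mat \<Rightarrow> real Matrix.mat" where
  "inv_mat A = the (mat_inverse A)"

definition ridge_init :: "real Matrix.mat \<Rightarrow> real \<Rightarrow> real Matrix.vec \<Rightarrow> real Matrix.vec" where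
  "ridge_init X \<rho> y =
     inv_mat (transpose_mat X * X + \<rho> \<cdot>\<^sub>m 1\<^sub>m (dim_col X)) *\<^sub>v (transpose_mat X *\<^sub>v y)"

definition ridge_corr :: "real Matrix.mat \<Rightarrow> real Matrix.mat \<Rightarrow> (nat \<Rightarrow> real) \<Rightarrow> real \<Rightarrow> real Matrix.vec \<Rightarrow> real Matrix.vec" where
  "ridge_corr X Q lam \<rho> y =
     (let t = ridge_init X \<rho> y; r = dim_col Q; L = Lam_mat r lam in
       t + \<rho> \<cdot>\<^sub>v ((Q * inv_mat (L * L + \<rho> \<cdot>\<^sub>m 1\<^sub>m r) * transpose_mat Q) *\<^sub>v t))"

definition Nhat :: "real Matrix.mat \<Rightarrow> real Matrix.mat \<Rightarrow> (nat \<Rightarrow> real) \<Rightarrow> real \<Rightarrow> real \<Rightarrow> real Matrix.vec \<Rightarrow> nat set" where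
  "Nhat X Q lam \<rho> b y = {i. i < dim_col X \<and> \<bar>ridge_corr X Q lam \<rho> y $ i\<bar> > b}"

definition theta_hat :: "real Matrix.mat \<Rightarrow> real Matrix.mat \<Rightarrow> (nat \<Rightarrow> real) \<Rightarrow> real \<Rightarrow> real \<Rightarrow> real Matrix.vec \<Rightarrow> real Matrix.vec" where
  "theta_hat X Q lam \<rho> b y =
     Matrix.vec (dim_col X)
       (\<lambda>i. if i \<in> Nhat X Q lam \<rho> b y then ridge_corr X Q lam \<rho> y $ i else 0)"

definition gamma_hat :: "real Matrix.mat \<Rightarrow> real Matrix.mat \<Rightarrow> real Matrix.mat \<Rightarrow> (nat \<Rightarrow> real) \<Rightarrow> real \<Rightarrow> real \<Rightarrow> real Matrix.vec \<Rightarrow> real Matrix.vec" where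
  "gamma_hat M X Q lam \<rho> b y = M *\<^sub>v theta_hat X Q lam \<rho> b y"

definition wgt :: "(nat \<Rightarrow> real) \<Rightarrow> real \<Rightarrow> nat \<Rightarrow> real" where
  "wgt lam \<rho> k = lam k / ((lam k)\<^sup>2 + \<rho>) + \<rho> * lam k / ((lam k)\<^sup>2 + \<rho>)\<^sup>2"

definition cc :: "real Matrix.mat \<Rightarrow> real Matrix.mat \<Rightarrow> nat set \<Rightarrow> nat \<Rightarrow> nat \<Rightarrow> real" where
  "cc M Q N i k = (\<Sum>j\<in>N. M $$ (i, j) * Q $$ (j, k))"

text \<open>tau_i relative to an index set N (N = N_{b_n} gives tau_i, N = N^_{b_n} gives tau^_i);
  n is the sample size.\<close>
definition tau_gen :: "nat \<Rightarrow> real Matrix.mat \<Rightarrow> real Matrix.mat \<Rightarrow> (nat \<Rightarrow> real) \<Rightarrow> real \<Rightarrow> nat set \<Rightarrow> nat \<Rightarrow> real" where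
  "tau_gen n M Q lam \<rho> N i =
     sqrt ((\<Sum>k<dim_col Q. (cc M Q N i k)\<^sup>2 * (wgt lam \<rho> k)\<^sup>2) + 1 / real n)"

text \<open>theta = Q Q^T beta,  theta_perp = Q_perp Q_perp^T beta.\<close>
definition theta_of :: "real Matrix.mat \<Rightarrow> real Matrix.vec \<Rightarrow> real Matrix.vec" where
  "theta_of Q \<beta> = (Q * transpose_mat Q) *\<^sub>v \<beta>"

definition Nb :: "real Matrix.mat \<Rightarrow> real Matrix.vec \<Rightarrow> real \<Rightarrow> nat set" where
  "Nb Q \<beta> b = {i. i < dim_row Q \<and> \<bar>theta_of Q \<beta> $ i\<bar> > b}"

definition Mset :: "real Matrix.mat \<Rightarrow> real Matrix.mat \<Rightarrow> real Matrix.vec \<Rightarrow> real \<Rightarrow> nat set" where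
  "Mset M Q \<beta> b = {i. i < dim_row M \<and> (\<Sum>k<dim_col Q. (cc M Q (Nb Q \<beta> b) i k)\<^sup>2) > 0}"

definition C_M_mat :: "real Matrix.mat \<Rightarrow> real Matrix.mat \<Rightarrow> real Matrix.vec \<Rightarrow> real \<Rightarrow> real Matrix.mat" where
  "C_M_mat M Q \<beta> b =
     Matrix.mat (card (Mset M Q \<beta> b)) (dim_col Q)
       (\<lambda>(a, k). cc M Q (Nb Q \<beta> b) (sorted_list_of_set (Mset M Q \<beta> b) ! a) k)"

definition stat :: "real Matrix.mat \<Rightarrow> real Matrix.vec \<Rightarrow> real Matrix.mat \<Rightarrow> real Matrix.mat \<Rightarrow> (nat \<Rightarrow> real) \<Rightarrow> real \<Rightarrow> real \<Rightarrow> real Matrix.vec \<Rightarrow> real" where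
  "stat X \<beta> M Q lam \<rho> b y =
     Max ((\<lambda>i. \<bar>gamma_hat M X Q lam \<rho> b y $ i - (M *\<^sub>v \<beta>) $ i\<bar>
                / tau_gen (dim_row X) M Q lam \<rho> (Nhat X Q lam \<rho> b y) i) ` {..<dim_row M})"

definition err_space :: "nat \<Rightarrow> real measure \<Rightarrow> (nat \<Rightarrow> real) measure" where
  "err_space n D = PiM {..<n} (\<lambda>_. D)"

definition prob_stat :: "real Matrix.mat \<Rightarrow> real Matrix.vec \<Rightarrow> real Matrix.mat \<Rightarrow> real Matrix.mat \<Rightarrow> (nat \<Rightarrow> real) \<Rightarrow> real \<Rightarrow> real \<Rightarrow> real measure \<Rightarrow> real \<Rightarrow> real" where
  "prob_stat X \<beta> M Q lam \<rho> b D x =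
     measure (err_space (dim_row X) D)
       {e \<in> space (err_space (dim_row X) D).
          stat X \<beta> M Q lam \<rho> b (X *\<^sub>v \<beta> + Matrix.vec (dim_row X) e) \<le> x}"

definition err_var :: "real measure \<Rightarrow> real" where
  "err_var D = (\<integral>x. x\<^sup>2 \<partial>D)"

definition gauss :: "real \<Rightarrow> real measure" where
  "gauss s = density lborel (normal_density 0 s)"

definition H_fun :: "nat \<Rightarrow> real Matrix.mat \<Rightarrow> real Matrix.mat \<Rightarrow> (nat \<Rightarrow> real) \<Rightarrow> real Matrix.vec \<Rightarrow> real \<Rightarrow> real \<Rightarrow> real \<Rightarrow> real \<Rightarrow> real" where
  "H_fun n M Q lam \<beta> \<rho> b \<sigma> x =
     measure (PiM {..<dim_col Q} (\<lambda>_. gauss \<sigma>))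
       {\<xi> \<in> space (PiM {..<dim_col Q} (\<lambda>_. gauss \<sigma>)).
          Max ((\<lambda>i. \<bar>\<Sum>k<dim_col Q. cc M Q (Nb Q \<beta> b) i k * wgt lam \<rho> k * \<xi> k\<bar>
                     / tau_gen n M Q lam \<rho> (Nb Q \<beta> b) i) ` Mset M Q \<beta> b) \<le> x}"

definition t_coef :: "nat \<Rightarrow> real Matrix.mat \<Rightarrow> real Matrix.mat \<Rightarrow> real Matrix.mat \<Rightarrow> (nat \<Rightarrow> real) \<Rightarrow> real Matrix.vec \<Rightarrow> real \<Rightarrow> real \<Rightarrow> nat \<Rightarrow> nat \<Rightarrow> real" where
  "t_coef n M P Q lam \<beta> \<rho> b i l =
     (\<Sum>k<dim_col Q. cc M Q (Nb Q \<beta> b) i k * P $$ (l, k) * wgt lam \<rho> k)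
       / tau_gen n M Q lam \<rho> (Nb Q \<beta> b) i"

definition t_max :: "nat \<Rightarrow> real Matrix.mat \<Rightarrow> real Matrix.mat \<Rightarrow> real Matrix.mat \<Rightarrow> (nat \<Rightarrow> real) \<Rightarrow> real Matrix.vec \<Rightarrow> real \<Rightarrow> real \<Rightarrow> real" where
  "t_max n M P Q lam \<beta> \<rho> b =
     Max {\<bar>t_coef n M P Q lam \<beta> \<rho> b i l\<bar> | i l. i \<in> Mset M Q \<beta> b \<and> l < n}"

end

theory Submission
  imports Defs "Jordan_Normal_Form.Determinant" "HOL-Real_Asymp.Real_Asymp"
begin

text \<open>Off an event of vanishing probability the thresholding recovers \<open>N\<close> exactly, and then the
  statistic is \<open>max \<bar>\<Sum>l. t i l * \<epsilon> l\<bar>\<close> up to a bias \<open>\<kappa> = o(1 / sqrt (log n))\<close>. The errors are replaced by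
  Gaussians one at a time (Lindeberg) inside a smooth proxy for the indicator of the maximum, which costs
  \<open>\<beta>\<^sup>3 * (\<Sum>l. max i \<bar>t i l\<bar>\<^sup>3)\<close> with \<open>\<beta>\<close> of order \<open>log n\<close> over the window width. Both alternatives of
  Assumption 7 make the sum \<open>o(log n powr (-9/2))\<close>, so the width can be taken \<open>o(1 / sqrt (log n))\<close>, and a window
  of that width has vanishing probability for the Gaussian maximum by anti-concentration. Rotation invariance,
  tails and anti-concentration of the Gaussian law are all read off from the Cameron--Martin formula.\<close>

section \<open>Gaussian product measures\<close>

text \<open>Two kinds of uniformity shape the argument. All \<open>p\<close> coordinates must be
  thresholded correctly at once, with \<open>p\<close> polynomial in \<open>n\<close> but only a
  moment of order \<open>m\<close> at hand. So the noise in a coordinate gets an exponential bound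
  where its weighted sum of squared errors is small and a Markov bound elsewhere; the gap between
  \<open>\<alpha>\<^sub>p / m\<close> and \<open>\<eta> - \<nu>\<^sub>b\<close> is the room for a
  truncation level that makes both terms vanish after summing over \<open>p\<close> coordinates. The
  error must also be uniform in the level \<open>x\<close>, while the anti-concentration bound grows
  with the size of \<open>x\<close>. Levels beyond some \<open>x0\<close> of order sqrt (log n) are
  left to the Gaussian tail; the factor \<open>x0\<close> that remains is why windows and biases
  must be o(1 / sqrt (log n)). The power 9/2 has the same origin: log n over the width, cubed, gives
  log^3, and the width itself contributes log^(3/2). Anti-concentration also needs the rows of
  \<open>t\<close> to have norms bounded below. The term 1/n under the root in \<open>\<tau>\<close>
  allows this: all weights are at least of order n^(-1/2), so the variance of a row in the index set
  dominates a fixed multiple of 1/n.\<close>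

lemma prob_space_gauss: "0 < s \<Longrightarrow> prob_space (gauss s)"
  unfolding gauss_def by (rule prob_space_normal_density)

lemma sets_gauss [simp, measurable_cong]: "sets (gauss s) = sets borel"
  by (simp add: gauss_def)

lemma space_gauss [simp]: "space (gauss s) = UNIV"
  by (simp add: gauss_def)

lemma nn_integral_gauss:
  "f \<in> borel_measurable borel \<Longrightarrow>
    (\<integral>\<^sup>+y. f y \<partial>gauss s) = (\<integral>\<^sup>+y. ennreal (normal_density 0 s y) * f y \<partial>lborel)"
  by (simp add: gauss_def nn_integral_density)

lemma normal_density_shift:
  assumes "0 < s"
  shows "normal_density 0 s (y - a) = normal_density 0 s y * exp (y * a / s\<^sup>2 - a\<^sup>2 / (2 * s\<^sup>2))"
proof -
  have "- (y - a)\<^sup>2 / (2 * s\<^sup>2) = - y\<^sup>2 / (2 * s\<^sup>2) + (y * a / s\<^sup>2 - a\<^sup>2 / (2 * s\<^sup>2))"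
    using assms by (simp add: field_simps power2_eq_square)
  then show ?thesis
    by (simp add: normal_density_def exp_add[symmetric])
qed

lemma gauss_shift:
  assumes s: "0 < s" and [measurable]: "f \<in> borel_measurable borel"
  shows "(\<integral>\<^sup>+y. f (y + a) \<partial>gauss s)
    = (\<integral>\<^sup>+y. f y * ennreal (exp (y * a / s\<^sup>2 - a\<^sup>2 / (2 * s\<^sup>2))) \<partial>gauss s)"
proof -
  have "(\<integral>\<^sup>+y. f (y + a) \<partial>gauss s) = (\<integral>\<^sup>+y. ennreal (normal_density 0 s y) * f (y + a) \<partial>lborel)"
    by (simp add: nn_integral_gauss)
  also have "\<dots> = (\<integral>\<^sup>+y. ennreal (normal_density 0 s (y - a)) * f y \<partial>lborel)"
    by (subst nn_integral_real_affine[where c=1 and t="-a"]) (simp_all add: add.commute)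
  also have "\<dots> = (\<integral>\<^sup>+y. ennreal (normal_density 0 s y) * (f y * ennreal (exp (y * a / s\<^sup>2 - a\<^sup>2 / (2 * s\<^sup>2)))) \<partial>lborel)"
    by (intro nn_integral_cong) (simp add: normal_density_shift[OF s] ennreal_mult ac_simps)
  finally show ?thesis
    by (simp add: nn_integral_gauss)
qed

abbreviation iid :: "nat set \<Rightarrow> real measure \<Rightarrow> (nat \<Rightarrow> real) measure" where
  "iid I D \<equiv> PiM I (\<lambda>_. D)"

abbreviation gauss_vec :: "nat set \<Rightarrow> real \<Rightarrow> (nat \<Rightarrow> real) measure" where
  "gauss_vec I s \<equiv> iid I (gauss s)"

abbreviation third_moment :: "real measure \<Rightarrow> real" where
  "third_moment D \<equiv> (\<integral>x. \<bar>x\<bar> ^ 3 \<partial>D)"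

lemma product_prob_space_gauss: "0 < s \<Longrightarrow> product_prob_space (\<lambda>_. gauss s)"
  by (intro product_prob_spaceI prob_space_gauss)

lemma prob_space_gauss_vec: "0 < s \<Longrightarrow> prob_space (gauss_vec I s)"
  by (intro prob_space_PiM prob_space_gauss)

text \<open>The density of the shift is a product over coordinates, so the one-dimensional formula
  is applied one coordinate at a time. Nonnegative integrals make Fubini available for every
  measurable \<open>f\<close>, and the restriction to \<open>I\<close> keeps the shifted point in
  the product space.\<close>

lemma cameron_martin:
  assumes s: "0 < s" and "finite I" and "f \<in> borel_measurable (gauss_vec I s)"
  shows "(\<integral>\<^sup>+z. f (\<lambda>l\<in>I. z l + a l) \<partial>gauss_vec I s)
    = (\<integral>\<^sup>+z. f z * ennreal (exp ((\<Sum>l\<in>I. a l * z l) / s\<^sup>2 - (\<Sum>l\<in>I. (a l)\<^sup>2) / (2 * s\<^sup>2))) \<partial>gauss_vec I s)"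
  using assms(2,3)
proof (induction I arbitrary: f rule: finite_induct)
  case empty
  then show ?case by (simp add: PiM_empty nn_integral_count_space_finite)
next
  case (insert i I)
  interpret product_prob_space "\<lambda>_. gauss s" UNIV by (rule product_prob_space_gauss[OF s])
  interpret PI: prob_space "gauss_vec I s" by (rule prob_space_gauss_vec[OF s])
  note [measurable] = insert.prems
  let ?e = "\<lambda>I z. ennreal (exp ((\<Sum>l\<in>I. a l * z l) / s\<^sup>2 - (\<Sum>l\<in>I. (a l)\<^sup>2) / (2 * s\<^sup>2)))"
  have upd: "(\<lambda>l\<in>insert i I. (x(i := y)) l + a l) = (\<lambda>l\<in>I. x l + a l)(i := y + a i)" for x :: "nat \<Rightarrow> real" and y
    using insert.hyps by (auto simp: restrict_def fun_eq_iff)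
  have upd_meas: "(\<lambda>x. f (x(i := y))) \<in> borel_measurable (gauss_vec I s)" for y
    by measurable
  \<comment> \<open>Integrating the new coordinate last leaves a function of one variable, to which
    \<open>gauss_shift\<close> applies.\<close>
  define h where "h y = (\<integral>\<^sup>+x. f (x(i := y)) * ?e I x \<partial>gauss_vec I s)" for y
  have h_meas: "h \<in> borel_measurable borel"
    unfolding h_def by measurable
  have "(\<integral>\<^sup>+z. f (\<lambda>l\<in>insert i I. z l + a l) \<partial>gauss_vec (insert i I) s)
     = (\<integral>\<^sup>+y. \<integral>\<^sup>+x. f ((\<lambda>l\<in>I. x l + a l)(i := y + a i)) \<partial>gauss_vec I s \<partial>gauss s)"
    using insert.hyps by (subst product_nn_integral_insert_rev) (simp_all only: upd, measurable)
  also have "\<dots> = (\<integral>\<^sup>+y. \<integral>\<^sup>+x. f (x(i := y + a i)) * ?e I x \<partial>gauss_vec I s \<partial>gauss s)"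
    by (intro nn_integral_cong insert.IH upd_meas)
  also have "\<dots> = (\<integral>\<^sup>+y. h (y + a i) \<partial>gauss s)"
    by (simp add: h_def)
  also have "\<dots> = (\<integral>\<^sup>+y. h y * ennreal (exp (y * a i / s\<^sup>2 - (a i)\<^sup>2 / (2 * s\<^sup>2))) \<partial>gauss s)"
    by (rule gauss_shift[OF s h_meas])
  also have "\<dots> = (\<integral>\<^sup>+y. \<integral>\<^sup>+x. f (x(i := y)) * ?e (insert i I) (x(i := y)) \<partial>gauss_vec I s \<partial>gauss s)"
  proof (rule nn_integral_cong)
    fix y
    have *: "?e (insert i I) (x(i := y)) = ?e I x * ennreal (exp (y * a i / s\<^sup>2 - (a i)\<^sup>2 / (2 * s\<^sup>2)))" for x
    proof -
      have "(\<Sum>l\<in>I. a l * (x(i := y)) l) = (\<Sum>l\<in>I. a l * x l)"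
        using insert.hyps by (intro sum.cong) auto
      then have "(\<Sum>l\<in>insert i I. a l * (x(i := y)) l) / s\<^sup>2 - (\<Sum>l\<in>insert i I. (a l)\<^sup>2) / (2 * s\<^sup>2)
          = ((\<Sum>l\<in>I. a l * x l) / s\<^sup>2 - (\<Sum>l\<in>I. (a l)\<^sup>2) / (2 * s\<^sup>2)) + (y * a i / s\<^sup>2 - (a i)\<^sup>2 / (2 * s\<^sup>2))"
        using insert.hyps by (simp add: add_divide_distrib mult.commute)
      then show ?thesis
        by (simp only: exp_add ennreal_mult exp_ge_zero)
    qed
    show "h y * ennreal (exp (y * a i / s\<^sup>2 - (a i)\<^sup>2 / (2 * s\<^sup>2)))
      = (\<integral>\<^sup>+x. f (x(i := y)) * ?e (insert i I) (x(i := y)) \<partial>gauss_vec I s)"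
      unfolding h_def * mult.assoc[symmetric] by (rule nn_integral_multc[symmetric]) measurable
  qed
  also have "\<dots> = (\<integral>\<^sup>+z. f z * ?e (insert i I) z \<partial>gauss_vec (insert i I) s)"
    using insert.hyps by (subst product_nn_integral_insert_rev) (simp_all, measurable)
  finally show ?case .
qed

text \<open>Averaging over all translates along \<open>a\<close> against Lebesgue measure forgets
  the component along \<open>a\<close>, and the weight in \<open>F\<close> normalises that average.
  Hence the component along a unit vector may be redrawn independently: rotation invariance without
  a rotation matrix, in a form suited to induction.\<close>

lemma gauss_resample:
  assumes s: "0 < s" and fin: "finite I" and a: "(\<Sum>l\<in>I. (a l)\<^sup>2) = 1"
    and f[measurable]: "f \<in> borel_measurable (gauss_vec I s)"
  shows "(\<integral>\<^sup>+z. f z \<partial>gauss_vec I s)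
    = (\<integral>\<^sup>+y. \<integral>\<^sup>+z. f (\<lambda>l\<in>I. z l + (y - (\<Sum>l\<in>I. a l * z l)) * a l) \<partial>gauss_vec I s \<partial>gauss s)"
proof -
  interpret PI: prob_space "gauss_vec I s" by (rule prob_space_gauss_vec[OF s])
  interpret pair_sigma_finite "gauss_vec I s" lborel ..
  define ip where "ip z = (\<Sum>l\<in>I. a l * z l)" for z :: "nat \<Rightarrow> real"
  have ip_meas[measurable]: "ip \<in> borel_measurable (gauss_vec I s)"
    unfolding ip_def by measurable
  \<comment> \<open>The Cameron-Martin density times \<open>normal_density 0 s (ip z)\<close> is, as
    a function of \<open>y\<close>, the normal density centred at \<open>ip z\<close>; its total
    mass is 1 (\<open>dens\<close>).\<close>
  define F where "F z = f z * ennreal (normal_density 0 s (ip z))" for z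
  have F_meas[measurable]: "F \<in> borel_measurable (gauss_vec I s)"
    unfolding F_def by measurable
  define S where "S y z = (\<lambda>l\<in>I. z l + y * a l)" for y and z :: "nat \<Rightarrow> real"
  have S_meas[measurable]: "(\<lambda>(z, y). S y z) \<in> measurable (gauss_vec I s \<Otimes>\<^sub>M borel) (gauss_vec I s)"
    unfolding S_def case_prod_beta by (rule measurable_restrict) measurable
  have ip_S: "ip (S y z) = ip z + y" for y z
  proof -
    have "ip (S y z) = (\<Sum>l\<in>I. a l * z l + y * (a l)\<^sup>2)"
      unfolding ip_def S_def by (intro sum.cong) (auto simp: algebra_simps power2_eq_square)
    then show ?thesis by (simp add: sum.distrib sum_distrib_left[symmetric] a ip_def)
  qed
  have dens: "(\<integral>\<^sup>+y. ennreal (exp (y * u / s\<^sup>2 - y\<^sup>2 / (2 * s\<^sup>2)) * normal_density 0 s u) \<partial>lborel) = 1" for u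
  proof -
    have "exp (y * u / s\<^sup>2 - y\<^sup>2 / (2 * s\<^sup>2)) * normal_density 0 s u = normal_density u s y" for y
    proof -
      have "normal_density u s y = normal_density 0 s (u - y)"
        by (simp add: normal_density_def power2_commute)
      then show ?thesis
        by (simp add: normal_density_shift[OF s] mult.commute)
    qed
    then show ?thesis
      using prob_space.emeasure_space_1[OF prob_space_normal_density[OF s, of u]]
      by (simp add: emeasure_density)
  qed
  have "(\<integral>\<^sup>+y. \<integral>\<^sup>+z. F (S y z) \<partial>gauss_vec I s \<partial>lborel)
      = (\<integral>\<^sup>+y. \<integral>\<^sup>+z. F z * ennreal (exp (y * ip z / s\<^sup>2 - y\<^sup>2 / (2 * s\<^sup>2))) \<partial>gauss_vec I s \<partial>lborel)"
  proof (rule nn_integral_cong)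
    fix y :: real
    have sq: "(\<Sum>l\<in>I. (y * a l)\<^sup>2) = y\<^sup>2"
      by (simp add: power_mult_distrib sum_distrib_left[symmetric] a)
    have lin: "(\<Sum>l\<in>I. y * a l * z l) = y * ip z" for z
      by (simp add: ip_def sum_distrib_left ac_simps)
    show "(\<integral>\<^sup>+z. F (S y z) \<partial>gauss_vec I s)
      = (\<integral>\<^sup>+z. F z * ennreal (exp (y * ip z / s\<^sup>2 - y\<^sup>2 / (2 * s\<^sup>2))) \<partial>gauss_vec I s)"
      using cameron_martin[OF s fin F_meas, of "\<lambda>l. y * a l"] by (simp add: S_def sq lin)
  qed
  also have "\<dots> = (\<integral>\<^sup>+z. \<integral>\<^sup>+y. f z * ennreal (exp (y * ip z / s\<^sup>2 - y\<^sup>2 / (2 * s\<^sup>2)) * normal_density 0 s (ip z)) \<partial>lborel \<partial>gauss_vec I s)"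
    by (subst Fubini') (simp_all add: F_def ennreal_mult ac_simps)
  also have "\<dots> = (\<integral>\<^sup>+z. f z \<partial>gauss_vec I s)"
    by (simp add: nn_integral_cmult dens)
  finally have "(\<integral>\<^sup>+z. f z \<partial>gauss_vec I s) = (\<integral>\<^sup>+y. \<integral>\<^sup>+z. F (S y z) \<partial>gauss_vec I s \<partial>lborel)" ..
  also have "\<dots> = (\<integral>\<^sup>+z. \<integral>\<^sup>+y. F (S y z) \<partial>lborel \<partial>gauss_vec I s)"
    by (rule Fubini') measurable
  \<comment> \<open>Lebesgue measure is invariant under replacing \<open>y\<close> by
    \<open>y - ip z\<close>. The translate then has component exactly \<open>y\<close> along
    \<open>a\<close>, so the weight depends on \<open>y\<close> alone and becomes the density of a
    fresh Gaussian.\<close>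
  also have "\<dots> = (\<integral>\<^sup>+z. \<integral>\<^sup>+y. F (S (y - ip z) z) \<partial>lborel \<partial>gauss_vec I s)"
  proof (rule nn_integral_cong)
    fix z assume "z \<in> space (gauss_vec I s)"
    then have [measurable]: "(\<lambda>y. F (S y z)) \<in> borel_measurable borel" by measurable
    show "(\<integral>\<^sup>+y. F (S y z) \<partial>lborel) = (\<integral>\<^sup>+y. F (S (y - ip z) z) \<partial>lborel)"
      by (subst nn_integral_real_affine[where c=1 and t="- ip z"]) simp_all
  qed
  also have "\<dots> = (\<integral>\<^sup>+y. \<integral>\<^sup>+z. F (S (y - ip z) z) \<partial>gauss_vec I s \<partial>lborel)"
    by (rule Fubini'[symmetric]) measurable
  also have "\<dots> = (\<integral>\<^sup>+y. ennreal (normal_density 0 s y) * (\<integral>\<^sup>+z. f (S (y - ip z) z) \<partial>gauss_vec I s) \<partial>lborel)"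
    unfolding F_def ip_S
    by (intro nn_integral_cong, subst mult.commute, simp, intro nn_integral_cmult) measurable
  also have "\<dots> = (\<integral>\<^sup>+y. \<integral>\<^sup>+z. f (S (y - ip z) z) \<partial>gauss_vec I s \<partial>gauss s)"
    by (subst nn_integral_gauss) measurable
  finally show ?thesis
    by (simp add: S_def ip_def)
qed

text \<open>Redrawing the component along column \<open>r\<close> changes only coordinate
  \<open>r\<close> of the image, where it puts the fresh \<open>y\<close>, because the other columns
  are orthogonal to that column. Coordinates therefore split off one at a time, with no completion
  of \<open>P\<close> to an orthogonal matrix.\<close>

lemma gauss_orthonormal:
  assumes s: "0 < s" and fin: "finite I"
    and orth: "\<And>j k. j < r \<Longrightarrow> k < r \<Longrightarrow> (\<Sum>l\<in>I. P l j * P l k) = (if j = k then 1 else 0)"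
    and f: "f \<in> borel_measurable (gauss_vec {..<r} s)"
  shows "(\<integral>\<^sup>+z. f (\<lambda>k\<in>{..<r}. \<Sum>l\<in>I. P l k * z l) \<partial>gauss_vec I s) = (\<integral>\<^sup>+x. f x \<partial>gauss_vec {..<r} s)"
  using orth f
proof (induction r arbitrary: f)
  case 0
  interpret PI: prob_space "gauss_vec I s" by (rule prob_space_gauss_vec[OF s])
  show ?case by (simp add: PiM_empty nn_integral_count_space_finite PI.emeasure_space_1)
next
  case (Suc r)
  interpret product_prob_space "\<lambda>_. gauss s" UNIV by (rule product_prob_space_gauss[OF s])
  interpret PI: prob_space "gauss_vec I s" by (rule prob_space_gauss_vec[OF s])
  have f[measurable]: "f \<in> borel_measurable (gauss_vec (insert r {..<r}) s)"
    using Suc.prems(2) by (simp add: lessThan_Suc)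
  define L where "L r z = (\<lambda>k\<in>{..<r}. \<Sum>l\<in>I. P l k * z l)" for r and z :: "nat \<Rightarrow> real"
  have L_meas[measurable]: "L r \<in> measurable (gauss_vec I s) (gauss_vec {..<r} s)" for r
    unfolding L_def by (rule measurable_restrict) measurable
  have upd_meas: "(\<lambda>x. f (x(r := y))) \<in> borel_measurable (gauss_vec {..<r} s)" for y
    by measurable
  have a: "(\<Sum>l\<in>I. (P l r)\<^sup>2) = 1"
    using Suc.prems(1)[of r r] by (simp add: power2_eq_square)
  have LS: "L (Suc r) (\<lambda>l\<in>I. z l + (y - (\<Sum>l\<in>I. P l r * z l)) * P l r) = (L r z)(r := y)" for z y
  proof
    fix k
    define c where "c = y - (\<Sum>l\<in>I. P l r * z l)"
    have "(\<Sum>l\<in>I. P l k * (\<lambda>l\<in>I. z l + c * P l r) l) = (\<Sum>l\<in>I. P l k * z l) + c * (\<Sum>l\<in>I. P l k * P l r)" for k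
    proof -
      have "(\<Sum>l\<in>I. P l k * (\<lambda>l\<in>I. z l + c * P l r) l) = (\<Sum>l\<in>I. P l k * z l + c * (P l k * P l r))"
        by (intro sum.cong) (auto simp: algebra_simps)
      then show ?thesis by (simp add: sum.distrib sum_distrib_left)
    qed
    then show "L (Suc r) (\<lambda>l\<in>I. z l + (y - (\<Sum>l\<in>I. P l r * z l)) * P l r) k = ((L r z)(r := y)) k"
      using Suc.prems(1)[of k r] unfolding c_def[symmetric]
      by (auto simp: L_def c_def less_Suc_eq)
  qed
  have "(\<integral>\<^sup>+z. f (L (Suc r) z) \<partial>gauss_vec I s) = (\<integral>\<^sup>+y. \<integral>\<^sup>+z. f ((L r z)(r := y)) \<partial>gauss_vec I s \<partial>gauss s)"
    using L_meas[of "Suc r"] f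
    by (subst gauss_resample[OF s fin a]) (simp_all add: LS lessThan_Suc)
  also have "\<dots> = (\<integral>\<^sup>+y. \<integral>\<^sup>+x. f (x(r := y)) \<partial>gauss_vec {..<r} s \<partial>gauss s)"
    unfolding L_def by (intro nn_integral_cong Suc.IH Suc.prems(1) upd_meas) auto
  also have "\<dots> = (\<integral>\<^sup>+x. f x \<partial>gauss_vec {..<Suc r} s)"
    unfolding lessThan_Suc by (subst product_nn_integral_insert_rev) simp_all
  finally show ?case unfolding L_def .
qed

section \<open>Anti-concentration of Gaussian maxima\<close>

text \<open>Chernoff's bound read off from the shift by \<open>x * a\<close>: its density is at
  least \<open>exp (x\<^sup>2 / (2 * s\<^sup>2))\<close> on the event and has total mass 1.\<close>

lemma gauss_tail:
  assumes s: "0 < s" and fin: "finite I" and a: "(\<Sum>l\<in>I. (a l)\<^sup>2) \<le> 1" and x: "0 \<le> x"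
  shows "measure (gauss_vec I s) {z \<in> space (gauss_vec I s). x < (\<Sum>l\<in>I. a l * z l)} \<le> exp (- x\<^sup>2 / (2 * s\<^sup>2))"
proof -
  interpret PI: prob_space "gauss_vec I s" by (rule prob_space_gauss_vec[OF s])
  define S where "S = {z \<in> space (gauss_vec I s). x < (\<Sum>l\<in>I. a l * z l)}"
  have [measurable]: "S \<in> sets (gauss_vec I s)" unfolding S_def by measurable
  let ?e = "\<lambda>z. (\<Sum>l\<in>I. (x * a l) * z l) / s\<^sup>2 - (\<Sum>l\<in>I. (x * a l)\<^sup>2) / (2 * s\<^sup>2)"
  have le: "x\<^sup>2 / (2 * s\<^sup>2) \<le> ?e z" if "z \<in> S" for z
  proof -
    have "x * x \<le> x * (\<Sum>l\<in>I. a l * z l)"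
      using that x by (intro mult_left_mono) (auto simp: S_def)
    moreover have "(\<Sum>l\<in>I. (x * a l)\<^sup>2) \<le> x\<^sup>2 * 1"
      unfolding power_mult_distrib sum_distrib_left[symmetric] using a by (intro mult_left_mono) auto
    moreover have "(\<Sum>l\<in>I. (x * a l) * z l) = x * (\<Sum>l\<in>I. a l * z l)"
      by (simp add: sum_distrib_left ac_simps)
    ultimately have "x\<^sup>2 / s\<^sup>2 \<le> (\<Sum>l\<in>I. (x * a l) * z l) / s\<^sup>2"
      "(\<Sum>l\<in>I. (x * a l)\<^sup>2) / (2 * s\<^sup>2) \<le> x\<^sup>2 / (2 * s\<^sup>2)"
      by (auto intro!: divide_right_mono simp: power2_eq_square)
    then show ?thesis by simp
  qed
  have "ennreal (exp (x\<^sup>2 / (2 * s\<^sup>2))) * emeasure (gauss_vec I s) S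
      = (\<integral>\<^sup>+z. ennreal (exp (x\<^sup>2 / (2 * s\<^sup>2))) * indicator S z \<partial>gauss_vec I s)"
    by (simp add: nn_integral_cmult_indicator)
  also have "\<dots> \<le> (\<integral>\<^sup>+z. 1 * ennreal (exp (?e z)) \<partial>gauss_vec I s)"
    using le by (intro nn_integral_mono) (auto simp: indicator_def intro!: ennreal_leI)
  also have "\<dots> = 1"
    using cameron_martin[OF s fin, of "\<lambda>_. 1" "\<lambda>l. x * a l"] by (simp add: PI.emeasure_space_1)
  finally have "ennreal (exp (x\<^sup>2 / (2 * s\<^sup>2)) * measure (gauss_vec I s) S) \<le> 1"
    by (simp add: PI.emeasure_eq_measure ennreal_mult)
  then have "exp (x\<^sup>2 / (2 * s\<^sup>2)) * measure (gauss_vec I s) S \<le> 1"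
    by (simp add: ennreal_le_1)
  then show ?thesis
    unfolding S_def[symmetric] by (simp add: exp_minus field_simps)
qed

text \<open>Translating by \<open>c * a i\<close> raises \<open>W i\<close> by \<open>c\<close> and no other \<open>W j\<close> by more than that, so the event
  that the maximum is attained at \<open>i\<close> with value in a window is carried into the same event for the
  window moved by \<open>c\<close>, at the cost of a bounded Cameron--Martin density. Disjointness of the
  windows then bounds the mass of the first one; this replaces Nazarov's surface-area bound.\<close>

lemma gauss_max_anticoncentration:
  fixes g :: "'i \<Rightarrow> nat \<Rightarrow> real"
  assumes s: "0 < s" and fin: "finite I" and J: "finite J" and lo: "0 < lo" and h: "0 < h"
    and g: "\<And>i. i \<in> J \<Longrightarrow> lo\<^sup>2 \<le> (\<Sum>l\<in>I. (g i l)\<^sup>2)"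
  shows "measure (gauss_vec I s) {z \<in> space (gauss_vec I s).
      (\<exists>i\<in>J. x < (\<Sum>l\<in>I. g i l * z l)) \<and> (\<forall>i\<in>J. (\<Sum>l\<in>I. g i l * z l) \<le> x + h)}
    \<le> exp (3/2) * (h / lo) * (2 * \<bar>x\<bar> / lo + h / lo + s) / s\<^sup>2"
proof -
  interpret PI: prob_space "gauss_vec I s" by (rule prob_space_gauss_vec[OF s])
  let ?G = "gauss_vec I s" and ?g = "\<lambda>i z. \<Sum>l\<in>I. g i l * z l"
  let ?E = "{z \<in> space ?G. (\<exists>i\<in>J. x < ?g i z) \<and> (\<forall>i\<in>J. ?g i z \<le> x + h)}"
  define N where "N i = sqrt (\<Sum>l\<in>I. (g i l)\<^sup>2)" for i
  define a where "a i l = g i l / N i" for i l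
  define ip where "ip i z = (\<Sum>l\<in>I. a i l * z l)" for i and z :: "nat \<Rightarrow> real"
  \<comment> \<open>The added constant aligns rows of different norms: if G is the sum for row
    \<open>i\<close>, then \<open>W i z\<close> is \<open>x / lo\<close> plus (G - x) /
    \<open>N i\<close>. So \<open>W i z\<close> exceeds \<open>x / lo\<close> exactly when row
    \<open>i\<close> exceeds \<open>x\<close>, and a window of width \<open>h\<close> becomes one of
    width at most \<open>h / lo\<close>.\<close>
  define W where "W i z = ip i z + x * (1 / lo - 1 / N i)" for i and z :: "nat \<Rightarrow> real"
  have ip_meas[measurable]: "ip i \<in> borel_measurable ?G" for i
    unfolding ip_def by measurable
  have W_meas[measurable]: "W i \<in> borel_measurable ?G" for i
    unfolding W_def by measurable
  have N_lo: "lo \<le> N i" if "i \<in> J" for i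
    unfolding N_def using g[OF that] lo by (intro real_le_rsqrt) auto
  have N_pos: "0 < N i" if "i \<in> J" for i using N_lo[OF that] lo by simp
  have N_sq: "(N i)\<^sup>2 = (\<Sum>l\<in>I. (g i l)\<^sup>2)" for i
    unfolding N_def by (simp add: sum_nonneg)
  have a_sq: "(\<Sum>l\<in>I. (a i l)\<^sup>2) = 1" if "i \<in> J" for i
    using N_pos[OF that] by (simp add: a_def power_divide sum_divide_distrib[symmetric] N_sq[symmetric])
  have a_prod: "(\<Sum>l\<in>I. a i l * a j l) \<le> 1" if "i \<in> J" "j \<in> J" for i j
  proof -
    have "(\<Sum>l\<in>I. a i l * a j l) \<le> (\<Sum>l\<in>I. ((a i l)\<^sup>2 + (a j l)\<^sup>2) / 2)"
    proof (rule sum_mono)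
      fix l
      show "a i l * a j l \<le> ((a i l)\<^sup>2 + (a j l)\<^sup>2) / 2"
        using sum_squares_bound[of "a i l" "a j l"] by simp
    qed
    also have "\<dots> = 1"
      using a_sq that by (simp add: sum_divide_distrib[symmetric] sum.distrib)
    finally show ?thesis .
  qed
  \<comment> \<open>Ties between maximising rows are broken in favour of the smallest
    \<open>e i\<close>; this makes the events \<open>A u i\<close> disjoint in
    \<open>i\<close>.\<close>
  obtain e :: "'i \<Rightarrow> nat" where e: "inj_on e J"
    using finite_imp_inj_to_nat_seg[OF J] by blast
  define x' where "x' = x / lo"
  define h' where "h' = h / lo"
  have h': "0 < h'" using h lo by (simp add: h'_def)
  define A where "A u i = {z \<in> space ?G. u < W i z \<and> W i z \<le> u + h' \<and>
      (\<forall>j\<in>J. W j z \<le> W i z \<and> (e j < e i \<longrightarrow> W j z < W i z))}" for u i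
  have A_meas[measurable]: "A u i \<in> sets ?G" for u i
  proof -
    have le: "Measurable.pred ?G (\<lambda>z. W j z \<le> W i z)" for j
      unfolding linorder_not_less[symmetric] by (intro pred_intros_logic borel_measurable_pred_less W_meas)
    have lt: "Measurable.pred ?G (\<lambda>z. e j < e i \<longrightarrow> W j z < W i z)" for j
      using borel_measurable_pred_less[OF W_meas W_meas] by (cases "e j < e i") simp_all
    have "Measurable.pred ?G (\<lambda>z. \<forall>j\<in>J. W j z \<le> W i z \<and> (e j < e i \<longrightarrow> W j z < W i z))"
      using J by (intro pred_intros_finite pred_intros_logic le lt)
    then show ?thesis
      unfolding A_def by measurable
  qed
  \<comment> \<open>An upper bound for \<open>ip i z\<close> on \<open>A x' i\<close>: at most
    \<open>\<bar>x'\<bar> + h'\<close> from the window, and \<open>\<bar>x'\<bar>\<close> for the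
    aligning constant. An upper bound is enough because all shifts \<open>c\<close> are
    nonnegative.\<close>
  define R where "R = 2 * \<bar>x'\<bar> + h'"
  have R: "0 < R" using h' by (simp add: R_def)
  have shift: "exp (- (c * R + c\<^sup>2 / 2) / s\<^sup>2) * measure ?G (A x' i) \<le> measure ?G (A (x' + c) i)"
    if i: "i \<in> J" and c: "0 \<le> c" for i c
  proof -
    define S where "S z = (\<lambda>l\<in>I. z l + c * a i l)" for z :: "nat \<Rightarrow> real"
    have ip_S: "ip j (S z) = ip j z + c * (\<Sum>l\<in>I. a j l * a i l)" for j z
    proof -
      have "ip j (S z) = (\<Sum>l\<in>I. a j l * z l + c * (a j l * a i l))"
        unfolding ip_def S_def by (intro sum.cong) (auto simp: algebra_simps)
      then show ?thesis by (simp add: ip_def sum.distrib sum_distrib_left)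
    qed
    have W_S: "W j (S z) \<le> W j z + c" if "j \<in> J" for j z
      using a_prod[OF that i] c mult_left_mono[of "\<Sum>l\<in>I. a j l * a i l" 1 c] by (simp add: W_def ip_S)
    have ip_Si: "ip i (S z) = ip i z + c" for z
      unfolding ip_S using a_sq[OF i] by (simp add: power2_eq_square)
    then have W_Si: "W i (S z) = W i z + c" for z by (simp add: W_def)
    have S_A: "S z \<in> A (x' + c) i" if "z \<in> A x' i" for z
    proof -
      have "S z \<in> space ?G" by (simp add: S_def space_PiM)
      moreover have "W j (S z) \<le> W i (S z) \<and> (e j < e i \<longrightarrow> W j (S z) < W i (S z))" if "j \<in> J" for j
        using \<open>z \<in> A x' i\<close> W_S[OF that, of z] W_Si[of z] that by (force simp: A_def)
      ultimately show ?thesis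
        using that W_Si[of z] by (simp add: A_def)
    qed
    have R_le: "ip i z \<le> R" if "z \<in> A x' i" for z
    proof -
      have "\<bar>1 / lo - 1 / N i\<bar> \<le> 1 / lo"
        using N_lo[OF i] N_pos[OF i] lo by (simp add: abs_le_iff frac_le)
      then have "\<bar>x\<bar> * \<bar>1 / lo - 1 / N i\<bar> \<le> \<bar>x\<bar> * (1 / lo)"
        by (intro mult_left_mono) auto
      then have "\<bar>x * (1 / lo - 1 / N i)\<bar> \<le> \<bar>x'\<bar>"
        using lo by (simp add: x'_def abs_mult)
      moreover have "W i z \<le> x' + h'" using that by (simp add: A_def)
      ultimately show ?thesis unfolding W_def R_def by linarith
    qed
    let ?k = "\<lambda>z. c * ip i z / s\<^sup>2 - c\<^sup>2 / (2 * s\<^sup>2)"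
    \<comment> \<open>The factor \<open>exp (- ?k z)\<close> cancels the density of the shift, so
      \<open>cameron_martin\<close> leaves the plain measure of the moved event.\<close>
    let ?f = "\<lambda>z. indicator (A (x' + c) i) z * ennreal (exp (- ?k z))"
    have f: "?f \<in> borel_measurable ?G" by measurable
    have sq: "(\<Sum>l\<in>I. (c * a i l)\<^sup>2) = c\<^sup>2"
      by (simp add: power_mult_distrib sum_distrib_left[symmetric] a_sq[OF i])
    have lin: "(\<Sum>l\<in>I. c * a i l * z l) = c * ip i z" for z
      by (simp add: ip_def sum_distrib_left ac_simps)
    have kS: "- (c * R + c\<^sup>2 / 2) / s\<^sup>2 \<le> - ?k (S z)" if "z \<in> A x' i" for z
    proof -
      have "c * ip i z \<le> c * R" using R_le[OF that] c by (intro mult_left_mono)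
      then have "(c * ip i z + c\<^sup>2 / 2) / s\<^sup>2 \<le> (c * R + c\<^sup>2 / 2) / s\<^sup>2"
        by (intro divide_right_mono) auto
      moreover have "?k (S z) = (c * ip i z + c\<^sup>2 / 2) / s\<^sup>2"
        using s by (simp add: ip_Si field_simps power2_eq_square)
      ultimately show ?thesis by (simp only: minus_divide_left[symmetric] neg_le_iff_le)
    qed
    have "ennreal (exp (- (c * R + c\<^sup>2 / 2) / s\<^sup>2)) * emeasure ?G (A x' i)
        = (\<integral>\<^sup>+z. ennreal (exp (- (c * R + c\<^sup>2 / 2) / s\<^sup>2)) * indicator (A x' i) z \<partial>?G)"
      by (simp add: nn_integral_cmult_indicator)
    also have "\<dots> \<le> (\<integral>\<^sup>+z. ?f (S z) \<partial>?G)"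
    proof (rule nn_integral_mono)
      fix z
      show "ennreal (exp (- (c * R + c\<^sup>2 / 2) / s\<^sup>2)) * indicator (A x' i) z \<le> ?f (S z)"
        using S_A[of z] kS[of z] by (cases "z \<in> A x' i") (auto intro!: ennreal_leI)
    qed
    also have "\<dots> = (\<integral>\<^sup>+z. ?f z * ennreal (exp (?k z)) \<partial>?G)"
      using cameron_martin[OF s fin f, of "\<lambda>l. c * a i l"] unfolding S_def sq lin .
    also have "\<dots> = (\<integral>\<^sup>+z. indicator (A (x' + c) i) z \<partial>?G)"
      by (intro nn_integral_cong) (simp add: mult.assoc ennreal_mult[symmetric] exp_add[symmetric])
    also have "\<dots> = emeasure ?G (A (x' + c) i)" by simp
    finally show ?thesis
      by (simp add: PI.emeasure_eq_measure ennreal_mult[symmetric])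
  qed
  \<comment> \<open>A range of displacements of bounded cost: \<open>c0 * R \<le> s\<^sup>2\<close>
    and \<open>c0 \<le> s\<close> give \<open>c * R + c\<^sup>2 / 2 \<le> 3/2 * s\<^sup>2\<close>
    for \<open>c \<le> c0\<close>. This is the origin of \<open>exp (3/2)\<close>.\<close>
  define c0 where "c0 = s\<^sup>2 / (R + s)"
  have c0: "0 < c0" using s R by (simp add: c0_def)
  \<comment> \<open>\<open>K\<close> adjacent windows of width \<open>h'\<close> start at
    displacements of at most \<open>c0\<close>. Each carries at least \<open>exp (- (3/2))\<close>
    times the mass of the unshifted one, and their total mass is at most 1.\<close>
  define K where "K = nat \<lfloor>c0 / h'\<rfloor> + 1"
  have K_ge: "c0 / h' \<le> real K" unfolding K_def by linarith
  have q: "exp (- (3/2)) \<le> exp (- ((real k * h') * R + (real k * h')\<^sup>2 / 2) / s\<^sup>2)" if "k < K" for k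
  proof -
    have "real k \<le> c0 / h'"
      using that c0 h' unfolding K_def by (simp add: less_Suc_eq_le le_nat_floor le_nat_iff le_floor_iff)
    then have le: "real k * h' \<le> c0" using h' by (simp add: field_simps)
    have c0R: "c0 * R \<le> s\<^sup>2"
      using s R by (simp add: c0_def field_simps)
    have "c0 \<le> s" using s R by (simp add: c0_def field_simps power2_eq_square)
    then have "(real k * h')\<^sup>2 \<le> s\<^sup>2" using le h' by (intro power_mono) auto
    moreover have "(real k * h') * R \<le> s\<^sup>2"
      using mult_right_mono[OF le less_imp_le[OF R]] c0R by linarith
    ultimately have "((real k * h') * R + (real k * h')\<^sup>2 / 2) \<le> 3/2 * s\<^sup>2" by simp
    then have "((real k * h') * R + (real k * h')\<^sup>2 / 2) / s\<^sup>2 \<le> 3/2"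
      using s by (simp add: divide_le_eq)
    then show ?thesis by (simp only: minus_divide_left[symmetric] neg_le_iff_le exp_le_cancel_iff)
  qed
  define E where "E = (\<Sum>i\<in>J. measure ?G (A x' i))"
  have E0: "0 \<le> E" by (simp add: E_def sum_nonneg)
  have disj: "disjoint_family_on (\<lambda>(k, i). A (x' + real k * h') i) ({..<K} \<times> J)"
    unfolding disjoint_family_on_def
  proof (intro ballI impI equals0I)
    fix p q z
    assume pq: "p \<in> {..<K} \<times> J" "q \<in> {..<K} \<times> J" "p \<noteq> q"
      and z: "z \<in> (case p of (k, i) \<Rightarrow> A (x' + real k * h') i) \<inter> (case q of (k, i) \<Rightarrow> A (x' + real k * h') i)"
    obtain k i k' i' where p: "p = (k, i)" and q: "q = (k', i')" by (cases p, cases q)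
    have *: "i \<in> J" "i' \<in> J" "z \<in> A (x' + real k * h') i" "z \<in> A (x' + real k' * h') i'"
      using pq z by (auto simp: p q)
    have "\<not> e i < e i'" "\<not> e i' < e i" using * by (force simp: A_def)+
    then have ii: "i = i'" using e * by (metis inj_onD linorder_neqE_nat)
    have kk: "k = k'"
    proof (rule ccontr)
      assume "k \<noteq> k'"
      have lt: False if "k1 < k2" "z \<in> A (x' + real k1 * h') i" "z \<in> A (x' + real k2 * h') i" for k1 k2
      proof -
        have "(real k1 + 1) * h' \<le> real k2 * h'" using that(1) h' by (intro mult_right_mono) auto
        then show False using that(2,3) by (simp add: A_def algebra_simps)
      qed
      show False using lt[of k k'] lt[of k' k] * \<open>k \<noteq> k'\<close> ii by (cases "k < k'") auto
    qed
    show False using ii kk pq(3) by (simp add: p q)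
  qed
  have "exp (- (3/2)) * (c0 / h') * E \<le> exp (- (3/2)) * real K * E"
    using K_ge E0 by (intro mult_right_mono mult_left_mono) auto
  also have "\<dots> = (\<Sum>k<K. \<Sum>i\<in>J. exp (- (3/2)) * measure ?G (A x' i))"
    by (simp add: E_def sum_distrib_left mult.assoc mult.left_commute)
  also have "\<dots> \<le> (\<Sum>k<K. \<Sum>i\<in>J. measure ?G (A (x' + real k * h') i))"
  proof (intro sum_mono)
    fix k i assume "k \<in> {..<K}" "i \<in> J"
    then show "exp (- (3/2)) * measure ?G (A x' i) \<le> measure ?G (A (x' + real k * h') i)"
      using shift[of i "real k * h'"] q[of k] h'
      by (intro order_trans[OF mult_right_mono[OF q[of k]]]) auto
  qed
  also have "\<dots> = (\<Sum>p\<in>{..<K} \<times> J. measure ?G (case p of (k, i) \<Rightarrow> A (x' + real k * h') i))"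
    by (simp add: sum.cartesian_product case_prod_beta)
  also have "\<dots> = measure ?G (\<Union>p\<in>{..<K} \<times> J. case p of (k, i) \<Rightarrow> A (x' + real k * h') i)"
    using J disj by (intro PI.finite_measure_finite_Union[symmetric]) auto
  also have "\<dots> \<le> 1" by simp
  finally have E_le: "E \<le> exp (3/2) * h' / c0"
    using c0 h' by (simp add: exp_minus field_simps)
  have "measure ?G ?E
      \<le> measure ?G (\<Union>i\<in>J. A x' i)"
  proof (rule PI.finite_measure_mono)
    show "(\<Union>i\<in>J. A x' i) \<in> sets ?G" using J A_meas by (intro sets.finite_UN) auto
    show "?E \<subseteq> (\<Union>i\<in>J. A x' i)"
    proof safe
      fix z i0
      assume z: "z \<in> space ?G" and i0: "i0 \<in> J" "x < ?g i0 z"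
        and le: "\<forall>i\<in>J. ?g i z \<le> x + h"
      have W_eq: "W i z = x' + (?g i z - x) / N i" for i
        by (simp add: W_def ip_def a_def x'_def sum_divide_distrib diff_divide_distrib right_diff_distrib)
      have W_le: "W i z \<le> x' + h'" if "i \<in> J" for i
      proof -
        have "(?g i z - x) / N i \<le> h / N i"
          using le that N_pos[OF that] by (intro divide_right_mono) (auto simp: algebra_simps)
        also have "\<dots> \<le> h / lo" using N_lo[OF that] lo h by (intro divide_left_mono) auto
        finally show ?thesis by (simp add: W_eq h'_def)
      qed
      define w where "w = Max ((\<lambda>i. W i z) ` J)"
      have w_ge: "W i z \<le> w" if "i \<in> J" for i unfolding w_def using J that by (intro Max_ge) auto
      define T where "T = {i \<in> J. W i z = w}"
      have "w \<in> (\<lambda>i. W i z) ` J" unfolding w_def using J i0 by (intro Max_in) auto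
      then have "T \<noteq> {}" by (auto simp: T_def)
      then obtain i where i: "i \<in> T" "\<And>j. j \<in> T \<Longrightarrow> e i \<le> e j"
      proof -
        have fT: "finite T" using J by (simp add: T_def)
        have "Min (e ` T) \<in> e ` T" using fT \<open>T \<noteq> {}\<close> by (intro Min_in) auto
        then obtain i where "i \<in> T" "e i = Min (e ` T)" by auto
        then show ?thesis using that[of i] fT by simp
      qed
      have "x' < W i0 z" using i0 N_pos[of i0] by (simp add: W_eq)
      then have "x' < W i z" using w_ge[OF i0(1)] i(1) by (simp add: T_def)
      moreover have "W j z \<le> W i z \<and> (e j < e i \<longrightarrow> W j z < W i z)" if "j \<in> J" for j
        using w_ge[OF that] i(1) i(2)[of j] that by (auto simp: T_def order.strict_iff_order)
      ultimately have "z \<in> A x' i"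
        using W_le[of i] z i(1) by (auto simp: A_def T_def)
      then show "z \<in> (\<Union>i\<in>J. A x' i)" using i(1) by (auto simp: T_def)
    qed
  qed
  also have "\<dots> \<le> E"
    unfolding E_def using J by (intro PI.finite_measure_subadditive_finite) auto
  also note E_le
  also have "exp (3/2) * h' / c0 = exp (3/2) * (h / lo) * (2 * \<bar>x\<bar> / lo + h / lo + s) / s\<^sup>2"
    using lo by (simp add: c0_def R_def h'_def x'_def)
  finally show ?thesis .
qed

section \<open>Lindeberg replacement\<close>

lemma abs_integral_diff_le:
  fixes f g :: "'a \<Rightarrow> real"
  assumes M: "prob_space M" and fg: "integrable M f" "integrable M g"
    and le: "\<And>x. x \<in> space M \<Longrightarrow> \<bar>f x - g x\<bar> \<le> c"
  shows "\<bar>integral\<^sup>L M f - integral\<^sup>L M g\<bar> \<le> c"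
proof -
  interpret prob_space M by fact
  have "\<bar>integral\<^sup>L M f - integral\<^sup>L M g\<bar> = \<bar>\<integral>x. f x - g x \<partial>M\<bar>" using fg by simp
  also have "\<dots> \<le> (\<integral>x. \<bar>f x - g x\<bar> \<partial>M)" by (rule integral_abs_bound)
  also have "\<dots> \<le> c"
    using fg le by (intro integral_le_const) auto
  finally show ?thesis .
qed

definition third_moment_law :: "real measure \<Rightarrow> bool" where
  "third_moment_law D \<longleftrightarrow> prob_space D \<and> sets D = sets borel \<and> integrable D (\<lambda>x. \<bar>x\<bar> ^ 3)
    \<and> integrable D (\<lambda>x. x) \<and> integrable D (\<lambda>x. x\<^sup>2)"

lemma third_moment_lawD:
  assumes "third_moment_law D"
  shows "prob_space D" "sets D = sets borel" "integrable D (\<lambda>x. \<bar>x\<bar> ^ 3)" "integrable D (\<lambda>x. x)" "integrable D (\<lambda>x. x\<^sup>2)"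
  using assms by (auto simp: third_moment_law_def)

text \<open>A quadratic in one coordinate has the same integral under two laws with equal first and
  second moments, so exchanging the law of that coordinate costs only the cubic remainder. The
  coefficients are existential and may depend on the other coordinates; they are used only
  pointwise, so nothing has to be known about their measurability.\<close>

lemma lindeberg_swap:
  fixes D D' :: "real measure" and f :: "(nat \<Rightarrow> real) \<Rightarrow> real"
  assumes law: "third_moment_law D"
    and law': "third_moment_law D'"
    and mean: "(\<integral>x. x \<partial>D) = (\<integral>x. x \<partial>D')" and var: "(\<integral>x. x\<^sup>2 \<partial>D) = (\<integral>x. x\<^sup>2 \<partial>D')"
    and "finite I" "f \<in> borel_measurable (PiM I (\<lambda>_. borel))" "\<And>x. \<bar>f x\<bar> \<le> 1"
    and "\<And>l x. l \<in> I \<Longrightarrow> \<exists>a b c. \<forall>s. \<bar>f (x(l := s)) - (a + b * s + c * s\<^sup>2)\<bar> \<le> K l * \<bar>s\<bar> ^ 3"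
  shows "\<bar>(\<integral>x. f x \<partial>iid I D) - (\<integral>x. f x \<partial>iid I D')\<bar>
    \<le> (\<Sum>l\<in>I. K l) * (third_moment D + third_moment D')"
  using assms(5-8)
proof (induction I arbitrary: f rule: finite_induct)
  case empty
  then show ?case by (simp add: PiM_empty)
next
  case (insert i I)
  note D = third_moment_lawD[OF law] and D' = third_moment_lawD[OF law']
  interpret D: prob_space D by (rule D)
  interpret D': prob_space D' by (rule D')
  interpret PD: product_prob_space "\<lambda>_. D" UNIV by (intro product_prob_spaceI D)
  interpret PD': product_prob_space "\<lambda>_. D'" UNIV by (intro product_prob_spaceI D')
  have P: "prob_space (iid J D)" "prob_space (iid J D')" for J
    using D D' by (auto intro!: prob_space_PiM)
  interpret ID: prob_space "iid I D" by (rule P)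
  interpret ID': prob_space "iid I D'" by (rule P)
  note [measurable_cong] = D(2) D'(2)
  note [measurable] = insert.prems(1)
  define m where "m = third_moment D + third_moment D'"
  have bdd: "\<bar>f x\<bar> \<le> 1" for x by (rule insert.prems(2))
  have int_insert: "integrable (iid (insert i I) D) f" "integrable (iid (insert i I) D') f"
    using P[THEN prob_space.finite_measure] bdd by (auto intro!: finite_measure.integrable_const_bound[where B=1])
  have upd_meas: "(\<lambda>x. f (x(i := y))) \<in> borel_measurable (PiM I (\<lambda>_. borel))" for y by measurable
  have upd_meas': "(\<lambda>y. f (x(i := y))) \<in> borel_measurable borel" if "x \<in> space (PiM I (\<lambda>_. borel))" for x
    using measurable_comp[OF measurable_component_update[OF that] insert.prems(1)] insert.hyps by (simp add: comp_def)
  have int1: "integrable D (\<lambda>y. f (x(i := y)))" "integrable D' (\<lambda>y. f (x(i := y)))" if "x \<in> space (PiM I (\<lambda>_. borel :: real measure))" for x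
    using upd_meas'[OF that] bdd by (auto intro!: D.integrable_const_bound[where B=1] D'.integrable_const_bound[where B=1])
  have sp: "space (iid I D) = space (PiM I (\<lambda>_. borel))" "space (iid I D') = space (PiM I (\<lambda>_. borel))"
    using D(2) D'(2) by (auto simp: space_PiM dest: sets_eq_imp_space_eq)
  have step: "\<bar>(\<integral>y. f (x(i := y)) \<partial>D) - (\<integral>y. f (x(i := y)) \<partial>D')\<bar> \<le> K i * m"
    if x: "x \<in> space (PiM I (\<lambda>_. borel))" for x
  proof -
    obtain a b c where abc: "\<And>s. \<bar>f (x(i := s)) - (a + b * s + c * s\<^sup>2)\<bar> \<le> K i * \<bar>s\<bar> ^ 3"
      using insert.prems(3)[of i x] by (meson insertI1)
    let ?q = "\<lambda>s. a + b * s + c * s\<^sup>2"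
    have one: "\<bar>(\<integral>y. f (x(i := y)) \<partial>E) - (a + b * (\<integral>x. x \<partial>E) + c * (\<integral>x. x\<^sup>2 \<partial>E))\<bar> \<le> K i * third_moment E"
      if "prob_space E" "integrable E (\<lambda>x. \<bar>x\<bar> ^ 3)" "integrable E (\<lambda>x. x)" "integrable E (\<lambda>x. x\<^sup>2)"
        "integrable E (\<lambda>y. f (x(i := y)))" for E :: "real measure"
    proof -
      interpret E: prob_space E by fact
      have q: "integrable E ?q" using that by simp
      have "(\<integral>s. ?q s \<partial>E) = a + b * (\<integral>x. x \<partial>E) + c * (\<integral>x. x\<^sup>2 \<partial>E)"
        using that by (simp add: E.prob_space)
      then have "\<bar>(\<integral>y. f (x(i := y)) \<partial>E) - (a + b * (\<integral>x. x \<partial>E) + c * (\<integral>x. x\<^sup>2 \<partial>E))\<bar>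
          = \<bar>\<integral>s. f (x(i := s)) - ?q s \<partial>E\<bar>"
        using that q by (simp add: E.prob_space)
      also have "\<dots> \<le> (\<integral>s. \<bar>f (x(i := s)) - ?q s\<bar> \<partial>E)" by (rule integral_abs_bound)
      also have "\<dots> \<le> (\<integral>s. K i * \<bar>s\<bar> ^ 3 \<partial>E)"
        using that q abc by (intro integral_mono) auto
      finally show ?thesis by simp
    qed
    show ?thesis
      using one[OF D(1,3-5) int1(1)[OF x]] one[OF D'(1,3-5) int1(2)[OF x]]
      unfolding mean var m_def by (simp add: distrib_left)
  qed
  \<comment> \<open>Freezing coordinate \<open>i\<close> gives a function of the same kind with the
    same constants \<open>K\<close>.\<close>
  have IH: "\<bar>(\<integral>x. f (x(i := y)) \<partial>iid I D) - (\<integral>x. f (x(i := y)) \<partial>iid I D')\<bar> \<le> (\<Sum>l\<in>I. K l) * m" for y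
    unfolding m_def
  proof (rule insert.IH)
    show "(\<lambda>x. f (x(i := y))) \<in> borel_measurable (PiM I (\<lambda>_. borel))" by (rule upd_meas)
    show "\<bar>f (x(i := y))\<bar> \<le> 1" for x by (rule bdd)
  next
    fix l and x :: "nat \<Rightarrow> real" assume l: "l \<in> I"
    then have "l \<noteq> i" using insert.hyps by auto
    show "\<exists>a b c. \<forall>s. \<bar>f (x(l := s, i := y)) - (a + b * s + c * s\<^sup>2)\<bar> \<le> K l * \<bar>s\<bar> ^ 3"
      unfolding fun_upd_twist[OF \<open>l \<noteq> i\<close>] using insert.prems(3)[of l "x(i := y)"] l by blast
  qed
  have int_pair: "integrable (iid I D \<Otimes>\<^sub>M D') (\<lambda>(x, y). f (x(i := y)))"
    "integrable (iid I D' \<Otimes>\<^sub>M D') (\<lambda>(x, y). f (x(i := y)))"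
  proof -
    interpret p1: pair_prob_space "iid I D" D' ..
    interpret p2: pair_prob_space "iid I D'" D' ..
    show "integrable (iid I D \<Otimes>\<^sub>M D') (\<lambda>(x, y). f (x(i := y)))"
      using bdd by (intro p1.integrable_const_bound[where B=1]) (auto, measurable)
    show "integrable (iid I D' \<Otimes>\<^sub>M D') (\<lambda>(x, y). f (x(i := y)))"
      using bdd by (intro p2.integrable_const_bound[where B=1]) (auto, measurable)
  qed
  interpret p1: pair_sigma_finite "iid I D" D' ..
  interpret p2: pair_sigma_finite "iid I D'" D' ..
  \<comment> \<open>The hybrid has law \<open>D\<close> on \<open>I\<close> and \<open>D'\<close> on
    \<open>i\<close>. Moving the integral over \<open>i\<close> outside lets \<open>IH\<close> act
    for each fixed \<open>y\<close>.\<close>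
  have swap: "(\<integral>x. (\<integral>y. f (x(i := y)) \<partial>D') \<partial>iid I D) = (\<integral>y. (\<integral>x. f (x(i := y)) \<partial>iid I D) \<partial>D')"
    "(\<integral>x. (\<integral>y. f (x(i := y)) \<partial>D') \<partial>iid I D') = (\<integral>y. (\<integral>x. f (x(i := y)) \<partial>iid I D') \<partial>D')"
    using p1.Fubini_integral[OF int_pair(1)] p2.Fubini_integral[OF int_pair(2)] by simp_all
  have "\<bar>(\<integral>x. (\<integral>y. f (x(i := y)) \<partial>D) \<partial>iid I D) - (\<integral>x. (\<integral>y. f (x(i := y)) \<partial>D') \<partial>iid I D)\<bar> \<le> K i * m"
  proof (rule abs_integral_diff_le[OF P(1)])
    interpret p3: pair_prob_space "iid I D" D ..
    have "integrable (iid I D \<Otimes>\<^sub>M D) (\<lambda>(x, y). f (x(i := y)))"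
      using bdd by (intro p3.integrable_const_bound[where B=1]) (auto, measurable)
    then show "integrable (iid I D) (\<lambda>x. \<integral>y. f (x(i := y)) \<partial>D)"
      using p3.integrable_fst by fastforce
    show "integrable (iid I D) (\<lambda>x. \<integral>y. f (x(i := y)) \<partial>D')"
      using p1.integrable_fst[OF int_pair(1)] by simp
  qed (use step sp in auto)
  moreover have "\<bar>(\<integral>y. (\<integral>x. f (x(i := y)) \<partial>iid I D) \<partial>D') - (\<integral>y. (\<integral>x. f (x(i := y)) \<partial>iid I D') \<partial>D')\<bar> \<le> (\<Sum>l\<in>I. K l) * m"
    using p1.integrable_snd[OF int_pair(1)] p2.integrable_snd[OF int_pair(2)] IH
    by (intro abs_integral_diff_le[OF D'(1)]) auto
  ultimately have "\<bar>(\<integral>x. f x \<partial>iid (insert i I) D) - (\<integral>x. f x \<partial>iid (insert i I) D')\<bar> \<le> K i * m + (\<Sum>l\<in>I. K l) * m"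
    unfolding PD.product_integral_insert[OF insert.hyps int_insert(1)] PD'.product_integral_insert[OF insert.hyps int_insert(2)]
    unfolding swap by linarith
  then show ?case
    using insert.hyps by (simp add: m_def distrib_right)
qed

text \<open>Each derivative is \<open>F\<close> times a polynomial in the sums \<open>S k\<close>,
  where \<open>\<bar>S k t\<bar> \<le> V ^ k * S 0 t\<close>, and \<open>s ^ j * exp (- s)\<close>
  is bounded for \<open>s \<ge> 0\<close>. The constant is therefore independent of the size of
  \<open>J\<close>, which keeps the number of rows out of the Lindeberg term.\<close>

lemma exp_neg_sum_exp_taylor:
  fixes u v :: "'i \<Rightarrow> real"
  assumes J: "finite J" and V: "0 \<le> V" and v: "\<And>i. i \<in> J \<Longrightarrow> \<bar>v i\<bar> \<le> V"
  shows "\<exists>a b c. \<forall>s. \<bar>exp (- (\<Sum>i\<in>J. exp (u i + v i * s))) - (a + b * s + c * s\<^sup>2)\<bar> \<le> 6 * V ^ 3 * \<bar>s\<bar> ^ 3"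
proof -
  define S where "S k s = (\<Sum>i\<in>J. v i ^ k * exp (u i + v i * s))" for k :: nat and s
  define F where "F s = exp (- S 0 s)" for s
  have dS: "(S k has_real_derivative S (Suc k) s) (at s)" for k s
    unfolding S_def by (auto intro!: derivative_eq_intros sum.cong simp: algebra_simps)
  define diff where "diff m s = (if m = 0 then F s else if m = 1 then - S 1 s * F s
     else if m = 2 then ((S 1 s)\<^sup>2 - S 2 s) * F s else (- (S 1 s ^ 3) + 3 * S 1 s * S 2 s - S 3 s) * F s)" for m :: nat and s
  have dF: "(F has_real_derivative - S 1 s * F s) (at s)" for s
    unfolding F_def by (auto intro!: derivative_eq_intros dS)
  have d: "(diff m has_real_derivative diff (Suc m) s) (at s)" if "m < 3" for m s
  proof -
    have "((\<lambda>s. - S 1 s * F s) has_real_derivative ((S 1 s)\<^sup>2 - S 2 s) * F s) (at s)"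
      using dS[of 1 s] by (auto intro!: derivative_eq_intros dF simp: numeral_2_eq_2 power2_eq_square algebra_simps)
    moreover have "((\<lambda>s. ((S 1 s)\<^sup>2 - S 2 s) * F s) has_real_derivative (- (S 1 s ^ 3) + 3 * S 1 s * S 2 s - S 3 s) * F s) (at s)"
      using dS[of 1 s] dS[of 2 s]
      by (auto intro!: derivative_eq_intros dF simp: numeral_2_eq_2 numeral_3_eq_3 power2_eq_square power3_eq_cube algebra_simps)
    ultimately show ?thesis
      using that dF[of s] unfolding diff_def by (cases "m = 0"; cases "m = 1"; cases "m = 2") (auto simp: numeral_2_eq_2)
  qed
  \<comment> \<open>34 = 27 + 3 * 2 + 1, from \<open>e3\<close>, \<open>e2\<close> and
    \<open>e1\<close>. Division by 3! then leaves a constant below 6.\<close>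
  have bound: "\<bar>diff 3 t\<bar> \<le> 34 * V ^ 3" for t
  proof -
    define s where "s = S 0 t"
    have s0: "0 \<le> s" unfolding s_def S_def by (intro sum_nonneg) auto
    have Sk: "\<bar>S k t\<bar> \<le> V ^ k * s" for k
    proof -
      have "\<bar>S k t\<bar> \<le> (\<Sum>i\<in>J. \<bar>v i ^ k * exp (u i + v i * t)\<bar>)" unfolding S_def by (rule sum_abs)
      also have "\<dots> \<le> (\<Sum>i\<in>J. V ^ k * exp (u i + v i * t))"
        using v by (intro sum_mono) (auto simp: abs_mult power_abs intro!: mult_right_mono power_mono)
      finally show ?thesis by (simp add: s_def S_def sum_distrib_left)
    qed
    have "s \<le> exp s" using exp_ge_add_one_self[of s] by linarith
    then have e1: "s * exp (- s) \<le> 1" by (simp add: exp_minus field_simps)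
    have e2: "s\<^sup>2 * exp (- s) \<le> 2" using exp_lower_Taylor_quadratic[OF s0] s0 by (simp add: exp_minus field_simps)
    have e3: "s ^ 3 * exp (- s) \<le> 27"
    proof -
      have "s / 3 \<le> exp (s / 3)" using exp_ge_add_one_self[of "s / 3"] by linarith
      then have "(s / 3) ^ 3 \<le> exp (s / 3) ^ 3" using s0 by (intro power_mono) auto
      also have "\<dots> = exp s" using exp_of_nat_mult[of 3 "s / 3"] by simp
      finally show ?thesis by (simp add: exp_minus field_simps)
    qed
    have "\<bar>- (S 1 t ^ 3) + 3 * S 1 t * S 2 t - S 3 t\<bar> \<le> \<bar>S 1 t\<bar> ^ 3 + 3 * (\<bar>S 1 t\<bar> * \<bar>S 2 t\<bar>) + \<bar>S 3 t\<bar>"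
      by (simp add: abs_mult[symmetric] power_abs[symmetric])
    also have "\<dots> \<le> (V * s) ^ 3 + 3 * ((V * s) * (V\<^sup>2 * s)) + V ^ 3 * s"
      using Sk[of 1] Sk[of 2] Sk[of 3] V s0 by (intro add_mono mult_mono power_mono mult_left_mono) auto
    also have "\<dots> = V ^ 3 * (s ^ 3 + 3 * s\<^sup>2 + s)" by (simp add: algebra_simps power2_eq_square power3_eq_cube)
    finally have "\<bar>diff 3 t\<bar> \<le> V ^ 3 * (s ^ 3 + 3 * s\<^sup>2 + s) * exp (- s)"
      unfolding diff_def F_def s_def by (simp add: abs_mult)
    also have "\<dots> = V ^ 3 * (s ^ 3 * exp (- s) + 3 * (s\<^sup>2 * exp (- s)) + s * exp (- s))" by (simp add: algebra_simps)
    also have "\<dots> \<le> V ^ 3 * 34" using e1 e2 e3 V by (intro mult_left_mono) auto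
    finally show ?thesis by simp
  qed
  have "\<bar>F s - (F 0 + (- S 1 0 * F 0) * s + (((S 1 0)\<^sup>2 - S 2 0) * F 0 / 2) * s\<^sup>2)\<bar> \<le> 6 * V ^ 3 * \<bar>s\<bar> ^ 3" for s
  proof -
    have diff0: "diff 0 = F" by (simp add: diff_def fun_eq_iff)
    obtain t where t: "F s = (\<Sum>m<3. diff m 0 / fact m * s ^ m) + diff 3 t / fact 3 * s ^ 3"
      using Maclaurin_bi_le[where diff=diff and f=F and x=s and n=3, OF diff0] d by blast
    have "(\<Sum>m<3. diff m 0 / fact m * s ^ m) = F 0 + (- S 1 0 * F 0) * s + (((S 1 0)\<^sup>2 - S 2 0) * F 0 / 2) * s\<^sup>2"
      by (simp add: diff_def eval_nat_numeral)
    then have "\<bar>F s - (F 0 + (- S 1 0 * F 0) * s + (((S 1 0)\<^sup>2 - S 2 0) * F 0 / 2) * s\<^sup>2)\<bar> = \<bar>diff 3 t\<bar> * \<bar>s\<bar> ^ 3 / 6"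
      using t by (simp add: abs_mult power_abs fact_numeral)
    also have "\<dots> \<le> (34 * V ^ 3) * \<bar>s\<bar> ^ 3 / 6"
      using bound[of t] by (intro divide_right_mono mult_right_mono) auto
    also have "\<dots> \<le> 6 * V ^ 3 * \<bar>s\<bar> ^ 3" using V by (simp add: field_simps)
    finally show ?thesis .
  qed
  moreover have "exp (- (\<Sum>i\<in>J. exp (u i + v i * s))) = F s" for s
    by (simp add: F_def S_def)
  ultimately show ?thesis by (simp only:) blast
qed

section \<open>Tails of weighted error sums\<close>

lemma integrable_lower_moment:
  fixes D :: "real measure"
  assumes D: "prob_space D" "sets D = sets borel" and m: "integrable D (\<lambda>x. \<bar>x\<bar> powr m)" "real k \<le> m"
  shows "integrable D (\<lambda>x. \<bar>x\<bar> ^ k)"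
proof (rule Bochner_Integration.integrable_bound)
  interpret prob_space D by fact
  show "integrable D (\<lambda>x. 1 + \<bar>x\<bar> powr m)" using m by simp
  show "(\<lambda>x. \<bar>x\<bar> ^ k) \<in> borel_measurable D" using D(2) by (simp add: measurable_cong_sets[of D borel borel borel])
  have "\<bar>x\<bar> ^ k \<le> 1 + \<bar>x\<bar> powr m" for x :: real
  proof (cases "\<bar>x\<bar> \<le> 1")
    case True
    then have "\<bar>x\<bar> ^ k \<le> 1" by (simp add: power_le_one)
    then show ?thesis by (simp add: add_increasing2)
  next
    case False
    then have "\<bar>x\<bar> ^ k = \<bar>x\<bar> powr (real k)" by (simp add: powr_realpow)
    also have "\<dots> \<le> \<bar>x\<bar> powr m" using False m(2) by (intro powr_mono) auto
    finally show ?thesis by simp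
  qed
  then show "AE x in D. norm (\<bar>x\<bar> ^ k) \<le> norm (1 + \<bar>x\<bar> powr m)"
    by (auto simp: add_nonneg_nonneg)
qed

text \<open>The square in the exponent tames both tails, so the inequality holds on the whole line.
  A centred variable with only a second moment can thus be exponentiated once its own square is
  subtracted.\<close>

lemma exp_minus_square_le:
  fixes x :: real
  shows "exp (x - x\<^sup>2) \<le> 1 + x + x\<^sup>2"
proof (cases "x \<le> - 1/2")
  case True
  have "1 + x + x\<^sup>2 = (x + 1/2)\<^sup>2 + 3/4" by (simp add: power2_eq_square algebra_simps)
  then have "3/4 \<le> 1 + x + x\<^sup>2" by simp
  moreover have "(1/4 :: real) \<le> x\<^sup>2" using True power_mono[of "1/2" "-x" 2] by (simp add: power2_eq_square)
  then have "exp (x - x\<^sup>2) \<le> exp (- (3/4))" using True by simp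
  moreover have "exp (- (3/4)) \<le> (3/4 :: real)"
  proof -
    have "4/3 \<le> exp (3/4 :: real)" using exp_ge_add_one_self[of "3/4 :: real"] by simp
    then show ?thesis by (simp add: exp_minus field_simps)
  qed
  ultimately show ?thesis by linarith
next
  case False
  show ?thesis
  proof (cases "0 \<le> x")
    case True
    have "x - x\<^sup>2 \<le> ln (1 + x)"
      using True ln_one_plus_pos_lower_bound[of x] ln_ge_zero[of "1 + x"] mult_left_mono[of 1 x x]
      by (cases "x \<le> 1") (auto simp: power2_eq_square intro: order_trans[of _ 0])
    then have "exp (x - x\<^sup>2) \<le> exp (ln (1 + x))" by simp
    also have "\<dots> \<le> 1 + x + x\<^sup>2" using True by simp
    finally show ?thesis .
  next
    case neg: False
    \<comment> \<open>For \<open>z \<ge> 0\<close> the product of the Taylor quadratics of exp z and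
      exp (- z) is 1 + z^4 / 4, at least 1, which gives
      \<open>exp (- z) \<le> 1 - z + z\<^sup>2 / 2\<close>. As \<open>1 - x \<le> 2\<close> here,
      the last term is at most \<open>2 * x\<^sup>2\<close>, and the sum is
      \<open>1 + x + x\<^sup>2\<close>.\<close>
    define z where "z = x\<^sup>2 - x"
    have z: "0 \<le> z" unfolding z_def using neg zero_le_power2[of x] by linarith
    have "exp (- z) * 1 \<le> exp (- z) * ((1 + z + z\<^sup>2 / 2) * (1 - z + z\<^sup>2 / 2))"
    proof (rule mult_left_mono)
      have "(1 + z + z\<^sup>2 / 2) * (1 - z + z\<^sup>2 / 2) = 1 + (z\<^sup>2)\<^sup>2 / 4"
        by (simp add: power2_eq_square algebra_simps)
      then show "1 \<le> (1 + z + z\<^sup>2 / 2) * (1 - z + z\<^sup>2 / 2)" by simp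
    qed simp
    also have "\<dots> \<le> exp (- z) * (exp z * (1 - z + z\<^sup>2 / 2))"
    proof (intro mult_left_mono mult_right_mono exp_lower_Taylor_quadratic z)
      have "1 - z + z\<^sup>2 / 2 = (1 - z)\<^sup>2 / 2 + 1/2" by (simp add: power2_eq_square field_simps)
      then show "0 \<le> 1 - z + z\<^sup>2 / 2" by simp
    qed simp
    also have "\<dots> = 1 - z + z\<^sup>2 / 2" by (simp add: mult.assoc[symmetric] exp_add[symmetric])
    also have "z\<^sup>2 = x\<^sup>2 * (1 - x)\<^sup>2"
      unfolding z_def by (simp add: power2_eq_square algebra_simps)
    also have "1 - z + x\<^sup>2 * (1 - x)\<^sup>2 / 2 \<le> 1 - z + x\<^sup>2 * 2\<^sup>2 / 2"
      using False neg by (intro add_left_mono divide_right_mono mult_left_mono power_mono) auto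
    finally show ?thesis by (simp add: z_def)
  qed
qed

text \<open>Self-normalised Chernoff bound: subtracting \<open>u\<^sup>2\<close> times the weighted
  sum of squares makes the exponential moment finite under a second moment alone, and on the event
  this subtraction costs at most \<open>u\<^sup>2 * v\<close>.\<close>

lemma error_tail_one_sided:
  fixes D :: "real measure" and a :: "nat \<Rightarrow> real"
  assumes D: "prob_space D" "sets D = sets borel" "integrable D (\<lambda>x. x)" "integrable D (\<lambda>x. x\<^sup>2)" "(\<integral>x. x \<partial>D) = 0"
    and I: "finite I" and A: "(\<Sum>l\<in>I. (a l)\<^sup>2) \<le> A\<^sup>2" and u: "0 < u"
  shows "measure (iid I D) {e \<in> space (iid I D). t < (\<Sum>l\<in>I. a l * e l) \<and> (\<Sum>l\<in>I. (a l)\<^sup>2 * (e l)\<^sup>2) \<le> v}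
    \<le> exp (- u * t + u\<^sup>2 * (v + A\<^sup>2 * (\<integral>x. x\<^sup>2 \<partial>D)))"
proof -
  interpret D: prob_space D by fact
  interpret PD: product_prob_space "\<lambda>_. D" UNIV by (intro product_prob_spaceI D)
  interpret PI: prob_space "iid I D" by (intro prob_space_PiM D)
  note [measurable_cong] = D(2)
  define s2 where "s2 = (\<integral>x. x\<^sup>2 \<partial>D)"
  have s2: "0 \<le> s2" by (simp add: s2_def)
  define k where "k l x = exp (u * a l * x - (u * a l * x)\<^sup>2)" for l and x :: real
  \<comment> \<open>The integrand is bounded because \<open>y - y\<^sup>2\<close> is bounded above,
    so no exponential moment of \<open>D\<close> is involved.\<close>
  have k_int: "integrable D (k l)" for l
  proof (rule D.integrable_const_bound[where B="exp 1"])
    have "y - y\<^sup>2 \<le> 1" for y :: real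
      using sum_squares_bound[of y "1/2"] by (simp add: power2_eq_square)
    then show "AE x in D. norm (k l x) \<le> exp 1" by (simp add: k_def)
    show "k l \<in> borel_measurable D" unfolding k_def by measurable
  qed
  have k_le: "(\<integral>x. k l x \<partial>D) \<le> exp (u\<^sup>2 * (a l)\<^sup>2 * s2)" for l
  proof -
    have "(\<integral>x. k l x \<partial>D) \<le> (\<integral>x. 1 + u * a l * x + (u * a l)\<^sup>2 * x\<^sup>2 \<partial>D)"
      using D exp_minus_square_le[of "u * a l * x" for x]
      by (intro integral_mono k_int) (auto simp: k_def power_mult_distrib)
    also have "\<dots> = 1 + (u * a l)\<^sup>2 * s2" using D by (simp add: D.prob_space s2_def)
    also have "\<dots> \<le> exp (u\<^sup>2 * (a l)\<^sup>2 * s2)"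
      using exp_ge_add_one_self[of "u\<^sup>2 * (a l)\<^sup>2 * s2"] by (simp add: power_mult_distrib)
    finally show ?thesis .
  qed
  define Z where "Z e = (\<Prod>l\<in>I. k l (e l))" for e
  have Z_eq: "Z e = exp (u * (\<Sum>l\<in>I. a l * e l) - u\<^sup>2 * (\<Sum>l\<in>I. (a l)\<^sup>2 * (e l)\<^sup>2))" for e
    unfolding Z_def k_def exp_sum[OF I, symmetric]
    by (simp add: sum_subtractf sum_distrib_left power_mult_distrib mult.assoc)
  have Z_int: "integrable (iid I D) Z"
    unfolding Z_def using I k_int by (intro PD.product_integrable_prod) auto
  have "integral\<^sup>L (iid I D) Z = (\<Prod>l\<in>I. \<integral>x. k l x \<partial>D)"
    unfolding Z_def using I k_int by (intro PD.product_integral_prod) auto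
  also have "\<dots> \<le> (\<Prod>l\<in>I. exp (u\<^sup>2 * (a l)\<^sup>2 * s2))"
    using k_le by (intro prod_mono) (auto simp: k_def)
  also have "\<dots> = exp (u\<^sup>2 * s2 * (\<Sum>l\<in>I. (a l)\<^sup>2))"
    by (simp add: exp_sum[OF I, symmetric] sum_distrib_left ac_simps)
  also have "\<dots> \<le> exp (u\<^sup>2 * s2 * A\<^sup>2)" using A s2 by (simp add: mult_left_mono)
  finally have EZ: "integral\<^sup>L (iid I D) Z \<le> exp (u\<^sup>2 * s2 * A\<^sup>2)" .
  let ?S = "{e \<in> space (iid I D). t < (\<Sum>l\<in>I. a l * e l) \<and> (\<Sum>l\<in>I. (a l)\<^sup>2 * (e l)\<^sup>2) \<le> v}"
  have S_meas: "?S \<in> sets (iid I D)" by measurable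
  have S_int: "integrable (iid I D) (indicator ?S :: _ \<Rightarrow> real)"
    using S_meas by (intro integrable_real_indicator) (auto simp: PI.emeasure_eq_measure)
  have ind: "indicator ?S e \<le> exp (- u * t + u\<^sup>2 * v) * Z e" for e
  proof (cases "e \<in> ?S")
    case True
    then have "u * t \<le> u * (\<Sum>l\<in>I. a l * e l)" "u\<^sup>2 * (\<Sum>l\<in>I. (a l)\<^sup>2 * (e l)\<^sup>2) \<le> u\<^sup>2 * v"
      using u by (auto intro!: mult_left_mono)
    then show ?thesis using True by (simp add: Z_eq exp_add[symmetric])
  qed (auto simp: Z_eq)
  have "measure (iid I D) ?S = (\<integral>e. indicator ?S e \<partial>iid I D)"
    using S_meas by simp
  also have "\<dots> \<le> (\<integral>e. exp (- u * t + u\<^sup>2 * v) * Z e \<partial>iid I D)"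
    using ind Z_int S_int by (intro integral_mono) auto
  also have "\<dots> \<le> exp (- u * t + u\<^sup>2 * v) * exp (u\<^sup>2 * s2 * A\<^sup>2)"
    using EZ by simp
  also have "\<dots> = exp (- u * t + u\<^sup>2 * (v + A\<^sup>2 * s2))" by (simp add: exp_add[symmetric] algebra_simps)
  finally show ?thesis by (simp add: s2_def)
qed

text \<open>The self-normalised bound is used on the event that the weighted sum of squares is at
  most \<open>2 * A\<^sup>2 * c\<close>; the complement is paid for by the moment of order
  \<open>m\<close>. Neither term involves the number of summands. The parameters \<open>c\<close>
  and \<open>u\<close> stay free and are fixed only when rates are inserted.\<close>

lemma error_tail:
  fixes D :: "real measure" and a :: "nat \<Rightarrow> real"
  assumes D: "prob_space D" "sets D = sets borel" "integrable D (\<lambda>x. x)" "(\<integral>x. x \<partial>D) = 0"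
    and m: "integrable D (\<lambda>x. \<bar>x\<bar> powr m)" "2 < m"
    and I: "finite I" and A: "(\<Sum>l\<in>I. (a l)\<^sup>2) \<le> A\<^sup>2" "0 < A" and c: "0 < c" and u: "0 < u"
  shows "measure (iid I D) {e \<in> space (iid I D). t < \<bar>\<Sum>l\<in>I. a l * e l\<bar>}
    \<le> (\<integral>x. \<bar>x\<bar> powr m \<partial>D) * c powr (- m / 2) + 2 * exp (- u * t + u\<^sup>2 * A\<^sup>2 * (2 * c + (\<integral>x. x\<^sup>2 \<partial>D)))"
proof -
  interpret D: prob_space D by fact
  interpret PI: prob_space "iid I D" by (intro prob_space_PiM D)
  note [measurable_cong] = D(2)
  define v where "v = 2 * A\<^sup>2 * c"
  define V where "V e = (\<Sum>l\<in>I. (a l)\<^sup>2 * (e l)\<^sup>2)" for e :: "nat \<Rightarrow> real"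
  let ?M = "iid I D"
  have V_meas[measurable]: "V \<in> borel_measurable ?M" unfolding V_def by measurable
  have D2: "integrable D (\<lambda>x. x\<^sup>2)"
    using integrable_lower_moment[OF D(1,2) m(1), of 2] m(2) by simp
  have comp: "integrable ?M (\<lambda>e. \<bar>e l\<bar> powr m)" "(\<integral>e. \<bar>e l\<bar> powr m \<partial>?M) = (\<integral>x. \<bar>x\<bar> powr m \<partial>D)" if "l \<in> I" for l
  proof -
    have d: "distr ?M D (\<lambda>e. e l) = D" using D(1) that by (intro distr_PiM_component)
    show "integrable ?M (\<lambda>e. \<bar>e l\<bar> powr m)"
      using m(1) that by (subst (asm) d[symmetric]) (simp add: integrable_distr_eq)
    show "(\<integral>e. \<bar>e l\<bar> powr m \<partial>?M) = (\<integral>x. \<bar>x\<bar> powr m \<partial>D)"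
      using that by (subst (2) d[symmetric]) (simp add: integral_distr)
  qed
  define K where "K = (\<integral>x. \<bar>x\<bar> powr m \<partial>D)"
  have K: "0 \<le> K" by (simp add: K_def)
  \<comment> \<open>Truncation of the square at \<open>c\<close>: where
    \<open>x\<^sup>2 > c\<close>, the factor \<open>(x\<^sup>2 / c) powr (m / 2 - 1)\<close> exceeds
    1 because \<open>m > 2\<close>.\<close>
  have young: "x\<^sup>2 \<le> c + \<bar>x\<bar> powr m * c powr (1 - m / 2)" for x :: real
  proof (cases "x\<^sup>2 \<le> c")
    case False
    then have x: "0 < \<bar>x\<bar>" using c by auto
    have "x\<^sup>2 = x\<^sup>2 * (c powr (m / 2 - 1) * c powr (1 - m / 2))"
      using c by (simp add: powr_add[symmetric])
    also have "\<dots> \<le> x\<^sup>2 * ((x\<^sup>2) powr (m / 2 - 1) * c powr (1 - m / 2))"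
      using False c m(2) by (intro mult_left_mono mult_right_mono powr_mono2) auto
    also have "x\<^sup>2 * ((x\<^sup>2) powr (m / 2 - 1) * c powr (1 - m / 2)) = (x\<^sup>2) powr (1 + (m / 2 - 1)) * c powr (1 - m / 2)"
      using x by (subst powr_add) simp
    also have "(x\<^sup>2) powr (1 + (m / 2 - 1)) = \<bar>x\<bar> powr m"
    proof -
      have "x\<^sup>2 = \<bar>x\<bar> powr 2" using x by simp
      then show ?thesis by (simp only: powr_powr) simp
    qed
    finally show ?thesis using c by simp
  qed (simp add: add_increasing2)
  let ?B = "{e \<in> space ?M. v < V e}"
  \<comment> \<open>Up to the factor \<open>c powr (- m / 2)\<close> this averages
    \<open>\<bar>e l\<bar> powr m\<close> with weights \<open>(a l)\<^sup>2 / A\<^sup>2\<close> of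
    total at most 1. Since \<open>V e \<le> c * A\<^sup>2 * (1 + w e)\<close>, the event
    \<open>?B\<close> forces \<open>w e > 1\<close>, and Markov's inequality applies.\<close>
  define w where "w e = (\<Sum>l\<in>I. (a l)\<^sup>2 * \<bar>e l\<bar> powr m) * (c powr (- m / 2) / A\<^sup>2)" for e :: "nat \<Rightarrow> real"
  have w0: "0 \<le> w e" for e unfolding w_def by (intro mult_nonneg_nonneg sum_nonneg) auto
  have ind: "indicator ?B e \<le> w e" for e
  proof (cases "e \<in> ?B")
    case True
    have "V e \<le> (\<Sum>l\<in>I. (a l)\<^sup>2 * (c + \<bar>e l\<bar> powr m * c powr (1 - m / 2)))"
      unfolding V_def using young by (intro sum_mono mult_left_mono) auto
    also have "\<dots> = c * (\<Sum>l\<in>I. (a l)\<^sup>2) + c powr (1 - m / 2) * (\<Sum>l\<in>I. (a l)\<^sup>2 * \<bar>e l\<bar> powr m)"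
      by (simp add: distrib_left sum.distrib sum_distrib_left ac_simps)
    also have "\<dots> \<le> c * A\<^sup>2 + c powr (1 - m / 2) * (\<Sum>l\<in>I. (a l)\<^sup>2 * \<bar>e l\<bar> powr m)"
      using A c by (intro add_right_mono mult_left_mono) auto
    also have "c powr (1 - m / 2) = c * c powr (- m / 2)"
      using c powr_add[of c 1 "- m / 2"] by simp
    also have "c * A\<^sup>2 + c * c powr (- m / 2) * (\<Sum>l\<in>I. (a l)\<^sup>2 * \<bar>e l\<bar> powr m) = c * A\<^sup>2 * (1 + w e)"
      using A by (simp add: w_def field_simps)
    finally have "V e \<le> c * A\<^sup>2 * (1 + w e)" .
    moreover have "c * A\<^sup>2 * 2 < V e" using True by (simp add: v_def ac_simps)
    ultimately have "c * A\<^sup>2 * 2 < c * A\<^sup>2 * (1 + w e)" by linarith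
    then have "1 < w e" using c A by (simp add: mult_less_cancel_left)
    then show ?thesis using True by simp
  qed (simp add: w0)
  have B_int: "integrable ?M (indicator ?B :: _ \<Rightarrow> real)"
    by (intro integrable_real_indicator) (auto simp: PI.emeasure_eq_measure)
  have w_int: "integrable ?M w" unfolding w_def using comp by auto
  have "measure ?M ?B = (\<integral>e. indicator ?B e \<partial>?M)" by simp
  also have "\<dots> \<le> integral\<^sup>L ?M w"
    using ind w_int B_int by (intro integral_mono) auto
  also have "\<dots> = (\<Sum>l\<in>I. (a l)\<^sup>2 * K) * (c powr (- m / 2) / A\<^sup>2)"
    unfolding w_def using comp by (simp add: K_def)
  also have "\<dots> = (\<Sum>l\<in>I. (a l)\<^sup>2) / A\<^sup>2 * (K * c powr (- m / 2))"
    by (simp add: sum_distrib_right[symmetric])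
  also have "\<dots> \<le> 1 * (K * c powr (- m / 2))"
    using A K by (intro mult_right_mono) auto
  finally have B: "measure ?M ?B \<le> K * c powr (- m / 2)" by simp
  let ?S = "\<lambda>a. {e \<in> space ?M. t < (\<Sum>l\<in>I. a l * e l) \<and> V e \<le> v}"
  have S_meas: "?S a \<in> sets ?M" for a by measurable
  have S: "measure ?M (?S a) \<le> exp (- u * t + u\<^sup>2 * (v + A\<^sup>2 * (\<integral>x. x\<^sup>2 \<partial>D)))"
    "measure ?M (?S (\<lambda>l. - a l)) \<le> exp (- u * t + u\<^sup>2 * (v + A\<^sup>2 * (\<integral>x. x\<^sup>2 \<partial>D)))"
    using error_tail_one_sided[OF D(1,2,3) D2 D(4) I, where a=a and A=A and t=t and v=v and u=u]
      error_tail_one_sided[OF D(1,2,3) D2 D(4) I, where a="\<lambda>l. - a l" and A=A and t=t and v=v and u=u] A u by (simp_all add: V_def)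
  have "{e \<in> space ?M. t < \<bar>\<Sum>l\<in>I. a l * e l\<bar>} \<subseteq> ?B \<union> (?S a \<union> ?S (\<lambda>l. - a l))"
    by (auto simp: sum_negf abs_if split: if_splits)
  then have "measure ?M {e \<in> space ?M. t < \<bar>\<Sum>l\<in>I. a l * e l\<bar>} \<le> measure ?M (?B \<union> (?S a \<union> ?S (\<lambda>l. - a l)))"
    using S_meas by (intro PI.finite_measure_mono) auto
  also have "\<dots> \<le> measure ?M ?B + (measure ?M (?S a) + measure ?M (?S (\<lambda>l. - a l)))"
    using S_meas by (intro order_trans[OF measure_Un_le] add_left_mono measure_Un_le) auto
  also have "\<dots> \<le> K * c powr (- m / 2) + 2 * exp (- u * t + u\<^sup>2 * (v + A\<^sup>2 * (\<integral>x. x\<^sup>2 \<partial>D)))"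
    using B S by linarith
  finally show ?thesis by (simp add: K_def v_def algebra_simps)
qed

section \<open>Matrix algebra of the ridge estimator\<close>

lemma mult_mat_vec_index_sum:
  fixes A :: "real Matrix.mat"
  assumes "A \<in> carrier_mat a b" "v \<in> carrier_vec b" "i < a"
  shows "vec_index (A *\<^sub>v v) i = (\<Sum>k<b. A $$ (i, k) * vec_index v k)"
  using assms by (auto simp: mult_mat_vec_def scalar_prod_def atLeast0LessThan intro!: sum.cong)

lemma mult_mat_index_sum:
  fixes A :: "real Matrix.mat"
  assumes "A \<in> carrier_mat a b" "B \<in> carrier_mat b c" "i < a" "j < c"
  shows "(A * B) $$ (i, j) = (\<Sum>k<b. A $$ (i, k) * B $$ (k, j))"
  using assms by (auto simp: scalar_prod_def atLeast0LessThan intro!: sum.cong)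

lemma mat_diag_mult_vec:
  fixes f :: "nat \<Rightarrow> real"
  assumes "v \<in> carrier_vec r"
  shows "mat_diag r f *\<^sub>v v = Matrix.vec r (\<lambda>k. f k * vec_index v k)"
proof (intro eq_vecI)
  fix i assume "i < dim_vec (Matrix.vec r (\<lambda>k. f k * vec_index v k))"
  then have i: "i < r" by simp
  have "(\<Sum>k<r. mat_diag r f $$ (i, k) * vec_index v k) = (\<Sum>k<r. if i = k then f k * vec_index v k else 0)"
    using i by (intro sum.cong) (auto simp: mat_diag_def)
  then show "vec_index (mat_diag r f *\<^sub>v v) i = vec_index (Matrix.vec r (\<lambda>k. f k * vec_index v k)) i"
    using i assms mult_mat_vec_index_sum[of "mat_diag r f" r r v i] by simp
qed (simp add: mat_diag_def)

lemma smult_one_mult_vec: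
  fixes v :: "real Matrix.vec"
  assumes "v \<in> carrier_vec p"
  shows "(\<rho> \<cdot>\<^sub>m 1\<^sub>m p) *\<^sub>v v = \<rho> \<cdot>\<^sub>v v"
proof -
  have "\<rho> \<cdot>\<^sub>m 1\<^sub>m p = mat_diag p (\<lambda>_. \<rho>)"
    by (intro eq_matI) (auto simp: mat_diag_def)
  then show ?thesis
    using assms by (intro eq_vecI) (auto simp: mat_diag_mult_vec)
qed

text \<open>\<open>mat_inverse\<close> returns an option; a nonzero determinant ensures that
  \<open>the\<close> in \<open>inv_mat\<close> yields a genuine inverse.\<close>

lemma inv_mat_unit:
  assumes A: "A \<in> carrier_mat n n" and U: "Determinant.det A \<noteq> 0"
  shows "inv_mat A \<in> carrier_mat n n" "inv_mat A * A = 1\<^sub>m n"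
proof -
  have "mat_inverse A \<noteq> None"
    using mat_inverse(1)[OF A, where b="()"] det_non_zero_imp_unit[OF A U, where b="()"] by blast
  then obtain B where "mat_inverse A = Some B" by auto
  with mat_inverse(2)[OF A this] show "inv_mat A \<in> carrier_mat n n" "inv_mat A * A = 1\<^sub>m n"
    by (auto simp: inv_mat_def)
qed

lemma inv_mat_solve:
  assumes A: "A \<in> carrier_mat n n" and U: "Determinant.det A \<noteq> 0"
    and v: "v \<in> carrier_vec n" and eq: "A *\<^sub>v v = w"
  shows "inv_mat A *\<^sub>v w = v"
  using inv_mat_unit[OF A U] A v assoc_mult_mat_vec[of "inv_mat A" n n A n v] eq by simp

text \<open>A kernel vector v would satisfy |X v|^2 + \<rho> |v|^2 = 0.\<close>

lemma det_ridge:
  fixes X :: "real Matrix.mat"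
  assumes X: "X \<in> carrier_mat n p" and \<rho>: "0 < \<rho>"
  shows "Determinant.det (X\<^sup>T * X + \<rho> \<cdot>\<^sub>m 1\<^sub>m p) \<noteq> 0"
proof
  let ?A = "X\<^sup>T * X + \<rho> \<cdot>\<^sub>m 1\<^sub>m p"
  have A: "?A \<in> carrier_mat p p" using X by auto
  assume "Determinant.det ?A = 0"
  then obtain v where v: "v \<in> carrier_vec p" "v \<noteq> 0\<^sub>v p" "?A *\<^sub>v v = 0\<^sub>v p"
    using det_0_iff_vec_prod_zero_field[OF A] by auto
  have XX: "X\<^sup>T * X \<in> carrier_mat p p" and R: "\<rho> \<cdot>\<^sub>m 1\<^sub>m p \<in> carrier_mat p p" using X by auto
  have Rv: "(\<rho> \<cdot>\<^sub>m 1\<^sub>m p) *\<^sub>v v = \<rho> \<cdot>\<^sub>v v"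
    by (rule smult_one_mult_vec[OF v(1)])
  have Av: "?A *\<^sub>v v = X\<^sup>T *\<^sub>v (X *\<^sub>v v) + \<rho> \<cdot>\<^sub>v v"
    using add_mult_distrib_mat_vec[OF XX R v(1)] X v(1) Rv by simp
  have Xv: "X *\<^sub>v v \<in> carrier_vec n" using X v(1) by simp
  have "scalar_prod (?A *\<^sub>v v) v = scalar_prod (X *\<^sub>v v) (X *\<^sub>v v) + \<rho> * scalar_prod v v"
    unfolding Av using transpose_vec_mult_scalar[OF X v(1) Xv] X v(1)
    by (subst add_scalar_prod_distrib[of _ p]) auto
  moreover have "scalar_prod (?A *\<^sub>v v) v = 0" unfolding v(3) using v(1) by simp
  moreover have "0 \<le> scalar_prod w w" for w :: "real Matrix.vec"
    by (auto simp: scalar_prod_def intro!: sum_nonneg)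
  ultimately have "scalar_prod v v \<le> 0"
    using \<rho> by (smt (verit) mult_pos_pos)
  then have "(\<Sum>i<p. vec_index v i * vec_index v i) \<le> 0"
    using v(1) by (simp add: scalar_prod_def atLeast0LessThan)
  then have "(\<Sum>i<p. vec_index v i * vec_index v i) = 0"
    by (intro antisym sum_nonneg) auto
  then have "\<forall>i<p. vec_index v i = 0"
    by (subst (asm) sum_nonneg_eq_0_iff) auto
  then have "v = 0\<^sub>v p" using v(1) by (intro eq_vecI) auto
  then show False using v(2) by simp
qed

lemma inv_mat_diag:
  assumes f: "\<And>k. k < r \<Longrightarrow> f k \<noteq> (0 :: real)"
  shows "inv_mat (mat_diag r f) = mat_diag r (\<lambda>k. 1 / f k)"
proof -
  let ?A = "mat_diag r f" and ?B = "mat_diag r (\<lambda>k. 1 / f k)"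
  have "mat_diag r (\<lambda>i. f i * (1 / f i)) = mat_diag r (\<lambda>i. 1)"
    using f by (intro eq_matI) (auto simp: mat_diag_def)
  then have AB: "?A * ?B = 1\<^sub>m r" by simp
  have "Determinant.det ?A * Determinant.det ?B = 1"
    using det_mult[of ?A r ?B] AB by simp
  then have U: "Determinant.det ?A \<noteq> 0" by auto
  have A: "?A \<in> carrier_mat r r" and B: "?B \<in> carrier_mat r r" by simp_all
  note inv = inv_mat_unit[OF A U]
  have "inv_mat ?A = inv_mat ?A * (?A * ?B)"
    using inv(1) unfolding AB by simp
  also have "\<dots> = (inv_mat ?A * ?A) * ?B"
    by (rule assoc_mult_mat[symmetric, OF inv(1) A B])
  also have "\<dots> = ?B" unfolding inv(2) by (rule left_mult_one_mat[OF B])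
  finally show ?thesis .
qed

lemma orthonormal_cols_sum:
  fixes Q :: "real Matrix.mat"
  assumes Q: "Q \<in> carrier_mat p r" and orth: "Q\<^sup>T * Q = 1\<^sub>m r" and jk: "j < r" "k < r"
  shows "(\<Sum>i<p. Q $$ (i, j) * Q $$ (i, k)) = (if j = k then 1 else 0)"
proof -
  have "(Q\<^sup>T * Q) $$ (j, k) = (\<Sum>i<p. Q $$ (i, j) * Q $$ (i, k))"
    using mult_mat_index_sum[of "Q\<^sup>T" r p Q r j k] Q jk by simp
  then show ?thesis using orth jk by simp
qed

lemma theta_of_index:
  assumes Q: "Q \<in> carrier_mat p r" and \<beta>: "\<beta> \<in> carrier_vec p" and j: "j < p"
  shows "vec_index (theta_of Q \<beta>) j = (\<Sum>k<r. Q $$ (j, k) * (\<Sum>i<p. Q $$ (i, k) * vec_index \<beta> i))"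
proof -
  have t: "theta_of Q \<beta> = Q *\<^sub>v (Q\<^sup>T *\<^sub>v \<beta>)"
    unfolding theta_of_def using Q \<beta> by (intro assoc_mult_mat_vec) auto
  have "vec_index (Q\<^sup>T *\<^sub>v \<beta>) k = (\<Sum>i<p. Q $$ (i, k) * vec_index \<beta> i)" if "k < r" for k
    using mult_mat_vec_index_sum[of "Q\<^sup>T" r p \<beta> k] Q \<beta> that by simp
  then show ?thesis
    unfolding t using mult_mat_vec_index_sum[of Q p r "Q\<^sup>T *\<^sub>v \<beta>" j] Q \<beta> j by simp
qed

lemma beta_split:
  assumes Q: "Q \<in> carrier_mat p r" and Qp: "Qp \<in> carrier_mat p q" and \<beta>: "\<beta> \<in> carrier_vec p" and j: "j < p"
    and perp: "Q * Q\<^sup>T + Qp * Qp\<^sup>T = 1\<^sub>m p"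
  shows "vec_index \<beta> j = vec_index (theta_of Q \<beta>) j + vec_index (theta_of Qp \<beta>) j"
proof -
  have "\<beta> = (Q * Q\<^sup>T + Qp * Qp\<^sup>T) *\<^sub>v \<beta>"
    using perp \<beta> by simp
  also have "\<dots> = theta_of Q \<beta> + theta_of Qp \<beta>"
    unfolding theta_of_def using Q Qp \<beta> by (intro add_mult_distrib_mat_vec) auto
  finally have "vec_index \<beta> j = vec_index (theta_of Q \<beta> + theta_of Qp \<beta>) j" by simp
  also have "\<dots> = vec_index (theta_of Q \<beta>) j + vec_index (theta_of Qp \<beta>) j"
    using j Qp \<beta> by (intro index_add_vec(1)) (simp add: theta_of_def)
  finally show ?thesis .
qed

text \<open>A row of \<open>Q\<close> followed by the same row of \<open>Qp\<close> is a unit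
  vector, by the diagonal of \<open>perp\<close>. This bounds noise and bias in every single
  coordinate, uniformly in \<open>p\<close>.\<close>

lemma row_norm_le:
  assumes Q: "Q \<in> carrier_mat p r" and Qp: "Qp \<in> carrier_mat p q" and j: "j < p"
    and perp: "Q * Q\<^sup>T + Qp * Qp\<^sup>T = (1\<^sub>m p :: real Matrix.mat)"
  shows "(\<Sum>k<r. (Q $$ (j, k))\<^sup>2) \<le> 1"
proof -
  have "(Q * Q\<^sup>T) $$ (j, j) + (Qp * Qp\<^sup>T) $$ (j, j) = 1"
    using perp j Q Qp by (metis carrier_matD index_add_mat(1) index_mult_mat(2,3) index_one_mat(1) index_transpose_mat(3))
  moreover have "(Q * Q\<^sup>T) $$ (j, j) = (\<Sum>k<r. (Q $$ (j, k))\<^sup>2)"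
    using mult_mat_index_sum[of Q p r "Q\<^sup>T" p j j] Q j by (simp add: power2_eq_square)
  moreover have "(Qp * Qp\<^sup>T) $$ (j, j) = (\<Sum>k<q. (Qp $$ (j, k))\<^sup>2)"
    using mult_mat_index_sum[of Qp p q "Qp\<^sup>T" p j j] Qp j by (simp add: power2_eq_square)
  ultimately show ?thesis using sum_nonneg[of "{..<q}" "\<lambda>k. (Qp $$ (j, k))\<^sup>2"] by simp
qed

lemma orthonormal_sum_sq:
  fixes P :: "nat \<Rightarrow> nat \<Rightarrow> real"
  assumes orth: "\<And>j k. j < r \<Longrightarrow> k < r \<Longrightarrow> (\<Sum>l<n. P l j * P l k) = (if j = k then 1 else 0)"
  shows "(\<Sum>l<n. (\<Sum>k<r. P l k * d k)\<^sup>2) = (\<Sum>k<r. (d k)\<^sup>2)"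
proof -
  have "(\<Sum>l<n. (\<Sum>k<r. P l k * d k)\<^sup>2) = (\<Sum>l<n. \<Sum>j<r. \<Sum>k<r. d j * d k * (P l j * P l k))"
    by (simp add: power2_eq_square sum_product ac_simps)
  also have "\<dots> = (\<Sum>j<r. \<Sum>l<n. \<Sum>k<r. d j * d k * (P l j * P l k))"
    by (rule sum.swap)
  also have "\<dots> = (\<Sum>j<r. \<Sum>k<r. \<Sum>l<n. d j * d k * (P l j * P l k))"
    by (rule sum.cong[OF refl]) (rule sum.swap)
  also have "\<dots> = (\<Sum>j<r. \<Sum>k<r. d j * d k * (if j = k then 1 else 0))"
    using orth by (simp add: sum_distrib_left[symmetric])
  also have "\<dots> = (\<Sum>k<r. (d k)\<^sup>2)"
    by (simp add: power2_eq_square if_distrib cong: if_cong)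
  finally show ?thesis .
qed

lemma theta_norm:
  assumes Q: "Q \<in> carrier_mat p r" and \<beta>: "\<beta> \<in> carrier_vec p" and orth: "Q\<^sup>T * Q = 1\<^sub>m r"
  shows "(\<Sum>j<p. (vec_index (theta_of Q \<beta>) j)\<^sup>2) = (\<Sum>k<r. (\<Sum>i<p. Q $$ (i, k) * vec_index \<beta> i)\<^sup>2)"
proof -
  have "(\<Sum>j<p. (vec_index (theta_of Q \<beta>) j)\<^sup>2) = (\<Sum>j<p. (\<Sum>k<r. Q $$ (j, k) * (\<Sum>i<p. Q $$ (i, k) * vec_index \<beta> i))\<^sup>2)"
    using theta_of_index[OF Q \<beta>] by (intro sum.cong) auto
  also have "\<dots> = (\<Sum>k<r. (\<Sum>i<p. Q $$ (i, k) * vec_index \<beta> i)\<^sup>2)"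
    using orthonormal_cols_sum[OF Q orth] by (intro orthonormal_sum_sq[where P="\<lambda>l k. Q $$ (l, k)"]) auto
  finally show ?thesis .
qed

text \<open>In singular coordinates everything is diagonal: the initial ridge fit multiplies by
  \<lambda> / (\<lambda>^2 + \<rho>), the correction by 1 + \<rho> / (\<lambda>^2 + \<rho>), and the
  product of the two is \<open>wgt\<close>. The inverse of size \<open>p\<close> is never computed;
  a solution of the normal equations in the range of \<open>Q\<close> is exhibited instead.\<close>

lemma ridge_corr_index:
  assumes X: "X \<in> carrier_mat n p" and P: "P \<in> carrier_mat n r" and Q: "Q \<in> carrier_mat p r" and \<beta>: "\<beta> \<in> carrier_vec p"
    and svd: "X = P * Lam_mat r lam * Q\<^sup>T"
    and PP: "P\<^sup>T * P = 1\<^sub>m r" and QQ: "Q\<^sup>T * Q = 1\<^sub>m r"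
    and \<rho>: "0 < \<rho>" and j: "j < p"
  shows "vec_index (ridge_corr X Q lam \<rho> (X *\<^sub>v \<beta> + Matrix.vec n e)) j
    = (\<Sum>k<r. Q $$ (j, k) * (wgt lam \<rho> k * (lam k * (\<Sum>i<p. Q $$ (i, k) * vec_index \<beta> i) + (\<Sum>l<n. P $$ (l, k) * e l))))"
proof -
  define z where "z = Matrix.vec r (\<lambda>k. lam k * (\<Sum>i<p. Q $$ (i, k) * vec_index \<beta> i) + (\<Sum>l<n. P $$ (l, k) * e l))"
  define y where "y = X *\<^sub>v \<beta> + Matrix.vec n e"
  let ?L = "Lam_mat r lam"
  note carr = X P Q \<beta>
  have L: "?L \<in> carrier_mat r r" by (simp add: Lam_mat_def)
  have Pt: "P\<^sup>T \<in> carrier_mat r n" and Qt: "Q\<^sup>T \<in> carrier_mat r p" using P Q by auto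
  have PL: "P * ?L \<in> carrier_mat n r" using P L by simp
  have Xv: "X *\<^sub>v v = P *\<^sub>v (?L *\<^sub>v (Q\<^sup>T *\<^sub>v v))" if "v \<in> carrier_vec p" for v
    unfolding svd using that P L Qt PL by (subst assoc_mult_mat_vec[OF PL Qt that], subst assoc_mult_mat_vec[OF P L]) auto
  have Lt: "?L\<^sup>T = ?L"
    unfolding Lam_mat_def by (intro eq_matI) (auto simp: mat_diag_def)
  have Xt: "X\<^sup>T = Q * (?L * P\<^sup>T)"
    unfolding svd using transpose_mult[OF PL Qt] transpose_mult[OF P L] Lt by simp
  have Xtv: "X\<^sup>T *\<^sub>v v = Q *\<^sub>v (?L *\<^sub>v (P\<^sup>T *\<^sub>v v))" if "v \<in> carrier_vec n" for v
  proof -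
    have LP: "?L * P\<^sup>T \<in> carrier_mat r n" using L Pt by simp
    show ?thesis
      unfolding Xt assoc_mult_mat_vec[OF Q LP that] assoc_mult_mat_vec[OF L Pt that] ..
  qed
  have PPv: "P\<^sup>T *\<^sub>v (P *\<^sub>v v) = v" if "v \<in> carrier_vec r" for v
    using assoc_mult_mat_vec[OF Pt P that] PP that by simp
  have QQv: "Q\<^sup>T *\<^sub>v (Q *\<^sub>v v) = v" if "v \<in> carrier_vec r" for v
    using assoc_mult_mat_vec[OF Qt Q that] QQ that by simp
  have yc: "y \<in> carrier_vec n" unfolding y_def using X \<beta> by simp
  have zc: "z \<in> carrier_vec r" by (simp add: z_def)
  have Lv: "?L *\<^sub>v v = Matrix.vec r (\<lambda>k. lam k * vec_index v k)" if "v \<in> carrier_vec r" for v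
    unfolding Lam_mat_def by (rule mat_diag_mult_vec[OF that])
  have Pty: "P\<^sup>T *\<^sub>v y = z"
  proof -
    have "P\<^sup>T *\<^sub>v y = P\<^sup>T *\<^sub>v (X *\<^sub>v \<beta>) + P\<^sup>T *\<^sub>v Matrix.vec n e"
      unfolding y_def using X \<beta> Pt by (intro mult_add_distrib_mat_vec) auto
    also have "P\<^sup>T *\<^sub>v (X *\<^sub>v \<beta>) = ?L *\<^sub>v (Q\<^sup>T *\<^sub>v \<beta>)"
      unfolding Xv[OF \<beta>] using L Qt \<beta> by (intro PPv) auto
    also have "\<dots> = Matrix.vec r (\<lambda>k. lam k * vec_index (Q\<^sup>T *\<^sub>v \<beta>) k)"
      using Qt \<beta> by (intro Lv) auto
    also have "\<dots> + P\<^sup>T *\<^sub>v Matrix.vec n e = z"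
    proof (intro eq_vecI)
      fix k assume "k < dim_vec z"
      then have k: "k < r" by (simp add: z_def)
      show "vec_index (Matrix.vec r (\<lambda>k. lam k * vec_index (Q\<^sup>T *\<^sub>v \<beta>) k) + P\<^sup>T *\<^sub>v Matrix.vec n e) k = vec_index z k"
        using k mult_mat_vec_index_sum[OF Qt \<beta> k] mult_mat_vec_index_sum[OF Pt, of "Matrix.vec n e" k] P Q
        by (simp add: z_def)
    qed (use Pt in \<open>simp add: z_def\<close>)
    finally show ?thesis .
  qed
  have pos: "0 < (lam k)\<^sup>2 + \<rho>" for k using \<rho> by (simp add: add_nonneg_pos)
  \<comment> \<open>Coordinates of that solution:
    \<open>(\<Lambda>\<^sup>2 + \<rho>) v = \<Lambda> z\<close> solved entry by entry, with z = P^T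
    y.\<close>
  define v where "v = Matrix.vec r (\<lambda>k. lam k / ((lam k)\<^sup>2 + \<rho>) * vec_index z k)"
  have vc: "v \<in> carrier_vec r" by (simp add: v_def)
  have Qv: "Q *\<^sub>v v \<in> carrier_vec p" using Q vc by simp
  have init: "ridge_init X \<rho> y = Q *\<^sub>v v"
  proof -
    let ?A = "X\<^sup>T * X + \<rho> \<cdot>\<^sub>m 1\<^sub>m p"
    have A: "?A \<in> carrier_mat p p" using X by auto
    have XX: "X\<^sup>T * X \<in> carrier_mat p p" and R: "\<rho> \<cdot>\<^sub>m 1\<^sub>m p \<in> carrier_mat p p" using X by auto
    have Rv: "(\<rho> \<cdot>\<^sub>m 1\<^sub>m p) *\<^sub>v (Q *\<^sub>v v) = \<rho> \<cdot>\<^sub>v (Q *\<^sub>v v)"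
      by (rule smult_one_mult_vec[OF Qv])
    have Lvc: "?L *\<^sub>v v \<in> carrier_vec r" "?L *\<^sub>v (?L *\<^sub>v v) \<in> carrier_vec r" using L vc by auto
    have "?A *\<^sub>v (Q *\<^sub>v v) = X\<^sup>T *\<^sub>v (X *\<^sub>v (Q *\<^sub>v v)) + \<rho> \<cdot>\<^sub>v (Q *\<^sub>v v)"
      using add_mult_distrib_mat_vec[OF XX R Qv] X Qv Rv by simp
    also have "X *\<^sub>v (Q *\<^sub>v v) = P *\<^sub>v (?L *\<^sub>v v)" using Xv[OF Qv] QQv[OF vc] by simp
    also have "X\<^sup>T *\<^sub>v \<dots> = Q *\<^sub>v (?L *\<^sub>v (?L *\<^sub>v v))"
      using Xtv[of "P *\<^sub>v (?L *\<^sub>v v)"] P Lvc PPv[OF Lvc(1)] by simp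
    also have "\<rho> \<cdot>\<^sub>v (Q *\<^sub>v v) = Q *\<^sub>v (\<rho> \<cdot>\<^sub>v v)"
      using Q vc by (simp add: mult_mat_vec)
    also have "Q *\<^sub>v (?L *\<^sub>v (?L *\<^sub>v v)) + Q *\<^sub>v (\<rho> \<cdot>\<^sub>v v) = Q *\<^sub>v (?L *\<^sub>v (?L *\<^sub>v v) + \<rho> \<cdot>\<^sub>v v)"
      using Q vc Lvc by (intro mult_add_distrib_mat_vec[symmetric]) auto
    also have "?L *\<^sub>v (?L *\<^sub>v v) + \<rho> \<cdot>\<^sub>v v = ?L *\<^sub>v z"
    proof (intro eq_vecI)
      fix k assume "k < dim_vec (?L *\<^sub>v z)"
      then have k: "k < r" using L by simp
      have fac: "lam k * (lam k * x) + \<rho> * x = ((lam k)\<^sup>2 + \<rho>) * x" for x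
        by (simp add: power2_eq_square algebra_simps)
      have "lam k * (lam k * (lam k / ((lam k)\<^sup>2 + \<rho>) * vec_index z k)) + \<rho> * (lam k / ((lam k)\<^sup>2 + \<rho>) * vec_index z k)
          = ((lam k)\<^sup>2 + \<rho>) * (lam k / ((lam k)\<^sup>2 + \<rho>) * vec_index z k)"
        by (rule fac)
      also have "\<dots> = lam k * vec_index z k" using pos[of k] by simp
      finally show "vec_index (?L *\<^sub>v (?L *\<^sub>v v) + \<rho> \<cdot>\<^sub>v v) k = vec_index (?L *\<^sub>v z) k"
        using k vc zc Lvc by (simp add: Lv v_def)
    qed (use L vc in simp)
    also have "Q *\<^sub>v (?L *\<^sub>v z) = X\<^sup>T *\<^sub>v y" using Xtv[OF yc] Pty by simp
    finally have "inv_mat ?A *\<^sub>v (X\<^sup>T *\<^sub>v y) = Q *\<^sub>v v"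
      by (rule inv_mat_solve[OF A det_ridge[OF X \<rho>] Qv])
    then show ?thesis using X by (simp add: ridge_init_def)
  qed
  let ?I = "inv_mat (?L * ?L + \<rho> \<cdot>\<^sub>m 1\<^sub>m r)"
  have "?L * ?L + \<rho> \<cdot>\<^sub>m 1\<^sub>m r = mat_diag r (\<lambda>k. (lam k)\<^sup>2 + \<rho>)"
    unfolding Lam_mat_def mat_diag_diag by (intro eq_matI) (auto simp: mat_diag_def power2_eq_square)
  then have I: "?I = mat_diag r (\<lambda>k. 1 / ((lam k)\<^sup>2 + \<rho>))"
    using inv_mat_diag[of r "\<lambda>k. (lam k)\<^sup>2 + \<rho>"] pos by (simp add: less_imp_neq[THEN not_sym])
  have Ic: "?I \<in> carrier_mat r r" unfolding I by simp
  have QI: "Q * ?I \<in> carrier_mat p r" using Q Ic by simp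
  define w where "w = Matrix.vec r (\<lambda>k. 1 / ((lam k)\<^sup>2 + \<rho>) * vec_index v k)"
  have wc: "w \<in> carrier_vec r" by (simp add: w_def)
  have "(Q * ?I * Q\<^sup>T) *\<^sub>v (Q *\<^sub>v v) = (Q * ?I) *\<^sub>v v"
    using assoc_mult_mat_vec[OF QI Qt Qv] QQv[OF vc] by simp
  also have "\<dots> = Q *\<^sub>v (?I *\<^sub>v v)"
    by (rule assoc_mult_mat_vec[OF Q Ic vc])
  also have "?I *\<^sub>v v = w" unfolding I w_def by (rule mat_diag_mult_vec[OF vc])
  finally have corr: "ridge_corr X Q lam \<rho> y = Q *\<^sub>v v + \<rho> \<cdot>\<^sub>v (Q *\<^sub>v w)"
    unfolding ridge_corr_def init Let_def using Q by simp
  have "vec_index (ridge_corr X Q lam \<rho> y) j = (\<Sum>k<r. Q $$ (j, k) * vec_index v k) + \<rho> * (\<Sum>k<r. Q $$ (j, k) * vec_index w k)"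
    unfolding corr using j Q vc wc mult_mat_vec_index_sum[OF Q vc j] mult_mat_vec_index_sum[OF Q wc j] by simp
  also have "\<dots> = (\<Sum>k<r. Q $$ (j, k) * (wgt lam \<rho> k * vec_index z k))"
    unfolding sum_distrib_left sum.distrib[symmetric]
  proof (intro sum.cong refl)
    fix k assume "k \<in> {..<r}"
    have "q * (c / a * x) + \<rho> * (q * (1 / a * (c / a * x))) = q * ((c / a + \<rho> * c / a\<^sup>2) * x)" for q c a x :: real
      by (simp add: power2_eq_square algebra_simps)
    then show "Q $$ (j, k) * vec_index v k + \<rho> * (Q $$ (j, k) * vec_index w k) = Q $$ (j, k) * (wgt lam \<rho> k * vec_index z k)"
      using \<open>k \<in> {..<r}\<close> by (simp add: v_def w_def wgt_def)
  qed
  finally show ?thesis by (simp add: y_def z_def)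
qed

section \<open>Comparison of maxima\<close>

lemma gauss_moments:
  assumes s: "0 < s"
  shows "integrable (gauss s) (\<lambda>x. \<bar>x\<bar> ^ 3)" "integrable (gauss s) (\<lambda>x. x)" "integrable (gauss s) (\<lambda>x. x\<^sup>2)"
    "(\<integral>x. x \<partial>gauss s) = 0" "(\<integral>x. x\<^sup>2 \<partial>gauss s) = s\<^sup>2"
proof -
  have i: "integrable (gauss s) f \<longleftrightarrow> integrable lborel (\<lambda>x. normal_density 0 s x * f x)"
    if "f \<in> borel_measurable borel" for f :: "real \<Rightarrow> real"
    unfolding gauss_def using that by (subst integrable_density) auto
  have e: "(\<integral>x. f x \<partial>gauss s) = (\<integral>x. normal_density 0 s x * f x \<partial>lborel)"
    if "f \<in> borel_measurable borel" for f :: "real \<Rightarrow> real"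
    unfolding gauss_def using that by (subst integral_density) auto
  show "integrable (gauss s) (\<lambda>x. \<bar>x\<bar> ^ 3)"
    using integrable_normal_moment_abs[OF s, of 0 3] by (subst i) auto
  show "integrable (gauss s) (\<lambda>x. x)"
    using integrable_normal_moment_nz_1[OF s, of 0] by (subst i) auto
  show "integrable (gauss s) (\<lambda>x. x\<^sup>2)"
    using integrable_normal_moment[OF s, of 0 2] by (subst i) auto
  show "(\<integral>x. x \<partial>gauss s) = 0"
    using integral_normal_moment_nz_1[OF s, of 0] by (subst e) auto
  show "(\<integral>x. x\<^sup>2 \<partial>gauss s) = s\<^sup>2"
    using integral_normal_moment_even[OF s, of 0 1] s by (subst e) (auto simp: fact_numeral power2_eq_square)
qed

text \<open>The smooth proxy for the event that all coordinates lie below a level \<open>c\<close> is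
  \<open>exp (- (\<Sum>i. exp (\<beta> * (T i - c))))\<close>; compared with a smoothed indicator of a soft maximum
  its derivatives need no chain rule.\<close>

lemma max_comparison:
  fixes D D' :: "real measure" and w :: "'i \<Rightarrow> nat \<Rightarrow> real"
  assumes law: "third_moment_law D"
    and law': "third_moment_law D'"
    and mean: "(\<integral>x. x \<partial>D) = (\<integral>x. x \<partial>D')" and var: "(\<integral>x. x\<^sup>2 \<partial>D) = (\<integral>x. x\<^sup>2 \<partial>D')"
    and I: "finite I" and J: "finite J" and V: "\<And>i l. i \<in> J \<Longrightarrow> l \<in> I \<Longrightarrow> \<bar>w i l\<bar> \<le> V l" "\<And>l. l \<in> I \<Longrightarrow> 0 \<le> V l"
    and \<beta>: "0 < \<beta>"
  shows "measure (iid I D) {x \<in> space (iid I D). \<forall>i\<in>J. (\<Sum>l\<in>I. w i l * x l) \<le> y}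
    \<le> measure (iid I D') {x \<in> space (iid I D'). \<forall>i\<in>J. (\<Sum>l\<in>I. w i l * x l) \<le> y + 2 * d}
      + 6 * \<beta> ^ 3 * (\<Sum>l\<in>I. V l ^ 3) * (third_moment D + third_moment D')
      + real (card J) * exp (- \<beta> * d) + exp (- exp (\<beta> * d))"
proof -
  let ?M = "iid I D" and ?M' = "iid I D'"
  note D = third_moment_lawD[OF law] and D' = third_moment_lawD[OF law']
  interpret M: prob_space ?M using D by (auto intro!: prob_space_PiM)
  interpret M': prob_space ?M' using D' by (auto intro!: prob_space_PiM)
  note [measurable_cong] = D(2) D'(2)
  define T where "T i x = (\<Sum>l\<in>I. w i l * x l)" for i and x :: "nat \<Rightarrow> real"
  \<comment> \<open>The level \<open>y + d\<close> lies halfway between \<open>y\<close> and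
    \<open>y + 2 * d\<close>. If all sums are below \<open>y\<close>, every inner exponential is at
    most \<open>exp (- \<beta> * d)\<close>; if some sum exceeds \<open>y + 2 * d\<close>, one of
    them is at least \<open>exp (\<beta> * d)\<close>.\<close>
  define f where "f x = exp (- (\<Sum>i\<in>J. exp (\<beta> * (T i x - (y + d)))))" for x
  have T_meas[measurable]: "T i \<in> borel_measurable (PiM I (\<lambda>_. borel))" for i
    unfolding T_def by measurable
  have f_meas[measurable]: "f \<in> borel_measurable (PiM I (\<lambda>_. borel))"
    unfolding f_def by measurable
  have f01: "0 \<le> f x" "f x \<le> 1" for x
    unfolding f_def by (auto intro!: sum_nonneg)
  have "\<bar>(\<integral>x. f x \<partial>?M) - (\<integral>x. f x \<partial>?M')\<bar>
      \<le> (\<Sum>l\<in>I. 6 * (\<beta> * V l) ^ 3) * (third_moment D + third_moment D')"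
  proof (rule lindeberg_swap[OF law law' mean var I f_meas])
    show "\<bar>f x\<bar> \<le> 1" for x using f01[of x] by simp
    fix l and x :: "nat \<Rightarrow> real" assume l: "l \<in> I"
    have "T i (x(l := s)) = (\<Sum>k\<in>I - {l}. w i k * x k) + w i l * s" for i s
    proof -
      have "T i (x(l := s)) = w i l * s + (\<Sum>k\<in>I - {l}. w i k * (x(l := s)) k)"
        unfolding T_def using I l by (subst sum.remove[of I l]) auto
      also have "(\<Sum>k\<in>I - {l}. w i k * (x(l := s)) k) = (\<Sum>k\<in>I - {l}. w i k * x k)"
        by (intro sum.cong) auto
      finally show ?thesis by (simp only: add.commute)
    qed
    then have "f (x(l := s)) = exp (- (\<Sum>i\<in>J. exp (\<beta> * ((\<Sum>k\<in>I - {l}. w i k * x k) - (y + d)) + \<beta> * w i l * s)))" for s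
      by (simp add: f_def algebra_simps)
    moreover have "\<bar>\<beta> * w i l\<bar> \<le> \<beta> * V l" if "i \<in> J" for i
      using V(1)[OF that l] \<beta> by (simp add: abs_mult)
    moreover have "0 \<le> \<beta> * V l" using V(2)[OF l] \<beta> by simp
    ultimately show "\<exists>a b c. \<forall>s. \<bar>f (x(l := s)) - (a + b * s + c * s\<^sup>2)\<bar> \<le> 6 * (\<beta> * V l) ^ 3 * \<bar>s\<bar> ^ 3"
      using exp_neg_sum_exp_taylor[OF J, of "\<beta> * V l" "\<lambda>i. \<beta> * w i l"] by simp
  qed
  moreover have "(\<Sum>l\<in>I. 6 * (\<beta> * V l) ^ 3) = 6 * \<beta> ^ 3 * (\<Sum>l\<in>I. V l ^ 3)"
    by (simp add: power_mult_distrib sum_distrib_left mult.assoc)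
  ultimately have lind: "(\<integral>x. f x \<partial>?M) \<le> (\<integral>x. f x \<partial>?M')
      + 6 * \<beta> ^ 3 * (\<Sum>l\<in>I. V l ^ 3) * (third_moment D + third_moment D')"
    by (simp only:)
  have f_int: "integrable ?M f" "integrable ?M' f"
    using f01 by (auto intro!: M.integrable_const_bound[where B=1] M'.integrable_const_bound[where B=1])
  let ?A = "{x \<in> space ?M. \<forall>i\<in>J. T i x \<le> y}"
  have A_meas: "?A \<in> sets ?M" using J by measurable
  have A_int: "integrable ?M (indicator ?A :: _ \<Rightarrow> real)"
    using A_meas by (intro integrable_real_indicator) (auto simp: M.emeasure_eq_measure)
  have lower: "indicator ?A x \<le> f x + real (card J) * exp (- \<beta> * d)" for x
  proof (cases "x \<in> ?A")
    case True
    have "(\<Sum>i\<in>J. exp (\<beta> * (T i x - (y + d)))) \<le> (\<Sum>i\<in>J. exp (- \<beta> * d))"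
    proof (rule sum_mono)
      fix i assume "i \<in> J"
      then have "T i x - (y + d) \<le> - d" using True by auto
      then have "\<beta> * (T i x - (y + d)) \<le> \<beta> * (- d)" using \<beta> by (intro mult_left_mono) auto
      then show "exp (\<beta> * (T i x - (y + d))) \<le> exp (- \<beta> * d)" by simp
    qed
    then have "1 - real (card J) * exp (- \<beta> * d) \<le> 1 + - (\<Sum>i\<in>J. exp (\<beta> * (T i x - (y + d))))" by simp
    also have "\<dots> \<le> f x" unfolding f_def by (rule exp_ge_add_one_self)
    finally show ?thesis using True by simp
  qed (simp add: f01 add_nonneg_nonneg)
  have "measure ?M ?A = (\<integral>x. indicator ?A x \<partial>?M)" using A_meas by simp
  also have "\<dots> \<le> (\<integral>x. f x + real (card J) * exp (- \<beta> * d) \<partial>?M)"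
    using lower f_int A_int by (intro integral_mono) auto
  also have "\<dots> = (\<integral>x. f x \<partial>?M) + real (card J) * exp (- \<beta> * d)"
    using f_int by (simp add: M.prob_space)
  finally have 1: "measure ?M ?A \<le> (\<integral>x. f x \<partial>?M) + real (card J) * exp (- \<beta> * d)" .
  let ?B = "{x \<in> space ?M'. \<forall>i\<in>J. T i x \<le> y + 2 * d}"
  have B_meas: "?B \<in> sets ?M'" using J by measurable
  have B_int: "integrable ?M' (indicator ?B :: _ \<Rightarrow> real)"
    using B_meas by (intro integrable_real_indicator) (auto simp: M'.emeasure_eq_measure)
  have upper: "f x \<le> indicator ?B x + exp (- exp (\<beta> * d))" if "x \<in> space ?M'" for x
  proof (cases "x \<in> ?B")
    case False
    then have "\<not> (\<forall>i\<in>J. T i x \<le> y + 2 * d)" using that by blast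
    then obtain i where i: "i \<in> J" "y + 2 * d < T i x" by (auto simp: not_le)
    then have "\<beta> * d \<le> \<beta> * (T i x - (y + d))" using \<beta> by (intro mult_left_mono) auto
    then have "exp (\<beta> * d) \<le> exp (\<beta> * (T i x - (y + d)))" by simp
    also have "\<dots> \<le> (\<Sum>i\<in>J. exp (\<beta> * (T i x - (y + d))))" using J i by (intro member_le_sum) auto
    finally show ?thesis using False by (simp add: f_def)
  qed (use f01[of x] in \<open>simp add: add_increasing2\<close>)
  have "(\<integral>x. f x \<partial>?M') \<le> (\<integral>x. indicator ?B x + exp (- exp (\<beta> * d)) \<partial>?M')"
    using upper f_int B_int by (intro integral_mono) auto
  also have "\<dots> = measure ?M' ?B + exp (- exp (\<beta> * d))"
    using B_int by (subst Bochner_Integration.integral_add) (auto simp: M'.prob_space B_meas)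
  finally have 2: "(\<integral>x. f x \<partial>?M') \<le> measure ?M' ?B + exp (- exp (\<beta> * d))" .
  show ?thesis using lind 1 2 unfolding T_def by linarith
qed

section \<open>Two-sided maxima: signed rows and the two error budgets\<close>

abbreviation all_below :: "nat set \<Rightarrow> 'i set \<Rightarrow> ('i \<Rightarrow> nat \<Rightarrow> real) \<Rightarrow> (nat \<Rightarrow> real) measure \<Rightarrow> real \<Rightarrow> (nat \<Rightarrow> real) set" where
  "all_below I M t E y \<equiv> {z \<in> space E. \<forall>i\<in>M. \<bar>\<Sum>l\<in>I. t i l * z l\<bar> \<le> y}"

text \<open>The cost of exchanging the two laws: the Lindeberg term, with \<open>\<mu>\<close> the
  sum of the third moments and \<open>B\<close> the sum of cubed coefficient bounds, followed by the
  two errors of the smooth proxy. The factor 2 counts the signs of the \<open>k\<close>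
  rows.\<close>

definition swap_error :: "real \<Rightarrow> real \<Rightarrow> real \<Rightarrow> real \<Rightarrow> real \<Rightarrow> real" where
  "swap_error \<mu> B k \<beta> d = 6 * \<beta> ^ 3 * B * \<mu> + 2 * k * exp (- \<beta> * d) + exp (- exp (\<beta> * d))"

text \<open>The Gaussian mass of a window of width \<open>h\<close>: anti-concentration at levels of
  size at most \<open>x0\<close>, plus a union bound over the tails of the \<open>2 * k\<close>
  signed rows beyond \<open>x0\<close>.\<close>

definition window_error :: "real \<Rightarrow> real \<Rightarrow> real \<Rightarrow> real \<Rightarrow> real \<Rightarrow> real" where
  "window_error s lo k h x0 = exp (3/2) * (h / lo) * (2 * x0 / lo + h / lo + s) / s\<^sup>2 + 2 * k * exp (- x0\<^sup>2 / (2 * s\<^sup>2))"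

lemma all_abs_le_signs_iff:
  fixes t :: "'i \<Rightarrow> nat \<Rightarrow> real"
  shows "(\<forall>i\<in>M. \<bar>\<Sum>l\<in>I. t i l * z l\<bar> \<le> c)
    \<longleftrightarrow> (\<forall>p\<in>M \<times> {1, - 1 :: real}. (\<Sum>l\<in>I. (snd p * t (fst p) l) * z l) \<le> c)"
  by (auto simp: abs_le_iff sum_negf)

lemma abs_max_comparison:
  fixes D D' :: "real measure" and t :: "'i \<Rightarrow> nat \<Rightarrow> real"
  assumes law: "third_moment_law D"
    and law': "third_moment_law D'"
    and mean: "(\<integral>x. x \<partial>D) = (\<integral>x. x \<partial>D')" and var: "(\<integral>x. x\<^sup>2 \<partial>D) = (\<integral>x. x\<^sup>2 \<partial>D')"
    and I: "finite I" and M: "finite M" and V: "\<And>i l. i \<in> M \<Longrightarrow> l \<in> I \<Longrightarrow> \<bar>t i l\<bar> \<le> V l" "\<And>l. l \<in> I \<Longrightarrow> 0 \<le> V l"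
    and \<beta>: "0 < \<beta>"
  shows "measure (iid I D) (all_below I M t (iid I D) y)
    \<le> measure (iid I D') (all_below I M t (iid I D') (y + 2 * d))
      + swap_error (third_moment D + third_moment D') (\<Sum>l\<in>I. V l ^ 3) (real (card M)) \<beta> d"
proof -
  have "card (M \<times> {1, - 1 :: real}) = 2 * card M"
    by (simp add: card_cartesian_product card_insert_if)
  moreover have "\<bar>snd p * t (fst p) l\<bar> \<le> V l" if "p \<in> M \<times> {1, - 1 :: real}" "l \<in> I" for p l
    using that V(1) by (auto simp: abs_mult)
  ultimately show ?thesis
    using max_comparison[OF law law' mean var I, of "M \<times> {1, -1}" "\<lambda>p l. snd p * t (fst p) l" V \<beta> y d] M V(2) \<beta>
    unfolding all_abs_le_signs_iff swap_error_def by simp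
qed

text \<open>The one-sided bound grows with the level, so three ranges are separated. Below
  \<open>- x0\<close> the larger event is empty, as \<open>h \<le> x0\<close>; up to
  \<open>x0\<close> the window bound applies; above \<open>x0\<close> the smaller event already has
  probability close to 1. Negative levels must be covered because the lower comparison moves
  \<open>x\<close> to the left.\<close>

lemma gauss_abs_max_anticoncentration:
  fixes t :: "'i \<Rightarrow> nat \<Rightarrow> real"
  assumes s: "0 < s" and I: "finite I" and M: "finite M" "M \<noteq> {}" and lo: "0 < lo" and h: "0 < h" "h \<le> x0"
    and t: "\<And>i. i \<in> M \<Longrightarrow> lo\<^sup>2 \<le> (\<Sum>l\<in>I. (t i l)\<^sup>2)" "\<And>i. i \<in> M \<Longrightarrow> (\<Sum>l\<in>I. (t i l)\<^sup>2) \<le> 1"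
  shows "measure (gauss_vec I s) (all_below I M t (gauss_vec I s) (y + h))
    \<le> measure (gauss_vec I s) (all_below I M t (gauss_vec I s) y) + window_error s lo (real (card M)) h x0"
proof -
  interpret PI: prob_space "gauss_vec I s" by (rule prob_space_gauss_vec[OF s])
  let ?G = "gauss_vec I s"
  define w where "w p l = snd p * t (fst p) l" for p :: "'i \<times> real" and l
  let ?J = "M \<times> {1, - 1 :: real}"
  let ?A = "all_below I M t ?G"
  have A_meas: "?A c \<in> sets ?G" for c using M by measurable
  have w_sq: "(\<Sum>l\<in>I. (w p l)\<^sup>2) = (\<Sum>l\<in>I. (t (fst p) l)\<^sup>2)" if "p \<in> ?J" for p
    using that by (auto simp: w_def power_mult_distrib)
  have card_J: "card ?J = 2 * card M" "finite ?J" using M by (simp_all add: card_cartesian_product card_insert_if)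
  define E1 where "E1 = exp (3/2) * (h / lo) * (2 * x0 / lo + h / lo + s) / s\<^sup>2"
  define E2 where "E2 = 2 * real (card M) * exp (- x0\<^sup>2 / (2 * s\<^sup>2))"
  have E: "0 \<le> E1" "0 \<le> E2" using h lo s by (auto simp: E1_def E2_def)
  have "measure ?G (?A (y + h)) \<le> measure ?G (?A y) + (E1 + E2)"
  proof -
    consider "y < - x0" | "\<bar>y\<bar> \<le> x0" | "x0 < y" by linarith
    then show ?thesis
    proof cases
      case 1
      have "?A (y + h) = {}"
      proof -
        obtain i where "i \<in> M" using M by auto
        have "\<not> \<bar>a\<bar> \<le> y + h" for a :: real using 1 h by (simp add: abs_le_iff)
        then show ?thesis using \<open>i \<in> M\<close> by auto
      qed
      then have "measure ?G (?A (y + h)) = 0" by (simp only: measure_empty)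
      then show ?thesis using E measure_nonneg[of ?G "?A y"] by linarith
    next
      case 2
      let ?W = "{z \<in> space ?G. (\<exists>p\<in>?J. y < (\<Sum>l\<in>I. w p l * z l)) \<and> (\<forall>p\<in>?J. (\<Sum>l\<in>I. w p l * z l) \<le> y + h)}"
      have W_meas: "?W \<in> sets ?G" using card_J by measurable
      have "measure ?G ?W \<le> exp (3/2) * (h / lo) * (2 * \<bar>y\<bar> / lo + h / lo + s) / s\<^sup>2"
        using w_sq t(1) by (intro gauss_max_anticoncentration[OF s I card_J(2) lo h(1)]) auto
      also have "\<dots> \<le> E1"
        unfolding E1_def using 2 lo h s by (intro divide_right_mono mult_left_mono add_right_mono) auto
      finally have W: "measure ?G ?W \<le> E1" .
      have "?A (y + h) \<subseteq> ?A y \<union> ?W"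
        unfolding all_abs_le_signs_iff w_def by force
      then have "measure ?G (?A (y + h)) \<le> measure ?G (?A y \<union> ?W)"
        using A_meas W_meas by (intro PI.finite_measure_mono) auto
      also have "\<dots> \<le> measure ?G (?A y) + measure ?G ?W"
        using A_meas W_meas by (intro measure_Un_le) auto
      finally show ?thesis using W E by linarith
    next
      case 3
      let ?T = "\<lambda>p. {z \<in> space ?G. x0 < (\<Sum>l\<in>I. w p l * z l)}"
      have T_meas: "?T p \<in> sets ?G" for p by measurable
      have T_UN: "(\<Union>p\<in>?J. ?T p) \<in> sets ?G"
        using card_J(2) T_meas by (intro sets.finite_UN) auto
      have "space ?G \<subseteq> ?A y \<union> (\<Union>p\<in>?J. ?T p)"
        unfolding all_abs_le_signs_iff w_def[symmetric] using 3 by force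
      then have "measure ?G (space ?G) \<le> measure ?G (?A y \<union> (\<Union>p\<in>?J. ?T p))"
        by (intro PI.finite_measure_mono sets.Un A_meas T_UN)
      also have "\<dots> \<le> measure ?G (?A y) + measure ?G (\<Union>p\<in>?J. ?T p)"
        by (intro measure_Un_le A_meas T_UN)
      also have "measure ?G (\<Union>p\<in>?J. ?T p) \<le> (\<Sum>p\<in>?J. measure ?G (?T p))"
        using T_meas card_J(2) by (intro PI.finite_measure_subadditive_finite) auto
      also have "\<dots> \<le> (\<Sum>p\<in>?J. exp (- x0\<^sup>2 / (2 * s\<^sup>2)))"
        using w_sq t(2) h by (intro sum_mono gauss_tail[OF s I]) auto
      also have "\<dots> = E2" using card_J by (simp add: E2_def)
      finally have "1 \<le> measure ?G (?A y) + E2" by (simp add: PI.prob_space)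
      then show ?thesis using PI.prob_le_1[of "?A (y + h)"] E by linarith
    qed
  qed
  then show ?thesis by (simp add: E1_def E2_def window_error_def)
qed

section \<open>The estimators at a fixed sample size\<close>

lemma finite_Mset [simp]: "finite (Mset M Q \<beta> b)"
  by (simp add: Mset_def)

lemma tau_gen_pos:
  assumes "0 < n"
  shows "0 < tau_gen n M Q lam \<rho> N i" "1 / sqrt (real n) \<le> tau_gen n M Q lam \<rho> N i"
    "(\<Sum>k<dim_col Q. (cc M Q N i k * wgt lam \<rho> k)\<^sup>2) \<le> (tau_gen n M Q lam \<rho> N i)\<^sup>2"
proof -
  let ?S = "\<Sum>k<dim_col Q. (cc M Q N i k)\<^sup>2 * (wgt lam \<rho> k)\<^sup>2"
  have S: "0 \<le> ?S" by (intro sum_nonneg) auto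
  show "0 < tau_gen n M Q lam \<rho> N i"
    unfolding tau_gen_def using S assms by (intro real_sqrt_gt_zero add_nonneg_pos) auto
  show "1 / sqrt (real n) \<le> tau_gen n M Q lam \<rho> N i"
  proof -
    have "1 / sqrt (real n) = sqrt (1 / real n)" by (simp add: real_sqrt_divide)
    then show ?thesis unfolding tau_gen_def using S by (simp only: real_sqrt_le_iff)
  qed
  show "(\<Sum>k<dim_col Q. (cc M Q N i k * wgt lam \<rho> k)\<^sup>2) \<le> (tau_gen n M Q lam \<rho> N i)\<^sup>2"
    unfolding tau_gen_def using S by (simp add: power_mult_distrib)
qed

definition noise_coef :: "real Matrix.mat \<Rightarrow> real Matrix.mat \<Rightarrow> (nat \<Rightarrow> real) \<Rightarrow> real \<Rightarrow> nat \<Rightarrow> nat \<Rightarrow> real" where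
  "noise_coef P Q lam \<rho> j l = (\<Sum>k<dim_col Q. Q $$ (j, k) * wgt lam \<rho> k * P $$ (l, k))"

definition zeta :: "real Matrix.mat \<Rightarrow> real Matrix.vec \<Rightarrow> nat \<Rightarrow> real" where
  "zeta Q \<beta> k = (\<Sum>i<dim_row Q. Q $$ (i, k) * vec_index \<beta> i)"

text \<open>The relative bias left in singular direction \<open>k\<close>: plain ridge loses the
  fraction \<rho> / (\<lambda>^2 + \<rho>), and the correction squares it (see
  \<open>wgt_mult_lam\<close>).\<close>

definition shrink :: "(nat \<Rightarrow> real) \<Rightarrow> real \<Rightarrow> nat \<Rightarrow> real" where
  "shrink lam \<rho> k = (\<rho> / ((lam k)\<^sup>2 + \<rho>))\<^sup>2"

lemma wgt_mult_lam:
  assumes "0 < \<rho>"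
  shows "wgt lam \<rho> k * lam k = 1 - shrink lam \<rho> k"
proof -
  define a where "a = (lam k)\<^sup>2 + \<rho>"
  have a: "0 < a" using assms by (simp add: a_def add_nonneg_pos)
  have "wgt lam \<rho> k * lam k = (a - \<rho>) / a + \<rho> * (a - \<rho>) / a\<^sup>2"
    by (simp add: wgt_def a_def power2_eq_square algebra_simps)
  also have "\<dots> = 1 - (\<rho> / a)\<^sup>2"
    using a by (simp add: field_simps power2_eq_square)
  finally show ?thesis by (simp add: shrink_def a_def)
qed

text \<open>Everything here concerns one sample size, so the limit argument only has to insert
  rates. \<open>q\<close> becomes \<open>p - r\<close>.\<close>

locale ridge_model =
  fixes n p p1 r q :: nat and X M P Q Qp :: "real Matrix.mat" and \<beta> :: "real Matrix.vec"
    and lam :: "nat \<Rightarrow> real" and \<rho> b :: real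
  assumes X: "X \<in> carrier_mat n p" and \<beta>: "\<beta> \<in> carrier_vec p" and M: "M \<in> carrier_mat p1 p"
    and P: "P \<in> carrier_mat n r" and Q: "Q \<in> carrier_mat p r" and Qp: "Qp \<in> carrier_mat p q"
    and svd: "X = P * Lam_mat r lam * Q\<^sup>T"
    and PP: "P\<^sup>T * P = 1\<^sub>m r" and QQ: "Q\<^sup>T * Q = 1\<^sub>m r"
    and perp: "Q * Q\<^sup>T + Qp * Qp\<^sup>T = 1\<^sub>m p"
    and \<rho>: "0 < \<rho>" and n: "0 < n"
begin

abbreviation "N \<equiv> Nb Q \<beta> b"
abbreviation "\<M> \<equiv> Mset M Q \<beta> b"
abbreviation "\<theta> j \<equiv> vec_index (theta_of Q \<beta>) j"
abbreviation "\<tau> i \<equiv> tau_gen n M Q lam \<rho> N i"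
abbreviation "t i l \<equiv> t_coef n M P Q lam \<beta> \<rho> b i l"
abbreviation "resp e \<equiv> X *\<^sub>v \<beta> + Matrix.vec n e"
abbreviation "noise j e \<equiv> (\<Sum>l<n. noise_coef P Q lam \<rho> j l * e l)"
abbreviation "bias j \<equiv> (\<Sum>k<r. Q $$ (j, k) * (shrink lam \<rho> k * zeta Q \<beta> k))"

abbreviation "est j e \<equiv> vec_index (ridge_corr X Q lam \<rho> (resp e)) j"
abbreviation "dev i e \<equiv> vec_index (gamma_hat M X Q lam \<rho> b (resp e)) i - vec_index (M *\<^sub>v \<beta>) i"
abbreviation "stat_at e \<equiv> stat X \<beta> M Q lam \<rho> b (resp e)"

lemma dims: "dim_row X = n" "dim_col X = p" "dim_row M = p1" "dim_col M = p" "dim_row Q = p" "dim_col Q = r"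
  using X M Q by auto

lemma t_coef_sum:
  fixes e :: "nat \<Rightarrow> real"
  shows "(\<Sum>l<n. t i l * e l)
    = (\<Sum>k<r. cc M Q N i k * wgt lam \<rho> k * (\<Sum>l<n. P $$ (l, k) * e l)) / \<tau> i"
proof -
  have "(\<Sum>l<n. t i l * e l)
      = (\<Sum>l<n. \<Sum>k<r. cc M Q N i k * wgt lam \<rho> k * (P $$ (l, k) * e l)) / \<tau> i"
    unfolding sum_divide_distrib[of _ "{..<n}"] t_coef_def dims times_divide_eq_left sum_distrib_right
    by (simp only: mult_ac)
  also have "(\<Sum>l<n. \<Sum>k<r. cc M Q N i k * wgt lam \<rho> k * (P $$ (l, k) * e l))
      = (\<Sum>k<r. \<Sum>l<n. cc M Q N i k * wgt lam \<rho> k * (P $$ (l, k) * e l))"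
    by (rule sum.swap)
  finally show ?thesis by (simp add: sum_distrib_left)
qed

lemma t_coef_sq:
  shows "(\<Sum>l<n. (t i l)\<^sup>2)
    = (\<Sum>k<r. (cc M Q N i k * wgt lam \<rho> k)\<^sup>2) / (\<tau> i)\<^sup>2"
proof -
  have "(\<Sum>l<n. (t i l)\<^sup>2)
      = (\<Sum>l<n. (\<Sum>k<r. P $$ (l, k) * (cc M Q N i k * wgt lam \<rho> k))\<^sup>2) / (\<tau> i)\<^sup>2"
    unfolding sum_divide_distrib[of _ "{..<n}"]
    by (simp only: t_coef_def dims power_divide[symmetric] mult_ac)
  also have "(\<Sum>l<n. (\<Sum>k<r. P $$ (l, k) * (cc M Q N i k * wgt lam \<rho> k))\<^sup>2)
      = (\<Sum>k<r. (cc M Q N i k * wgt lam \<rho> k)\<^sup>2)"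
    using orthonormal_cols_sum[OF P PP] by (intro orthonormal_sum_sq) auto
  finally show ?thesis .
qed

text \<open>The Gaussians on the \<open>r\<close> singular directions are realised as P^T z for
  \<open>n\<close> independent Gaussians z. The limit law then uses the same coefficients
  \<open>t\<close> and the same index set as the errors, which is what a coordinatewise replacement
  requires.\<close>

lemma H_fun_eq:
  assumes ne: "\<M> \<noteq> {}" and s: "0 < s"
  shows "H_fun n M Q lam \<beta> \<rho> b s x
    = measure (gauss_vec {..<n} s) (all_below {..<n} \<M> t (gauss_vec {..<n} s) x)"
proof -
  define T where "T i \<xi> = \<bar>\<Sum>k<r. cc M Q N i k * wgt lam \<rho> k * \<xi> k\<bar> / \<tau> i" for i and \<xi> :: "nat \<Rightarrow> real"
  have T_meas[measurable]: "T i \<in> borel_measurable (gauss_vec {..<r} s)" for i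
    unfolding T_def by measurable
  define S where "S = {\<xi> \<in> space (gauss_vec {..<r} s). \<forall>i\<in>\<M>. T i \<xi> \<le> x}"
  have S_meas[measurable]: "S \<in> sets (gauss_vec {..<r} s)"
    unfolding S_def by measurable
  have H: "H_fun n M Q lam \<beta> \<rho> b s x = measure (gauss_vec {..<r} s) S"
    unfolding H_fun_def dims S_def T_def using ne by (simp add: Max_le_iff)
  define L where "L z = (\<lambda>k\<in>{..<r}. \<Sum>l<n. P $$ (l, k) * z l)" for z :: "nat \<Rightarrow> real"
  have L_meas[measurable]: "L \<in> measurable (gauss_vec {..<n} s) (gauss_vec {..<r} s)"
    unfolding L_def by (rule measurable_restrict) measurable
  have T_L: "T i (L z) = \<bar>\<Sum>l<n. t i l * z l\<bar>" for i z
    using tau_gen_pos(1)[OF n, of M Q lam \<rho> N i]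
    by (simp add: T_def L_def t_coef_sum)
  have "emeasure (gauss_vec {..<r} s) S = (\<integral>\<^sup>+\<xi>. indicator S \<xi> \<partial>gauss_vec {..<r} s)" by simp
  also have "\<dots> = (\<integral>\<^sup>+z. indicator S (L z) \<partial>gauss_vec {..<n} s)"
    unfolding L_def using orthonormal_cols_sum[OF P PP]
    by (intro gauss_orthonormal[OF s, symmetric]) auto
  also have "\<dots> = (\<integral>\<^sup>+z. indicator {z \<in> space (gauss_vec {..<n} s). L z \<in> S} z \<partial>gauss_vec {..<n} s)"
    by (intro nn_integral_cong) (auto simp: indicator_def)
  also have "\<dots> = emeasure (gauss_vec {..<n} s) {z \<in> space (gauss_vec {..<n} s). L z \<in> S}"
    by (rule nn_integral_indicator) measurable
  also have "{z \<in> space (gauss_vec {..<n} s). L z \<in> S}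
      = all_below {..<n} \<M> t (gauss_vec {..<n} s) x"
    using measurable_space[OF L_meas] by (auto simp: S_def T_L)
  finally show ?thesis
    unfolding H by (simp add: measure_def)
qed

lemma noise_coef_sum:
  fixes e :: "nat \<Rightarrow> real"
  shows "noise j e = (\<Sum>k<r. Q $$ (j, k) * (wgt lam \<rho> k * (\<Sum>l<n. P $$ (l, k) * e l)))"
proof -
  have "noise j e = (\<Sum>l<n. \<Sum>k<r. Q $$ (j, k) * (wgt lam \<rho> k * (P $$ (l, k) * e l)))"
    unfolding noise_coef_def dims sum_distrib_right by (simp only: mult_ac)
  also have "\<dots> = (\<Sum>k<r. \<Sum>l<n. Q $$ (j, k) * (wgt lam \<rho> k * (P $$ (l, k) * e l)))"
    by (rule sum.swap)
  finally show ?thesis by (simp add: sum_distrib_left)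
qed

lemma noise_coef_sq:
  shows "(\<Sum>l<n. (noise_coef P Q lam \<rho> j l)\<^sup>2) = (\<Sum>k<r. (Q $$ (j, k) * wgt lam \<rho> k)\<^sup>2)"
proof -
  have "(\<Sum>l<n. (noise_coef P Q lam \<rho> j l)\<^sup>2) = (\<Sum>l<n. (\<Sum>k<r. P $$ (l, k) * (Q $$ (j, k) * wgt lam \<rho> k))\<^sup>2)"
    by (simp add: noise_coef_def dims ac_simps)
  also have "\<dots> = (\<Sum>k<r. (Q $$ (j, k) * wgt lam \<rho> k)\<^sup>2)"
    using orthonormal_cols_sum[OF P PP] by (intro orthonormal_sum_sq) auto
  finally show ?thesis .
qed

lemma ridge_corr_decomp:
  assumes j: "j < p"
  shows "est j e = \<theta> j - bias j + noise j e"
proof -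
  have "est j e
      = (\<Sum>k<r. Q $$ (j, k) * (wgt lam \<rho> k * (lam k * zeta Q \<beta> k + (\<Sum>l<n. P $$ (l, k) * e l))))"
    using ridge_corr_index[OF X P Q \<beta> svd PP QQ \<rho> j] by (simp add: zeta_def dims)
  also have "\<dots> = (\<Sum>k<r. Q $$ (j, k) * zeta Q \<beta> k - Q $$ (j, k) * (shrink lam \<rho> k * zeta Q \<beta> k)
      + Q $$ (j, k) * (wgt lam \<rho> k * (\<Sum>l<n. P $$ (l, k) * e l)))"
  proof (intro sum.cong refl)
    fix k
    have "wgt lam \<rho> k * (lam k * z + y) = z - shrink lam \<rho> k * z + wgt lam \<rho> k * y" for z y
    proof -
      have "wgt lam \<rho> k * (lam k * z + y) = (wgt lam \<rho> k * lam k) * z + wgt lam \<rho> k * y"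
        by (simp add: algebra_simps)
      then show ?thesis unfolding wgt_mult_lam[OF \<rho>] by (simp add: algebra_simps)
    qed
    then show "Q $$ (j, k) * (wgt lam \<rho> k * (lam k * zeta Q \<beta> k + (\<Sum>l<n. P $$ (l, k) * e l)))
      = Q $$ (j, k) * zeta Q \<beta> k - Q $$ (j, k) * (shrink lam \<rho> k * zeta Q \<beta> k)
        + Q $$ (j, k) * (wgt lam \<rho> k * (\<Sum>l<n. P $$ (l, k) * e l))"
      by (simp only: distrib_left right_diff_distrib)
  qed
  also have "\<dots> = \<theta> j - bias j + noise j e"
    using theta_of_index[OF Q \<beta> j] by (simp add: sum.distrib sum_subtractf noise_coef_sum zeta_def dims)
  finally show ?thesis .
qed

text \<open>The relative gap \<open>cb\<close> leaves an estimation error of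
  \<open>(1 - cb) * b\<close> harmless on both sides of the threshold; bias and noise get half of it
  each.\<close>

lemma Nhat_eq_Nb:
  assumes cb: "0 < cb" "cb < 1" and b: "0 < b"
    and gap: "\<And>i. i < p \<Longrightarrow> i \<notin> N \<Longrightarrow> \<bar>\<theta> i\<bar> \<le> cb * b" "\<And>i. i < p \<Longrightarrow> i \<in> N \<Longrightarrow> b / cb \<le> \<bar>\<theta> i\<bar>"
    and bias: "\<And>j. j < p \<Longrightarrow> \<bar>bias j\<bar> \<le> (1 - cb) * b / 2"
    and noise: "\<And>j. j < p \<Longrightarrow> \<bar>noise j e\<bar> \<le> (1 - cb) * b / 2"
  shows "Nhat X Q lam \<rho> b (resp e) = N"
proof -
  have "\<bar>est i e\<bar> > b \<longleftrightarrow> i \<in> N" if i: "i < p" for i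
  proof -
    have d: "\<bar>est i e - \<theta> i\<bar> \<le> (1 - cb) * b"
      using bias[OF i] noise[OF i] unfolding ridge_corr_decomp[OF i] by (auto simp: abs_le_iff)
    show ?thesis
    proof (cases "i \<in> N")
      case True
      \<comment> \<open>The margin above the threshold is
        \<open>1 / cb - (1 - cb) - 1 = (1 - cb)\<^sup>2 / cb\<close>.\<close>
      have "0 < (1 - cb)\<^sup>2" using cb by simp
      then have "1 < 1 / cb - (1 - cb)" using cb by (simp add: field_simps power2_eq_square)
      then have "b * 1 < b * (1 / cb - (1 - cb))" using b by (rule mult_strict_left_mono)
      then have "b < b / cb - (1 - cb) * b" by (simp add: algebra_simps)
      then show ?thesis using True gap(2)[OF i True] d by linarith
    next
      case False
      have "cb * b + (1 - cb) * b = b" by (simp add: algebra_simps)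
      then show ?thesis using False gap(1)[OF i False] d by linarith
    qed
  qed
  then show ?thesis
    unfolding Nhat_def dims by (auto simp: Nb_def dims)
qed

text \<open>The three deterministic sources of bias: shrinkage on the retained coordinates, the
  coordinates that are set to zero, and the part of \<open>\<beta>\<close> that \<open>X\<close>
  does not see.\<close>

definition rem :: "nat \<Rightarrow> real" where
  "rem i = (\<Sum>k<r. cc M Q N i k * (shrink lam \<rho> k * zeta Q \<beta> k))
    + (\<Sum>j\<in>{..<p} - N. M $$ (i, j) * \<theta> j) + (\<Sum>j<p. M $$ (i, j) * vec_index (theta_of Qp \<beta>) j)"

lemma gamma_hat_decomp:
  assumes Nhat: "Nhat X Q lam \<rho> b (resp e) = N" and i: "i < p1"
  shows "dev i e / \<tau> i
    = (\<Sum>l<n. t i l * e l) - rem i / \<tau> i"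
proof -
  have Np: "N \<subseteq> {..<p}" by (auto simp: Nb_def dims)
  have "vec_index (gamma_hat M X Q lam \<rho> b (resp e)) i = (\<Sum>j<p. M $$ (i, j) * (if j \<in> N then est j e else 0))"
    unfolding gamma_hat_def
    using mult_mat_vec_index_sum[OF M, of "theta_hat X Q lam \<rho> b (resp e)" i] i
    by (simp add: theta_hat_def dims Nhat)
  also have "\<dots> = (\<Sum>j\<in>N. M $$ (i, j) * est j e)"
    using Np by (simp add: if_distrib sum.inter_restrict[symmetric] Int_absorb1 cong: if_cong)
  also have "\<dots> = (\<Sum>j\<in>N. M $$ (i, j) * \<theta> j) - (\<Sum>j\<in>N. M $$ (i, j) * bias j) + (\<Sum>j\<in>N. M $$ (i, j) * noise j e)"
    using Np by (simp add: sum.distrib[symmetric] sum_subtractf[symmetric] ridge_corr_decomp subset_iff algebra_simps)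
  finally have g: "vec_index (gamma_hat M X Q lam \<rho> b (resp e)) i = \<dots>" .
  have exch: "(\<Sum>j\<in>N. M $$ (i, j) * (\<Sum>k<r. Q $$ (j, k) * a k)) = (\<Sum>k<r. cc M Q N i k * a k)" for a
  proof -
    have "(\<Sum>j\<in>N. M $$ (i, j) * (\<Sum>k<r. Q $$ (j, k) * a k)) = (\<Sum>j\<in>N. \<Sum>k<r. M $$ (i, j) * Q $$ (j, k) * a k)"
      by (simp add: sum_distrib_left mult.assoc)
    also have "\<dots> = (\<Sum>k<r. \<Sum>j\<in>N. M $$ (i, j) * Q $$ (j, k) * a k)" by (rule sum.swap)
    finally show ?thesis by (simp add: cc_def sum_distrib_right)
  qed
  have "vec_index (M *\<^sub>v \<beta>) i = (\<Sum>j<p. M $$ (i, j) * \<theta> j) + (\<Sum>j<p. M $$ (i, j) * vec_index (theta_of Qp \<beta>) j)"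
    using mult_mat_vec_index_sum[OF M \<beta> i] beta_split[OF Q Qp \<beta> _ perp]
    by (simp add: distrib_left sum.distrib)
  also have "(\<Sum>j<p. M $$ (i, j) * \<theta> j) = (\<Sum>j\<in>N. M $$ (i, j) * \<theta> j) + (\<Sum>j\<in>{..<p} - N. M $$ (i, j) * \<theta> j)"
    using Np by (subst sum.subset_diff[OF Np]) auto
  finally have "dev i e
      = (\<Sum>k<r. cc M Q N i k * (wgt lam \<rho> k * (\<Sum>l<n. P $$ (l, k) * e l))) - rem i"
    unfolding g rem_def noise_coef_sum dims exch by simp
  then show ?thesis
    unfolding t_coef_sum by (simp add: diff_divide_distrib mult.assoc)
qed

lemma cc_zero:
  assumes "i < p1" "i \<notin> \<M>" "k < r"
  shows "cc M Q N i k = 0"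
proof -
  have "(\<Sum>k<r. (cc M Q N i k)\<^sup>2) \<le> 0"
    using assms(1,2) by (simp add: Mset_def dims not_less)
  then have "(\<Sum>k<r. (cc M Q N i k)\<^sup>2) = 0" by (intro antisym sum_nonneg) auto
  then show ?thesis using assms(3) by (subst (asm) sum_nonneg_eq_0_iff) auto
qed

lemma stat_le_iff:
  assumes "0 < p1"
  shows "stat X \<beta> M Q lam \<rho> b y \<le> x \<longleftrightarrow> (\<forall>i<p1. \<bar>vec_index (gamma_hat M X Q lam \<rho> b y) i - vec_index (M *\<^sub>v \<beta>) i\<bar>
      / tau_gen n M Q lam \<rho> (Nhat X Q lam \<rho> b y) i \<le> x)"
  unfolding stat_def dims using assms by (subst Max_le_iff) auto

text \<open>Rows outside \<open>\<M>\<close> carry no noise, so after recovery of \<open>N\<close>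
  they contribute only their bias. The maximum over all \<open>p1\<close> rows therefore agrees with
  the one over \<open>\<M>\<close> up to \<open>\<kappa>\<close>.\<close>

lemma stat_sandwich:
  assumes Nhat: "Nhat X Q lam \<rho> b (resp e) = N" and ne: "\<M> \<noteq> {}"
    and rem: "\<And>i. i < p1 \<Longrightarrow> \<bar>rem i\<bar> / \<tau> i \<le> \<kappa>"
  shows "(\<forall>i\<in>\<M>. \<bar>\<Sum>l<n. t i l * e l\<bar> \<le> x - \<kappa>) \<Longrightarrow> stat_at e \<le> x"
    and "stat_at e \<le> x \<Longrightarrow> \<forall>i\<in>\<M>. \<bar>\<Sum>l<n. t i l * e l\<bar> \<le> x + \<kappa>"
proof -
  obtain i0 where i0: "i0 \<in> \<M>" using ne by auto
  have Mp: "i < p1" if "i \<in> \<M>" for i using that by (simp add: Mset_def dims)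
  have p1: "0 < p1" using Mp[OF i0] by simp
  have pos: "0 < \<tau> i" for i by (rule tau_gen_pos[OF n])
  have dev: "\<bar>dev i e\<bar> / \<tau> i
      = \<bar>(\<Sum>l<n. t i l * e l) - rem i / \<tau> i\<bar>" if "i < p1" for i
    unfolding gamma_hat_decomp[OF Nhat that, symmetric] using pos[of i] by simp
  have rem': "\<bar>rem i / \<tau> i\<bar> \<le> \<kappa>" if "i < p1" for i
    using rem[OF that] pos[of i] by (simp add: abs_divide)
  have iff: "stat_at e \<le> x \<longleftrightarrow> (\<forall>i<p1. \<bar>(\<Sum>l<n. t i l * e l) - rem i / \<tau> i\<bar> \<le> x)"
    unfolding stat_le_iff[OF p1] Nhat using dev by simp
  show "stat_at e \<le> x" if U: "\<forall>i\<in>\<M>. \<bar>\<Sum>l<n. t i l * e l\<bar> \<le> x - \<kappa>"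
    unfolding iff
  proof (intro allI impI)
    fix i assume i: "i < p1"
    have "\<bar>\<Sum>l<n. t i l * e l\<bar> \<le> x - \<kappa>"
    proof (cases "i \<in> \<M>")
      case False
      \<comment> \<open>The noise vanishes in this row. It remains to see that
        \<open>x - \<kappa>\<close> is nonnegative, which the row \<open>i0\<close> of the nonempty
        set \<open>\<M>\<close> supplies.\<close>
      have "t i l = 0" for l unfolding t_coef_def dims using cc_zero[OF i False] by simp
      then have "\<bar>\<Sum>l<n. t i l * e l\<bar> = 0" by simp
      also have "0 \<le> \<bar>\<Sum>l<n. t i0 l * e l\<bar>" by simp
      also have "\<dots> \<le> x - \<kappa>" using U i0 by auto
      finally show ?thesis .
    qed (use U in auto)
    then show "\<bar>(\<Sum>l<n. t i l * e l) - rem i / \<tau> i\<bar> \<le> x" using rem'[OF i] by linarith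
  qed
  show "\<forall>i\<in>\<M>. \<bar>\<Sum>l<n. t i l * e l\<bar> \<le> x + \<kappa>" if "stat_at e \<le> x"
  proof
    fix i assume "i \<in> \<M>"
    then have i: "i < p1" by (rule Mp)
    then have "\<bar>(\<Sum>l<n. t i l * e l) - rem i / \<tau> i\<bar> \<le> x" using that unfolding iff by simp
    then show "\<bar>\<Sum>l<n. t i l * e l\<bar> \<le> x + \<kappa>" using rem'[OF i] by linarith
  qed
qed

text \<open>The only obstacle is the random index set \<open>Nhat\<close>. Sums over it are
  rewritten as sums over all \<open>j < p\<close> with a case distinction inside, where
  measurability is automatic.\<close>

lemma stat_measurable:
  assumes p1: "0 < p1"
  shows "{e \<in> space (PiM {..<n} (\<lambda>_. borel)). stat_at e \<le> x} \<in> sets (PiM {..<n} (\<lambda>_. borel))"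
proof -
  let ?B = "PiM {..<n} (\<lambda>_. borel :: real measure)"
  define rc where "rc j e = \<theta> j - bias j + noise j e" for j and e :: "nat \<Rightarrow> real"
  have rc_meas[measurable]: "rc j \<in> borel_measurable ?B" for j
    unfolding rc_def by measurable
  define Y where "Y i e = (\<Sum>j<p. M $$ (i, j) * (if b < \<bar>rc j e\<bar> then rc j e else 0))" for i e
  define C where "C i k e = (\<Sum>j<p. if b < \<bar>rc j e\<bar> then M $$ (i, j) * Q $$ (j, k) else 0)" for i k e
  have Y_meas[measurable]: "Y i \<in> borel_measurable ?B" for i
    unfolding Y_def by measurable
  have C_meas[measurable]: "C i k \<in> borel_measurable ?B" for i k
    unfolding C_def by measurable
  have Nhat: "Nhat X Q lam \<rho> b (resp e) = {j. j < p \<and> b < \<bar>rc j e\<bar>}" for e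
    unfolding Nhat_def dims by (auto simp: ridge_corr_decomp rc_def)
  have Y: "vec_index (gamma_hat M X Q lam \<rho> b (resp e)) i = Y i e" if "i < p1" for i e
  proof -
    have th: "theta_hat X Q lam \<rho> b (resp e) \<in> carrier_vec p" by (simp add: theta_hat_def dims)
    show ?thesis
      unfolding gamma_hat_def mult_mat_vec_index_sum[OF M th that] Y_def
      by (intro sum.cong) (auto simp: theta_hat_def dims Nhat ridge_corr_decomp rc_def)
  qed
  have C: "cc M Q (Nhat X Q lam \<rho> b (resp e)) i k = C i k e" for i k e
  proof -
    have "{j. j < p \<and> b < \<bar>rc j e\<bar>} = {..<p} \<inter> {j. b < \<bar>rc j e\<bar>}" by auto
    then show ?thesis unfolding cc_def Nhat C_def by (simp add: sum.inter_restrict)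
  qed
  have "{e \<in> space ?B. stat_at e \<le> x}
      = {e \<in> space ?B. \<forall>i\<in>{..<p1}. \<bar>Y i e - vec_index (M *\<^sub>v \<beta>) i\<bar>
          / sqrt ((\<Sum>k<r. (C i k e)\<^sup>2 * (wgt lam \<rho> k)\<^sup>2) + 1 / real n) \<le> x}"
    unfolding stat_le_iff[OF p1] tau_gen_def dims C using Y by auto
  also have "\<dots> \<in> sets ?B" by measurable
  finally show ?thesis .
qed

end

lemma abs_sum_mult_le:
  fixes a b :: "'a \<Rightarrow> real"
  assumes "(\<Sum>k\<in>S. (a k)\<^sup>2) \<le> A\<^sup>2" "(\<Sum>k\<in>S. (b k)\<^sup>2) \<le> B\<^sup>2" "0 \<le> A" "0 \<le> B"
  shows "\<bar>\<Sum>k\<in>S. a k * b k\<bar> \<le> A * B"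
proof -
  have "(\<Sum>k\<in>S. a k * b k)\<^sup>2 \<le> (\<Sum>k\<in>S. (a k)\<^sup>2) * (\<Sum>k\<in>S. (b k)\<^sup>2)"
    by (rule Cauchy_Schwarz_ineq_sum)
  also have "\<dots> \<le> A\<^sup>2 * B\<^sup>2"
    using assms by (intro mult_mono) (auto intro: sum_nonneg)
  finally have "\<bar>\<Sum>k\<in>S. a k * b k\<bar>\<^sup>2 \<le> (A * B)\<^sup>2" by (simp add: power_mult_distrib)
  then show ?thesis by (rule power2_le_imp_le) (use assms in simp)
qed

text \<open>Off the exceptional event \<open>B\<close>, the event \<open>A\<close> lies between two
  level events at distance \<open>\<kappa>\<close> from \<open>x\<close>. Exchanging the laws moves
  the level by another \<open>2 * d\<close>, and one use of anti-concentration over the total width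
  returns to \<open>x\<close>, in either direction.\<close>

lemma kolmogorov_sandwich:
  fixes D :: "real measure" and t :: "'i \<Rightarrow> nat \<Rightarrow> real"
  assumes law: "third_moment_law D"
    and mean: "(\<integral>x. x \<partial>D) = 0" and s: "0 < s" and var: "(\<integral>x. x\<^sup>2 \<partial>D) = s\<^sup>2"
    and I: "finite I" and M: "finite M" "M \<noteq> {}"
    and V: "\<And>i l. i \<in> M \<Longrightarrow> l \<in> I \<Longrightarrow> \<bar>t i l\<bar> \<le> V l" "\<And>l. l \<in> I \<Longrightarrow> 0 \<le> V l" and \<beta>: "0 < \<beta>"
    and lo: "0 < lo" and h: "0 < \<kappa> + 2 * d" "\<kappa> + 2 * d \<le> x0"
    and t: "\<And>i. i \<in> M \<Longrightarrow> lo\<^sup>2 \<le> (\<Sum>l\<in>I. (t i l)\<^sup>2)" "\<And>i. i \<in> M \<Longrightarrow> (\<Sum>l\<in>I. (t i l)\<^sup>2) \<le> 1"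
    and A: "A \<in> sets (iid I D)" and B: "B \<in> sets (iid I D)" "measure (iid I D) B \<le> pb"
    and sub: "\<And>e. e \<in> space (iid I D) \<Longrightarrow> e \<notin> B \<Longrightarrow> \<forall>i\<in>M. \<bar>\<Sum>l\<in>I. t i l * e l\<bar> \<le> x - \<kappa> \<Longrightarrow> e \<in> A"
    and sup: "\<And>e. e \<in> A \<Longrightarrow> e \<notin> B \<Longrightarrow> \<forall>i\<in>M. \<bar>\<Sum>l\<in>I. t i l * e l\<bar> \<le> x + \<kappa>"
  shows "\<bar>measure (iid I D) A - measure (gauss_vec I s) (all_below I M t (gauss_vec I s) x)\<bar>
    \<le> pb + (swap_error (third_moment D + third_moment (gauss s)) (\<Sum>l\<in>I. V l ^ 3) (real (card M)) \<beta> d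
      + window_error s lo (real (card M)) (\<kappa> + 2 * d) x0)"
proof -
  let ?P = "iid I D" and ?G = "gauss_vec I s"
  note D = third_moment_lawD[OF law]
  interpret P: prob_space ?P using D by (auto intro!: prob_space_PiM)
  note [measurable_cong] = D(2)
  define U where "U E y = all_below I M t E y" for E y
  have U_meas: "U ?P y \<in> sets ?P" for y
    unfolding U_def using M by measurable
  let ?S = "swap_error (third_moment D + third_moment (gauss s)) (\<Sum>l\<in>I. V l ^ 3) (real (card M)) \<beta> d"
  let ?W = "window_error s lo (real (card M)) (\<kappa> + 2 * d) x0"
  have G: "third_moment_law (gauss s)"
    using prob_space_gauss[OF s] gauss_moments(1-3)[OF s] by (simp add: third_moment_law_def)
  have mv: "(\<integral>x. x \<partial>D) = (\<integral>x. x \<partial>gauss s)" "(\<integral>x. x\<^sup>2 \<partial>D) = (\<integral>x. x\<^sup>2 \<partial>gauss s)"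
    using mean var gauss_moments(4,5)[OF s] by auto
  have ac: "measure ?G (U ?G (y + (\<kappa> + 2 * d))) \<le> measure ?G (U ?G y) + ?W" for y
    unfolding U_def by (rule gauss_abs_max_anticoncentration[OF s I M lo h t])
  have "A \<subseteq> B \<union> U ?P (x + \<kappa>)"
    using sup sets.sets_into_space[OF A] by (auto simp: U_def)
  then have "measure ?P A \<le> measure ?P (B \<union> U ?P (x + \<kappa>))"
    using B U_meas by (intro P.finite_measure_mono) auto
  also have "\<dots> \<le> measure ?P B + measure ?P (U ?P (x + \<kappa>))"
    using B U_meas by (intro measure_Un_le) auto
  also have "measure ?P (U ?P (x + \<kappa>)) \<le> measure ?G (U ?G (x + (\<kappa> + 2 * d))) + ?S"
    using abs_max_comparison[where t=t and V=V and y="x + \<kappa>" and d=d, OF law G mv I M(1) V \<beta>]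
    by (simp only: U_def add.assoc)
  also note ac[of x]
  finally have upper: "measure ?P A \<le> pb + (measure ?G (U ?G x) + ?W + ?S)" using B(2) by simp
  \<comment> \<open>For the lower bound the chain starts at \<open>x - (\<kappa> + 2 * d)\<close>,
    so that the exchange of laws ends exactly at \<open>x - \<kappa>\<close>.\<close>
  have "measure ?G (U ?G x) = measure ?G (U ?G ((x - (\<kappa> + 2 * d)) + (\<kappa> + 2 * d)))" by simp
  also note ac[of "x - (\<kappa> + 2 * d)"]
  also have "measure ?G (U ?G (x - (\<kappa> + 2 * d))) \<le> measure ?P (U ?P ((x - (\<kappa> + 2 * d)) + 2 * d)) + ?S"
    using abs_max_comparison[where t=t and V=V and y="x - (\<kappa> + 2 * d)" and d=d, OF G law mv[symmetric] I M(1) V \<beta>]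
    unfolding U_def add.commute[of "third_moment D"] by linarith
  also have "(x - (\<kappa> + 2 * d)) + 2 * d = x - \<kappa>" by simp
  also have "measure ?P (U ?P (x - \<kappa>)) \<le> measure ?P (B \<union> A)"
    using sub A B by (intro P.finite_measure_mono) (auto simp: U_def)
  also have "\<dots> \<le> measure ?P B + measure ?P A"
    using A B by (intro measure_Un_le) auto
  finally have lower: "measure ?G (U ?G x) \<le> pb + measure ?P A + ?S + ?W" using B(2) by simp
  show ?thesis
    using upper lower unfolding U_def[symmetric] by (simp add: abs_le_iff)
qed

section \<open>Explicit bounds for weights, bias and distance of laws at one sample size\<close>

context ridge_model
begin

lemma wgt_bounds:
  assumes k: "0 < lam k"
  shows "lam k / ((lam k)\<^sup>2 + \<rho>) \<le> wgt lam \<rho> k" "0 < wgt lam \<rho> k" "wgt lam \<rho> k \<le> 1 / lam k"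
proof -
  show 1: "lam k / ((lam k)\<^sup>2 + \<rho>) \<le> wgt lam \<rho> k"
    unfolding wgt_def using k \<rho> by simp
  have "0 < lam k / ((lam k)\<^sup>2 + \<rho>)" using k \<rho> by (intro divide_pos_pos add_nonneg_pos) auto
  then show "0 < wgt lam \<rho> k" using 1 by linarith
  have "wgt lam \<rho> k * lam k \<le> 1" unfolding wgt_mult_lam[OF \<rho>] by (simp add: shrink_def)
  then show "wgt lam \<rho> k \<le> 1 / lam k" using k by (simp add: field_simps)
qed

lemma shrink_nonneg: "0 \<le> shrink lam \<rho> k"
  by (simp add: shrink_def)

lemma shrink_le: "0 < lam k \<Longrightarrow> shrink lam \<rho> k \<le> \<rho>\<^sup>2 / (lam k) ^ 4"
proof -
  assume k: "0 < lam k"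
  have "shrink lam \<rho> k \<le> (\<rho> / (lam k)\<^sup>2)\<^sup>2"
    unfolding shrink_def using k \<rho> by (intro power_mono divide_left_mono) (auto intro!: add_nonneg_pos mult_pos_pos)
  then show ?thesis by (simp add: power_divide power_mult[symmetric])
qed

text \<open>One power of the singular value is traded for \<open>wgt\<close>, so that the shrinkage
  bias of a row can be measured against its own \<open>\<tau>\<close> rather than against the lower
  bound 1 / sqrt n.\<close>

lemma shrink_le_wgt:
  assumes k: "0 < lam k"
  shows "shrink lam \<rho> k \<le> \<rho>\<^sup>2 / (lam k) ^ 3 * wgt lam \<rho> k"
proof -
  let ?a = "(lam k)\<^sup>2 + \<rho>"
  have a: "0 < ?a" using \<rho> by (simp add: add_nonneg_pos)
  have "shrink lam \<rho> k = \<rho>\<^sup>2 / ?a * (1 / ?a)"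
    by (simp add: shrink_def power_divide power2_eq_square)
  also have "\<dots> \<le> \<rho>\<^sup>2 / (lam k)\<^sup>2 * (1 / ?a)"
    using k \<rho> a by (intro mult_right_mono divide_left_mono) auto
  also have "\<dots> = \<rho>\<^sup>2 / (lam k) ^ 3 * (lam k / ?a)"
    using k by (simp add: power2_eq_square power3_eq_cube)
  also have "\<dots> \<le> \<rho>\<^sup>2 / (lam k) ^ 3 * wgt lam \<rho> k"
    using wgt_bounds(1)[of k] k by (intro mult_left_mono) auto
  finally show ?thesis .
qed

lemma bias_bound:
  assumes g: "\<And>k. k < r \<Longrightarrow> shrink lam \<rho> k \<le> g" "0 \<le> g"
    and Z: "(\<Sum>k<r. (zeta Q \<beta> k)\<^sup>2) \<le> Z\<^sup>2" "0 \<le> Z" and j: "j < p"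
  shows "\<bar>bias j\<bar> \<le> g * Z"
proof -
  have "(\<Sum>k<r. (shrink lam \<rho> k * zeta Q \<beta> k)\<^sup>2) \<le> (\<Sum>k<r. g\<^sup>2 * (zeta Q \<beta> k)\<^sup>2)"
    using g shrink_nonneg by (intro sum_mono) (auto simp: power_mult_distrib intro!: mult_right_mono power_mono)
  also have "\<dots> \<le> g\<^sup>2 * Z\<^sup>2" using Z by (simp add: sum_distrib_left[symmetric] mult_left_mono)
  finally have "(\<Sum>k<r. (shrink lam \<rho> k * zeta Q \<beta> k)\<^sup>2) \<le> (g * Z)\<^sup>2" by (simp add: power_mult_distrib)
  then have "\<bar>bias j\<bar> \<le> 1 * (g * Z)"
    using row_norm_le[OF Q Qp j perp] g Z by (intro abs_sum_mult_le) auto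
  then show ?thesis by simp
qed

text \<open>By Cauchy-Schwarz the shrinkage part is at most \<open>G * Z * \<tau> i\<close>, so it
  scales with the row. The other two parts are divided by \<open>\<tau> i \<ge> 1 / sqrt n\<close>,
  hence the factor sqrt n and the need for o(1 / sqrt (n log n)).\<close>

lemma rem_bound:
  assumes G: "\<And>k. k < r \<Longrightarrow> shrink lam \<rho> k \<le> G * wgt lam \<rho> k" "0 \<le> G"
    and Z: "(\<Sum>k<r. (zeta Q \<beta> k)\<^sup>2) \<le> Z\<^sup>2" "0 \<le> Z"
    and a: "\<bar>\<Sum>j\<in>{..<p} - N. M $$ (i, j) * \<theta> j\<bar> \<le> a1" "\<bar>\<Sum>j<p. M $$ (i, j) * vec_index (theta_of Qp \<beta>) j\<bar> \<le> a2"
  shows "\<bar>rem i\<bar> / \<tau> i \<le> G * Z + sqrt (real n) * (a1 + a2)"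
proof -
  have pos: "0 < \<tau> i" by (rule tau_gen_pos[OF n])
  have "(\<Sum>k<r. (cc M Q N i k * shrink lam \<rho> k)\<^sup>2) \<le> (\<Sum>k<r. G\<^sup>2 * (cc M Q N i k * wgt lam \<rho> k)\<^sup>2)"
  proof (rule sum_mono)
    fix k assume "k \<in> {..<r}"
    then have "(shrink lam \<rho> k)\<^sup>2 \<le> (G * wgt lam \<rho> k)\<^sup>2"
      using G(1) shrink_nonneg by (intro power_mono) auto
    then have "(cc M Q N i k)\<^sup>2 * (shrink lam \<rho> k)\<^sup>2 \<le> (cc M Q N i k)\<^sup>2 * (G * wgt lam \<rho> k)\<^sup>2"
      by (rule mult_left_mono) simp
    then show "(cc M Q N i k * shrink lam \<rho> k)\<^sup>2 \<le> G\<^sup>2 * (cc M Q N i k * wgt lam \<rho> k)\<^sup>2"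
      by (simp add: power_mult_distrib ac_simps)
  qed
  also have "\<dots> \<le> G\<^sup>2 * (\<tau> i)\<^sup>2"
    unfolding sum_distrib_left[symmetric]
    using tau_gen_pos(3)[OF n, where M=M and Q=Q and lam=lam and \<rho>=\<rho> and N=N and i=i] by (intro mult_left_mono) (auto simp: dims)
  finally have "(\<Sum>k<r. (cc M Q N i k * shrink lam \<rho> k)\<^sup>2) \<le> (G * \<tau> i)\<^sup>2" by (simp add: power_mult_distrib)
  then have "\<bar>\<Sum>k<r. (cc M Q N i k * shrink lam \<rho> k) * zeta Q \<beta> k\<bar> \<le> (G * \<tau> i) * Z"
    using G Z pos by (intro abs_sum_mult_le) auto
  then have 1: "\<bar>\<Sum>k<r. cc M Q N i k * (shrink lam \<rho> k * zeta Q \<beta> k)\<bar> \<le> G * Z * \<tau> i"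
    by (simp add: ac_simps)
  have a0: "0 \<le> a1 + a2" using a by linarith
  have "1 \<le> sqrt (real n) * \<tau> i"
    using tau_gen_pos(2)[OF n, where M=M and Q=Q and lam=lam and \<rho>=\<rho> and N=N and i=i] n by (simp add: field_simps)
  then have "(a1 + a2) * 1 \<le> (a1 + a2) * (sqrt (real n) * \<tau> i)" using a0 by (rule mult_left_mono)
  moreover have "\<bar>rem i\<bar> \<le> G * Z * \<tau> i + (a1 + a2)"
    unfolding rem_def using 1 a by linarith
  ultimately have "\<bar>rem i\<bar> \<le> (G * Z + sqrt (real n) * (a1 + a2)) * \<tau> i"
    by (simp add: algebra_simps)
  then show ?thesis using pos by (simp add: divide_le_eq)
qed

lemma t_sq_le_1: "(\<Sum>l<n. (t i l)\<^sup>2) \<le> 1"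
  unfolding t_coef_sq
  using tau_gen_pos(1,3)[OF n, where M=M and Q=Q and lam=lam and \<rho>=\<rho> and N=N and i=i] by (simp add: dims)

text \<open>The non-asymptotic form of the result. The right-hand side does not contain
  \<open>x\<close>, which yields uniformity; \<open>c\<close> and \<open>u\<close> tune the noise
  tail, while \<open>\<beta>'\<close>, \<open>d\<close> and \<open>x0\<close> tune the comparison of
  maxima.\<close>

lemma prob_stat_close:
  assumes D: "prob_space D" "sets D = sets borel" "integrable D (\<lambda>x. x)" "(\<integral>x. x \<partial>D) = 0"
    and m: "integrable D (\<lambda>x. \<bar>x\<bar> powr m)" "3 \<le> m" and s: "0 < s" "(\<integral>x. x\<^sup>2 \<partial>D) = s\<^sup>2"
    and lam: "\<And>k. k < r \<Longrightarrow> 0 < lam k"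
    and ne: "\<M> \<noteq> {}"
    and cb: "0 < cb" "cb < 1" and b: "0 < b"
    and gap: "\<And>i. i < p \<Longrightarrow> i \<notin> N \<Longrightarrow> \<bar>\<theta> i\<bar> \<le> cb * b" "\<And>i. i < p \<Longrightarrow> i \<in> N \<Longrightarrow> b / cb \<le> \<bar>\<theta> i\<bar>"
    and Z: "(\<Sum>k<r. (zeta Q \<beta> k)\<^sup>2) \<le> Z\<^sup>2" "0 \<le> Z"
    and g: "\<And>k. k < r \<Longrightarrow> shrink lam \<rho> k \<le> g" "0 \<le> g" "g * Z \<le> (1 - cb) * b / 2"
    and G: "\<And>k. k < r \<Longrightarrow> shrink lam \<rho> k \<le> G * wgt lam \<rho> k" "0 \<le> G"
    and a: "\<And>i. i < p1 \<Longrightarrow> \<bar>\<Sum>j\<in>{..<p} - N. M $$ (i, j) * \<theta> j\<bar> \<le> a1"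
      "\<And>i. i < p1 \<Longrightarrow> \<bar>\<Sum>j<p. M $$ (i, j) * vec_index (theta_of Qp \<beta>) j\<bar> \<le> a2"
    and \<kappa>: "G * Z + sqrt (real n) * (a1 + a2) \<le> \<kappa>"
    and W: "\<And>k. k < r \<Longrightarrow> wgt lam \<rho> k \<le> W" "0 < W"
    and c: "0 < c" and u: "0 < u"
    and V: "\<And>i l. i \<in> \<M> \<Longrightarrow> l < n \<Longrightarrow> \<bar>t i l\<bar> \<le> V l" "\<And>l. l < n \<Longrightarrow> 0 \<le> V l"
    and \<beta>': "0 < \<beta>'" and lo: "0 < lo" and h: "0 < \<kappa> + 2 * d" "\<kappa> + 2 * d \<le> x0"
    and tlo: "\<And>i. i \<in> \<M> \<Longrightarrow> lo\<^sup>2 \<le> (\<Sum>l<n. (t i l)\<^sup>2)"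
  shows "\<bar>prob_stat X \<beta> M Q lam \<rho> b D x - H_fun n M Q lam \<beta> \<rho> b s x\<bar>
    \<le> real p * ((\<integral>x. \<bar>x\<bar> powr m \<partial>D) * c powr (- m / 2) + 2 * exp (- u * ((1 - cb) * b / 2) + u\<^sup>2 * W\<^sup>2 * (2 * c + s\<^sup>2)))
      + (swap_error (third_moment D + third_moment (gauss s)) (\<Sum>l<n. V l ^ 3) (real (card \<M>)) \<beta>' d
        + window_error s lo (real (card \<M>)) (\<kappa> + 2 * d) x0)"
proof -
  let ?P = "iid {..<n} D"
  interpret P: prob_space ?P using D by (auto intro!: prob_space_PiM)
  note [measurable_cong] = D(2)
  have sets_P: "sets ?P = sets (PiM {..<n} (\<lambda>_. borel))" by (intro sets_PiM_cong) (auto simp: D)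
  have space_P: "space ?P = space (PiM {..<n} (\<lambda>_. borel))" using sets_P by (rule sets_eq_imp_space_eq)
  define pt where "pt = (\<integral>x. \<bar>x\<bar> powr m \<partial>D) * c powr (- m / 2) + 2 * exp (- u * ((1 - cb) * b / 2) + u\<^sup>2 * W\<^sup>2 * (2 * c + s\<^sup>2))"
  define Bj where "Bj j = {e \<in> space ?P. (1 - cb) * b / 2 < \<bar>noise j e\<bar>}" for j
  have Bj_meas: "Bj j \<in> sets ?P" for j unfolding Bj_def by measurable
  have Bj_le: "measure ?P (Bj j) \<le> pt" if j: "j < p" for j
  proof -
    have "(\<Sum>l<n. (noise_coef P Q lam \<rho> j l)\<^sup>2) = (\<Sum>k<r. (Q $$ (j, k) * wgt lam \<rho> k)\<^sup>2)"
      by (rule noise_coef_sq)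
    also have "\<dots> \<le> (\<Sum>k<r. W\<^sup>2 * (Q $$ (j, k))\<^sup>2)"
    proof (rule sum_mono)
      fix k assume "k \<in> {..<r}"
      then have "(wgt lam \<rho> k)\<^sup>2 \<le> W\<^sup>2"
        using W(1) wgt_bounds(2)[OF lam, of k] by (intro power_mono) auto
      then have "(Q $$ (j, k))\<^sup>2 * (wgt lam \<rho> k)\<^sup>2 \<le> (Q $$ (j, k))\<^sup>2 * W\<^sup>2"
        by (rule mult_left_mono) simp
      then show "(Q $$ (j, k) * wgt lam \<rho> k)\<^sup>2 \<le> W\<^sup>2 * (Q $$ (j, k))\<^sup>2"
        by (simp add: power_mult_distrib ac_simps)
    qed
    also have "\<dots> \<le> W\<^sup>2 * 1"
      unfolding sum_distrib_left[symmetric] using row_norm_le[OF Q Qp j perp] by (intro mult_left_mono) auto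
    finally have "(\<Sum>l<n. (noise_coef P Q lam \<rho> j l)\<^sup>2) \<le> W\<^sup>2" by simp
    then show ?thesis
      unfolding Bj_def pt_def s(2)[symmetric] using m W(2) c u by (intro error_tail[OF D]) auto
  qed
  \<comment> \<open>Outside this event all \<open>p\<close> noise terms fit their half of the
    threshold margin; the union bound over coordinates produces the factor \<open>p\<close>.\<close>
  define B where "B = (\<Union>j<p. Bj j)"
  have B_meas: "B \<in> sets ?P" unfolding B_def using Bj_meas by (intro sets.finite_UN) auto
  have "measure ?P B \<le> (\<Sum>j<p. measure ?P (Bj j))"
    unfolding B_def using Bj_meas by (intro P.finite_measure_subadditive_finite) auto
  also have "\<dots> \<le> (\<Sum>j<p. pt)" using Bj_le by (intro sum_mono) auto
  finally have B_le: "measure ?P B \<le> real p * pt" by simp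
  obtain i0 where i0: "i0 \<in> \<M>" using ne by auto
  have p1: "0 < p1" using i0 by (simp add: Mset_def dims)
  have Nhat: "Nhat X Q lam \<rho> b (resp e) = N" if "e \<in> space ?P" "e \<notin> B" for e
  proof (rule Nhat_eq_Nb[OF cb b gap])
    show "\<bar>bias j\<bar> \<le> (1 - cb) * b / 2" if "j < p" for j
      using bias_bound[OF g(1,2) Z that] g(3) by linarith
    show "\<bar>noise j e\<bar> \<le> (1 - cb) * b / 2" if "j < p" for j
      using \<open>e \<in> space ?P\<close> \<open>e \<notin> B\<close> that by (auto simp: B_def Bj_def not_less)
  qed
  have rem: "\<bar>rem i\<bar> / \<tau> i \<le> \<kappa>" if "i < p1" for i
    using rem_bound[OF G Z a[OF that]] \<kappa> by linarith
  define A where "A = {e \<in> space ?P. stat_at e \<le> x}"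
  have A_meas: "A \<in> sets ?P"
    unfolding A_def sets_P space_P by (rule stat_measurable[OF p1])
  have law: "third_moment_law D"
    using D integrable_lower_moment[OF D(1,2) m(1), of 3] integrable_lower_moment[OF D(1,2) m(1), of 2] m(2)
    by (auto simp: third_moment_law_def)
  have "\<bar>measure ?P A - measure (gauss_vec {..<n} s) (all_below {..<n} \<M> t (gauss_vec {..<n} s) x)\<bar>
    \<le> real p * pt + (swap_error (third_moment D + third_moment (gauss s)) (\<Sum>l<n. V l ^ 3) (real (card \<M>)) \<beta>' d
        + window_error s lo (real (card \<M>)) (\<kappa> + 2 * d) x0)"
  proof (rule kolmogorov_sandwich[OF law D(4) s _ finite_Mset ne _ _ \<beta>' lo h _ _ A_meas B_meas B_le])
    show "e \<in> A" if "e \<in> space ?P" "e \<notin> B" "\<forall>i\<in>\<M>. \<bar>\<Sum>l<n. t i l * e l\<bar> \<le> x - \<kappa>" for e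
      using stat_sandwich(1)[OF Nhat[OF that(1,2)] ne rem that(3)] that(1) by (simp add: A_def)
    show "\<forall>i\<in>\<M>. \<bar>\<Sum>l<n. t i l * e l\<bar> \<le> x + \<kappa>" if "e \<in> A" "e \<notin> B" for e
      using that by (intro stat_sandwich(2)[OF Nhat ne rem]) (auto simp: A_def)
  qed (use V tlo t_sq_le_1 in auto)
  moreover have "prob_stat X \<beta> M Q lam \<rho> b D x = measure ?P A"
    unfolding prob_stat_def err_space_def A_def dims ..
  ultimately show ?thesis
    unfolding H_fun_eq[OF ne s(1)] pt_def by simp
qed

end

section \<open>Rates\<close>

lemma tail_terms_tendsto:
  fixes a g e K E :: real
  assumes "a < g" "0 < e"
  shows "(\<lambda>n. real n powr a * (K * real n powr (- g) + E * exp (- (real n powr e)))) \<longlonglongrightarrow> 0"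
  using assms by real_asymp

lemma powr_less_eventually:
  fixes a b C D :: real
  assumes "a < b" "0 < D"
  shows "\<forall>\<^sub>F n in sequentially. C * real n powr a \<le> D * real n powr b"
  using assms by real_asymp

lemma powr_mult_sqrt_ln_tendsto:
  fixes a C :: real
  assumes "a < 0"
  shows "(\<lambda>n. C * real n powr a * sqrt (ln (real n))) \<longlonglongrightarrow> 0"
  using assms by real_asymp

lemma sqrt_ln_at_top: "0 < C \<Longrightarrow> filterlim (\<lambda>n. C * sqrt (ln (real n))) at_top sequentially"
  by real_asymp

text \<open>Write \<open>D\<close> for \<open>d\<close> times sqrt (log n) and \<open>x\<close> for
  \<open>B\<close> times (log n)^(9/2). With \<open>\<beta> * d = c * L\<close> the Lindeberg term
  is a multiple of x / D^3, while the window term needs \<open>D\<close> to vanish. \<open>D\<close>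
  at least the fourth root of \<open>x\<close> reconciles the two, since x / D^3 is then at most
  that root.\<close>

lemma window_choice:
  fixes B mc \<kappa> :: "nat \<Rightarrow> real" and a C m3 s lo :: real
  assumes B: "\<And>n. 0 \<le> B n" "(\<lambda>n. B n * ln (real n) powr (9/2)) \<longlonglongrightarrow> 0"
    and mc: "\<And>n. 0 \<le> mc n" "\<forall>\<^sub>F n in sequentially. mc n \<le> C * real n powr a" and \<kappa>: "\<And>n. 0 \<le> \<kappa> n" "(\<lambda>n. \<kappa> n * sqrt (ln (real n))) \<longlonglongrightarrow> 0"
    and s: "0 < s" and lo: "0 < lo"
  obtains \<beta> d x0 :: "nat \<Rightarrow> real"
  where "\<forall>\<^sub>F n in sequentially. 0 < \<beta> n \<and> 0 < \<kappa> n + 2 * d n \<and> \<kappa> n + 2 * d n \<le> x0 n"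
    "(\<lambda>n. swap_error m3 (B n) (mc n) (\<beta> n) (d n) + window_error s lo (mc n) (\<kappa> n + 2 * d n) (x0 n)) \<longlonglongrightarrow> 0"
proof -
  \<comment> \<open>Any exponent above \<open>a\<close> and 0 would do: \<open>mc n\<close> times
    n^(-c) must vanish.\<close>
  define c where "c = \<bar>a\<bar> + 1"
  have c: "0 < c" "a - c < 0" by (auto simp: c_def)
  define L where "L n = ln (real n)" for n
  define x where "x n = B n * L n powr (9/2)" for n
  \<comment> \<open>The summand \<open>1 / L n\<close> keeps the width positive even when
    \<open>x n\<close> is 0.\<close>
  define D where "D n = sqrt (sqrt (x n)) + 1 / L n" for n
  define d where "d n = D n / sqrt (L n)" for n
  define \<beta> where "\<beta> n = c * L n / d n" for n
  \<comment> \<open>Solves \<open>(x0 n)\<^sup>2 / (2 * s\<^sup>2) = c * L n\<close>, so the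
    Gaussian tail per signed row is n^(-c), as is the proxy error
    \<open>exp (- \<beta> n * d n)\<close>.\<close>
  define x0 where "x0 n = s * sqrt (2 * c) * sqrt (L n)" for n
  define h where "h n = \<kappa> n + 2 * d n" for n
  have Lpos: "\<forall>\<^sub>F n in sequentially. 0 < L n"
    unfolding L_def by real_asymp
  have x0_nn: "0 \<le> x n" for n unfolding x_def using B(1) by simp
  have x_lim: "x \<longlonglongrightarrow> 0" using B(2) unfolding x_def[abs_def] L_def .
  have xr_lim: "(\<lambda>n. sqrt (sqrt (x n))) \<longlonglongrightarrow> 0"
    using tendsto_real_sqrt[OF tendsto_real_sqrt[OF x_lim]] by simp
  have "(\<lambda>n. 1 / L n) \<longlonglongrightarrow> 0" unfolding L_def by real_asymp
  then have D_lim: "D \<longlonglongrightarrow> 0" unfolding D_def[abs_def] using tendsto_add[OF xr_lim] by simp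
  have Dpos: "\<forall>\<^sub>F n in sequentially. 0 < D n"
    using Lpos by eventually_elim (auto simp: D_def x0_nn intro!: add_nonneg_pos)
  have dpos: "\<forall>\<^sub>F n in sequentially. 0 < d n"
    using Lpos Dpos by eventually_elim (simp add: d_def)
  have \<beta>pos: "\<forall>\<^sub>F n in sequentially. 0 < \<beta> n"
    using Lpos dpos by eventually_elim (use c in \<open>simp add: \<beta>_def\<close>)
  have \<beta>d: "\<forall>\<^sub>F n in sequentially. \<beta> n * d n = c * L n"
    using dpos by eventually_elim (simp add: \<beta>_def)
  have hL_lim: "(\<lambda>n. h n * sqrt (L n)) \<longlonglongrightarrow> 0"
  proof (rule Lim_transform_eventually)
    have "(\<lambda>n. \<kappa> n * sqrt (L n) + 2 * D n) \<longlonglongrightarrow> 0 + 2 * 0"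
      using \<kappa>(2) D_lim unfolding L_def by (intro tendsto_intros)
    then show "(\<lambda>n. \<kappa> n * sqrt (L n) + 2 * D n) \<longlonglongrightarrow> 0" by simp
    show "\<forall>\<^sub>F n in sequentially. \<kappa> n * sqrt (L n) + 2 * D n = h n * sqrt (L n)"
      using Lpos by eventually_elim (simp add: h_def d_def algebra_simps)
  qed
  have h_lim: "h \<longlonglongrightarrow> 0"
  proof (rule Lim_transform_eventually)
    have "(\<lambda>n. 1 / sqrt (L n)) \<longlonglongrightarrow> 0" unfolding L_def by real_asymp
    from tendsto_mult[OF hL_lim this] show "(\<lambda>n. h n * sqrt (L n) * (1 / sqrt (L n))) \<longlonglongrightarrow> 0" by simp
    show "\<forall>\<^sub>F n in sequentially. h n * sqrt (L n) * (1 / sqrt (L n)) = h n"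
      using Lpos by eventually_elim simp
  qed
  have x0_top: "filterlim x0 at_top sequentially"
    unfolding x0_def[abs_def] L_def using sqrt_ln_at_top[of "s * sqrt (2 * c)"] s c by simp
  have "\<forall>\<^sub>F n in sequentially. h n \<le> 1" using order_tendstoD(2)[OF h_lim, of 1] by (simp add: eventually_mono)
  moreover have "\<forall>\<^sub>F n in sequentially. 1 \<le> x0 n" using x0_top by (simp add: filterlim_at_top)
  ultimately have hx0: "\<forall>\<^sub>F n in sequentially. h n \<le> x0 n" by eventually_elim simp
  have hpos: "\<forall>\<^sub>F n in sequentially. 0 < h n"
    using dpos by eventually_elim (use \<kappa>(1) in \<open>auto simp: h_def intro!: add_nonneg_pos\<close>)
  have t1: "(\<lambda>n. 6 * \<beta> n ^ 3 * B n * m3) \<longlonglongrightarrow> 0"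
  proof (rule Lim_null_comparison)
    show "\<forall>\<^sub>F n in sequentially. norm (6 * \<beta> n ^ 3 * B n * m3) \<le> 6 * c ^ 3 * sqrt (sqrt (x n)) * \<bar>m3\<bar>"
      using Lpos Dpos \<beta>pos
    proof eventually_elim
      case (elim n)
      have "\<beta> n ^ 3 * B n = c ^ 3 * (x n / D n ^ 3)"
      proof -
        have "\<beta> n = c * (L n * sqrt (L n)) / D n" using elim by (simp add: \<beta>_def d_def)
        then have "\<beta> n ^ 3 = c ^ 3 * (L n * sqrt (L n)) ^ 3 / D n ^ 3" by (simp add: power_divide power_mult_distrib)
        also have "(L n * sqrt (L n)) ^ 3 = L n powr (9/2)"
        proof -
          have "L n * sqrt (L n) = L n powr (3/2)"
            using elim powr_add[of "L n" 1 "1/2"] by (simp add: powr_half_sqrt)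
          then show ?thesis using elim by (simp add: powr_power)
        qed
        finally show ?thesis by (simp add: x_def)
      qed
      also have "\<dots> \<le> c ^ 3 * sqrt (sqrt (x n))"
      proof (rule mult_left_mono)
        show "0 \<le> c ^ 3" using c by simp
        define r where "r = sqrt (sqrt (x n))"
        have "r\<^sup>2 = sqrt (x n)" using x0_nn[of n] by (simp add: r_def)
        then have "(r\<^sup>2)\<^sup>2 = x n" using x0_nn[of n] by simp
        then have r: "x n = r ^ 4" by (simp flip: power_mult)
        have r0: "0 \<le> r" by (simp add: r_def x0_nn)
        have "r \<le> D n" using elim by (simp add: r_def D_def)
        then have "r ^ 3 \<le> D n ^ 3" using r0 by (intro power_mono)
        then have "r * r ^ 3 \<le> r * D n ^ 3" using r0 by (intro mult_left_mono)
        then show "x n / D n ^ 3 \<le> sqrt (sqrt (x n))" using elim r unfolding r_def[symmetric]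
          by (simp add: divide_le_eq power4_eq_xxxx power3_eq_cube mult.assoc)
      qed
      finally have le: "\<beta> n ^ 3 * B n \<le> c ^ 3 * sqrt (sqrt (x n))" .
      have "0 \<le> \<beta> n ^ 3 * B n" using elim B(1) by simp
      have "6 * (\<beta> n ^ 3 * B n) * \<bar>m3\<bar> \<le> 6 * (c ^ 3 * sqrt (sqrt (x n))) * \<bar>m3\<bar>"
        using le by (intro mult_right_mono mult_left_mono) auto
      moreover have "norm (6 * \<beta> n ^ 3 * B n * m3) = 6 * \<bar>\<beta> n ^ 3 * B n\<bar> * \<bar>m3\<bar>"
        by (simp add: abs_mult mult.assoc)
      ultimately show ?case using abs_of_nonneg[OF \<open>0 \<le> \<beta> n ^ 3 * B n\<close>] by (simp only: mult.assoc)
    qed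
    show "(\<lambda>n. 6 * c ^ 3 * sqrt (sqrt (x n)) * \<bar>m3\<bar>) \<longlonglongrightarrow> 0"
      using xr_lim x_lim by (auto intro!: tendsto_eq_intros)
  qed
  have expL: "\<forall>\<^sub>F n in sequentially. exp (- (c * L n)) = real n powr (- c)"
    using eventually_gt_at_top[of 0] by eventually_elim (simp add: L_def powr_def)
  have mc_lim: "(\<lambda>n. mc n * real n powr (- c)) \<longlonglongrightarrow> 0"
  proof (rule Lim_null_comparison)
    show "\<forall>\<^sub>F n in sequentially. norm (mc n * real n powr (- c)) \<le> C * real n powr (a - c)"
      using mc(2)
    proof eventually_elim
      case (elim n)
      have "mc n * real n powr (- c) \<le> C * real n powr a * real n powr (- c)"
        using elim by (intro mult_right_mono) auto
      then show ?case using mc(1)[of n] by (simp add: mult.assoc powr_add[symmetric])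
    qed
    show "(\<lambda>n. C * real n powr (a - c)) \<longlonglongrightarrow> 0" using c(2) by real_asymp
  qed
  have t2: "(\<lambda>n. 2 * mc n * exp (- \<beta> n * d n)) \<longlonglongrightarrow> 0"
  proof (rule Lim_transform_eventually)
    show "(\<lambda>n. 2 * (mc n * real n powr (- c))) \<longlonglongrightarrow> 0" using mc_lim by (auto intro!: tendsto_eq_intros)
    show "\<forall>\<^sub>F n in sequentially. 2 * (mc n * real n powr (- c)) = 2 * mc n * exp (- \<beta> n * d n)"
      using \<beta>d expL by eventually_elim simp
  qed
  have t3: "(\<lambda>n. exp (- exp (\<beta> n * d n))) \<longlonglongrightarrow> 0"
  proof (rule Lim_transform_eventually)
    show "(\<lambda>n. exp (- exp (c * ln (real n)))) \<longlonglongrightarrow> 0" using c(1) by real_asymp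
    show "\<forall>\<^sub>F n in sequentially. exp (- exp (c * ln (real n))) = exp (- exp (\<beta> n * d n))"
      using \<beta>d by eventually_elim (simp add: L_def)
  qed
  have t4: "(\<lambda>n. exp (3/2) * (h n / lo) * (2 * x0 n / lo + h n / lo + s) / s\<^sup>2) \<longlonglongrightarrow> 0"
  proof -
    define y where "y n = h n * sqrt (L n)" for n
    have "y \<longlonglongrightarrow> 0" using hL_lim by (simp add: y_def[abs_def])
    then have "(\<lambda>n. exp (3/2) / lo * (2 * (s * sqrt (2 * c)) / lo * y n + h n * h n / lo + h n * s) / s\<^sup>2)
        \<longlonglongrightarrow> exp (3/2) / lo * (2 * (s * sqrt (2 * c)) / lo * 0 + 0 * 0 / lo + 0 * s) / s\<^sup>2"
      using h_lim s lo by (intro tendsto_intros) auto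
    then have "(\<lambda>n. exp (3/2) / lo * (2 * (s * sqrt (2 * c)) / lo * (h n * sqrt (L n)) + h n * h n / lo + h n * s) / s\<^sup>2) \<longlonglongrightarrow> 0"
      by (simp add: y_def)
    then show ?thesis
      by (rule Lim_transform_eventually) (simp add: x0_def field_simps)
  qed
  have t5: "(\<lambda>n. 2 * mc n * exp (- (x0 n)\<^sup>2 / (2 * s\<^sup>2))) \<longlonglongrightarrow> 0"
  proof (rule Lim_transform_eventually)
    show "(\<lambda>n. 2 * (mc n * real n powr (- c))) \<longlonglongrightarrow> 0" using mc_lim by (auto intro!: tendsto_eq_intros)
    show "\<forall>\<^sub>F n in sequentially. 2 * (mc n * real n powr (- c)) = 2 * mc n * exp (- (x0 n)\<^sup>2 / (2 * s\<^sup>2))"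
      using expL Lpos
    proof eventually_elim
      case (elim n)
      have "(x0 n)\<^sup>2 / (2 * s\<^sup>2) = c * L n"
        using elim s c by (simp add: x0_def power_mult_distrib)
      then show ?case using elim by simp
    qed
  qed
  show ?thesis
  proof (rule that[of \<beta> d x0])
    show "\<forall>\<^sub>F n in sequentially. 0 < \<beta> n \<and> 0 < \<kappa> n + 2 * d n \<and> \<kappa> n + 2 * d n \<le> x0 n"
      using \<beta>pos hpos hx0 by eventually_elim (simp add: h_def)
    show "(\<lambda>n. swap_error m3 (B n) (mc n) (\<beta> n) (d n) + window_error s lo (mc n) (\<kappa> n + 2 * d n) (x0 n)) \<longlonglongrightarrow> 0"
      unfolding swap_error_def window_error_def h_def[symmetric]
      using tendsto_add[OF tendsto_add[OF tendsto_add[OF t1 t2] t3] tendsto_add[OF t4 t5]] by simp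
  qed
qed

text \<open>The cube of n^(-1/3) (log n)^(-3/2) is n^(-1) (log n)^(-9/2), which absorbs the
  \<open>n\<close> summands and the logarithm together.\<close>

lemma cubic_sum_tendsto_1:
  fixes tm B :: "nat \<Rightarrow> real" and a :: real
  assumes tm: "tm \<in> o(\<lambda>n. min (real n powr a * ln (real n) powr (- 3/2)) (real n powr (- 1/3) * ln (real n) powr (- 3/2)))"
    and B: "\<And>n. 0 \<le> B n" "\<forall>\<^sub>F n in sequentially. B n \<le> real n * tm n ^ 3"
  shows "(\<lambda>n. B n * ln (real n) powr (9/2)) \<longlonglongrightarrow> 0"
proof -
  let ?g = "\<lambda>n. real n powr (- 1/3) * ln (real n) powr (- 3/2)"
  have "(\<lambda>n. min (real n powr a * ln (real n) powr (- 3/2)) (?g n)) \<in> O(?g)"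
    by (intro bigoI[of _ 1] always_eventually) (auto simp: min_def)
  then have "tm \<in> o(?g)" by (rule landau_o.small_big_trans[OF tm])
  then have lim: "(\<lambda>n. tm n / ?g n) \<longlonglongrightarrow> 0" by (rule smalloD_tendsto)
  have pos: "\<forall>\<^sub>F n in sequentially. 0 < ln (real n)" by real_asymp
  show ?thesis
  proof (rule Lim_null_comparison)
    show "(\<lambda>n. (tm n / ?g n) ^ 3) \<longlonglongrightarrow> 0" using lim by (auto intro!: tendsto_eq_intros)
    show "\<forall>\<^sub>F n in sequentially. norm (B n * ln (real n) powr (9/2)) \<le> (tm n / ?g n) ^ 3"
      using B(2) pos eventually_gt_at_top[of 0]
    proof eventually_elim
      case (elim n)
      have "?g n ^ 3 = real n powr (- 1) * ln (real n) powr (- (9/2))"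
        using elim by (simp add: power_mult_distrib powr_power)
      then have "(tm n / ?g n) ^ 3 = real n * tm n ^ 3 * ln (real n) powr (9/2)"
        using elim by (simp add: power_divide powr_minus divide_simps)
      then show ?case using elim B(1)[of n] by (simp add: mult_right_mono)
    qed
  qed
qed

text \<open>In the product of the two rates the powers of \<open>n\<close> cancel and the logarithms
  add up to exponent -3 - 3/2 = -9/2.\<close>

lemma cubic_sum_tendsto_2:
  fixes tm mc B :: "nat \<Rightarrow> real" and a :: real
  assumes mc: "mc \<in> o(\<lambda>n. real n powr a * ln (real n) powr (- 3))"
    and tm: "tm \<in> O(\<lambda>n. real n powr (- a) * ln (real n) powr (- 3/2))"
    and B: "\<And>n. 0 \<le> B n" "\<forall>\<^sub>F n in sequentially. B n \<le> tm n * mc n"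
  shows "(\<lambda>n. B n * ln (real n) powr (9/2)) \<longlonglongrightarrow> 0"
proof -
  let ?g = "\<lambda>n. (real n powr a * ln (real n) powr (- 3)) * (real n powr (- a) * ln (real n) powr (- 3/2))"
  have "(\<lambda>n. mc n * tm n) \<in> o(?g)" by (rule landau_o.small_big_mult[OF mc tm])
  then have lim: "(\<lambda>n. mc n * tm n / ?g n) \<longlonglongrightarrow> 0" by (rule smalloD_tendsto)
  have pos: "\<forall>\<^sub>F n in sequentially. 0 < ln (real n)" by real_asymp
  show ?thesis
  proof (rule Lim_null_comparison[OF _ lim])
    show "\<forall>\<^sub>F n in sequentially. norm (B n * ln (real n) powr (9/2)) \<le> mc n * tm n / ?g n"
      using B(2) pos eventually_gt_at_top[of 0]
    proof eventually_elim
      case (elim n)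
      have "?g n = (real n powr a * real n powr (- a)) * (ln (real n) powr (- 3) * ln (real n) powr (- 3/2))" by simp
      also have "\<dots> = ln (real n) powr (- (9/2))"
        using elim by (simp add: powr_add[symmetric])
      finally have "mc n * tm n / ?g n = tm n * mc n * ln (real n) powr (9/2)"
        using elim by (simp add: powr_minus divide_simps)
      then show ?case using elim B(1)[of n] by (simp add: mult_right_mono)
    qed
  qed
qed

section \<open>Envelope of the coefficients, its cubic sum, and lower bounds for row norms\<close>

definition coef_max :: "nat \<Rightarrow> real Matrix.mat \<Rightarrow> real Matrix.mat \<Rightarrow> real Matrix.mat \<Rightarrow> (nat \<Rightarrow> real) \<Rightarrow> real Matrix.vec \<Rightarrow> real \<Rightarrow> real \<Rightarrow> nat \<Rightarrow> real" where
  "coef_max n M P Q lam \<beta> \<rho> b l = Max ((\<lambda>i. \<bar>t_coef n M P Q lam \<beta> \<rho> b i l\<bar>) ` Mset M Q \<beta> b)"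

lemma coef_max_ge:
  "i \<in> Mset M Q \<beta> b \<Longrightarrow> \<bar>t_coef n M P Q lam \<beta> \<rho> b i l\<bar> \<le> coef_max n M P Q lam \<beta> \<rho> b l"
  unfolding coef_max_def by (intro Max_ge) auto

lemma coef_max_attained:
  assumes "Mset M Q \<beta> b \<noteq> {}"
  obtains i where "i \<in> Mset M Q \<beta> b" "coef_max n M P Q lam \<beta> \<rho> b l = \<bar>t_coef n M P Q lam \<beta> \<rho> b i l\<bar>"
proof -
  have "coef_max n M P Q lam \<beta> \<rho> b l \<in> (\<lambda>i. \<bar>t_coef n M P Q lam \<beta> \<rho> b i l\<bar>) ` Mset M Q \<beta> b"
    unfolding coef_max_def using assms by (intro Max_in) auto
  then show ?thesis using that by auto
qed

lemma coef_max_nonneg: "Mset M Q \<beta> b \<noteq> {} \<Longrightarrow> 0 \<le> coef_max n M P Q lam \<beta> \<rho> b l"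
  by (metis abs_ge_zero coef_max_attained)

lemma t_coef_le_t_max:
  assumes "i \<in> Mset M Q \<beta> b" "l < n"
  shows "\<bar>t_coef n M P Q lam \<beta> \<rho> b i l\<bar> \<le> t_max n M P Q lam \<beta> \<rho> b"
proof -
  have "{\<bar>t_coef n M P Q lam \<beta> \<rho> b i l\<bar> | i l. i \<in> Mset M Q \<beta> b \<and> l < n}
      = (\<lambda>(i, l). \<bar>t_coef n M P Q lam \<beta> \<rho> b i l\<bar>) ` (Mset M Q \<beta> b \<times> {..<n})"
    by auto
  then have "finite {\<bar>t_coef n M P Q lam \<beta> \<rho> b i l\<bar> | i l. i \<in> Mset M Q \<beta> b \<and> l < n}"
    by simp
  then show ?thesis
    unfolding t_max_def using assms by (intro Max_ge) auto
qed

context ridge_model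
begin

abbreviation "V \<equiv> coef_max n M P Q lam \<beta> \<rho> b"
abbreviation "T \<equiv> t_max n M P Q lam \<beta> \<rho> b"

lemma coef_max_le_t_max: "\<M> \<noteq> {} \<Longrightarrow> l < n \<Longrightarrow> V l \<le> T"
  using t_coef_le_t_max by (metis coef_max_attained)

text \<open>One bound for each alternative of Assumption 7. The first counts errors; the second
  counts rows: one factor of the cube is bounded by \<open>T\<close>, the remaining square by the
  sum over rows, and each row has square sum at most 1.\<close>

lemma sum_coef_max_cube_le:
  assumes ne: "\<M> \<noteq> {}"
  shows "(\<Sum>l<n. V l ^ 3) \<le> real n * T ^ 3" "(\<Sum>l<n. V l ^ 3) \<le> T * real (card \<M>)"
proof -
  have "(\<Sum>l<n. V l ^ 3) \<le> (\<Sum>l<n. T ^ 3)"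
    using coef_max_le_t_max[OF ne] coef_max_nonneg[OF ne] by (intro sum_mono power_mono) auto
  then show "(\<Sum>l<n. V l ^ 3) \<le> real n * T ^ 3" by simp
  have T0: "0 \<le> T" using coef_max_le_t_max[OF ne n] coef_max_nonneg[OF ne] by (meson order_trans)
  have "(\<Sum>l<n. V l ^ 3) \<le> (\<Sum>l<n. T * (\<Sum>i\<in>\<M>. (t i l)\<^sup>2))"
  proof (rule sum_mono)
    fix l assume l: "l \<in> {..<n}"
    obtain i where i: "i \<in> \<M>" "V l = \<bar>t i l\<bar>" using coef_max_attained[OF ne] by blast
    have "V l ^ 3 = V l * (t i l)\<^sup>2" using i(2) by (simp add: power3_eq_cube power2_eq_square)
    also have "\<dots> \<le> T * (t i l)\<^sup>2" using coef_max_le_t_max[OF ne, of l] l by (intro mult_right_mono) auto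
    also have "\<dots> \<le> T * (\<Sum>i\<in>\<M>. (t i l)\<^sup>2)"
      using i(1) T0 by (intro mult_left_mono member_le_sum) auto
    finally show "V l ^ 3 \<le> T * (\<Sum>i\<in>\<M>. (t i l)\<^sup>2)" .
  qed
  also have "\<dots> = T * (\<Sum>i\<in>\<M>. \<Sum>l<n. (t i l)\<^sup>2)"
    by (simp add: sum_distrib_left[symmetric] sum.swap[of _ "\<M>"])
  also have "\<dots> \<le> T * (\<Sum>i\<in>\<M>. 1)"
    using t_sq_le_1 T0 by (intro mult_left_mono sum_mono) auto
  finally show "(\<Sum>l<n. V l ^ 3) \<le> T * real (card \<M>)" by simp
qed

text \<open>The row variance \<open>S\<close> is at least \<open>c * w\<^sup>2 / n\<close>, and S /
  (S + 1/n) increases with S. The bound is thus free of \<open>n\<close> and can serve as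
  \<open>lo\<close> in the anti-concentration.\<close>

lemma t_sq_ge:
  assumes w: "0 < w" "\<And>k. k < r \<Longrightarrow> w / sqrt (real n) \<le> wgt lam \<rho> k"
    and c: "0 < c" "c \<le> (\<Sum>k<r. (cc M Q N i k)\<^sup>2)"
  shows "c * w\<^sup>2 / (c * w\<^sup>2 + 1) \<le> (\<Sum>l<n. (t i l)\<^sup>2)"
proof -
  define S where "S = (\<Sum>k<r. (cc M Q N i k * wgt lam \<rho> k)\<^sup>2)"
  define q where "q = c * w\<^sup>2"
  have q: "0 < q" using w c by (simp add: q_def)
  have S0: "0 \<le> S" by (simp add: S_def sum_nonneg)
  have "q / real n \<le> (w\<^sup>2 / real n) * (\<Sum>k<r. (cc M Q N i k)\<^sup>2)"
    using mult_left_mono[OF c(2), of "w\<^sup>2 / real n"] by (simp add: q_def ac_simps)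
  also have "\<dots> \<le> S"
    unfolding S_def sum_distrib_left
  proof (rule sum_mono)
    fix k assume "k \<in> {..<r}"
    then have "(w / sqrt (real n))\<^sup>2 \<le> (wgt lam \<rho> k)\<^sup>2" using w by (intro power_mono) auto
    then have "w\<^sup>2 / real n \<le> (wgt lam \<rho> k)\<^sup>2" by (simp add: power_divide)
    then have "w\<^sup>2 / real n * (cc M Q N i k)\<^sup>2 \<le> (wgt lam \<rho> k)\<^sup>2 * (cc M Q N i k)\<^sup>2"
      by (rule mult_right_mono) simp
    then show "w\<^sup>2 / real n * (cc M Q N i k)\<^sup>2 \<le> (cc M Q N i k * wgt lam \<rho> k)\<^sup>2"
      by (simp add: power_mult_distrib ac_simps)
  qed
  finally have S: "q / real n \<le> S" .
  have tau: "(\<tau> i)\<^sup>2 = S + 1 / real n"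
    unfolding tau_gen_def dims S_def using S0 by (simp add: S_def power_mult_distrib)
  have pos: "0 < S + 1 / real n" using S0 n by (intro add_nonneg_pos) auto
  have "q * (S + 1 / real n) = q * S + q / real n" by (simp add: algebra_simps)
  also have "\<dots> \<le> q * S + S" using S by simp
  finally have "q * (S + 1 / real n) \<le> S * (q + 1)" by (simp add: algebra_simps)
  then have "q / (q + 1) \<le> S / (S + 1 / real n)"
    using pos q by (simp add: divide_le_eq pos_le_divide_eq ac_simps)
  then show ?thesis
    unfolding t_coef_sq tau S_def[symmetric] q_def .
qed

lemma wgt_ge:
  assumes k: "0 < lam k" "\<rho> \<le> (lam k)\<^sup>2" and C: "lam k \<le> C * sqrt (real n)" "0 < C"
  shows "(1 / (2 * C)) / sqrt (real n) \<le> wgt lam \<rho> k"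
proof -
  have "(1 / (2 * C)) / sqrt (real n) = 1 / (2 * (C * sqrt (real n)))" by simp
  also have "\<dots> \<le> 1 / (2 * lam k)" using k C n by (intro divide_left_mono) auto
  also have "\<dots> = lam k / (2 * (lam k)\<^sup>2)" using k by (simp add: power2_eq_square)
  also have "\<dots> \<le> lam k / ((lam k)\<^sup>2 + \<rho>)"
    using k \<rho> by (intro divide_left_mono mult_pos_pos add_nonneg_pos) auto
  also have "\<dots> \<le> wgt lam \<rho> k" by (rule wgt_bounds(1)[OF k(1)])
  finally show ?thesis .
qed

end

text \<open>The multiplier makes the linear term exactly -N^(\<eta> - \<nu> - g). Multiplier times
  noise scale 1 / (c N^\<eta>) is of order N^(-g), so against the truncation level N^(2 g) the
  quadratic term stays bounded.\<close>

lemma tail_exponent_bound: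
  fixes N \<tau> c \<eta> \<nu> g s :: real
  assumes N: "1 \<le> N" and pos: "0 < \<tau>" "0 < c" "0 \<le> g"
  shows "exp (- (N powr (\<eta> - \<nu> - g) / (\<tau> * N powr (- \<nu>))) * (\<tau> * N powr (- \<nu>))
      + (N powr (\<eta> - \<nu> - g) / (\<tau> * N powr (- \<nu>)))\<^sup>2 * (1 / (c * N powr \<eta>))\<^sup>2 * (2 * N powr (2 * g) + s\<^sup>2))
    \<le> exp ((2 + s\<^sup>2) / (\<tau> * c)\<^sup>2) * exp (- (N powr (\<eta> - \<nu> - g)))"
proof -
  have 1: "N powr (\<eta> - \<nu> - g) / (\<tau> * N powr (- \<nu>)) * (\<tau> * N powr (- \<nu>)) = N powr (\<eta> - \<nu> - g)"
    using N pos by simp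
  have "N powr (\<eta> - \<nu> - g) / (\<tau> * N powr (- \<nu>)) * (1 / (c * N powr \<eta>))
      = N powr (\<eta> - \<nu> - g) * N powr \<nu> * N powr (- \<eta>) / (\<tau> * c)"
    using N by (simp add: powr_minus divide_simps)
  also have "N powr (\<eta> - \<nu> - g) * N powr \<nu> * N powr (- \<eta>) = N powr (- g)"
    by (simp add: powr_add[symmetric])
  finally have 2: "(N powr (\<eta> - \<nu> - g) / (\<tau> * N powr (- \<nu>)))\<^sup>2 * (1 / (c * N powr \<eta>))\<^sup>2 = (N powr (- g) / (\<tau> * c))\<^sup>2"
    by (simp only: power_mult_distrib[symmetric])
  have g2: "(N powr (- g))\<^sup>2 = N powr (- (2 * g))"
    using N by (simp add: powr_power)
  have "(N powr (- g) / (\<tau> * c))\<^sup>2 * (2 * N powr (2 * g) + s\<^sup>2) = (2 * (N powr (- (2 * g)) * N powr (2 * g)) + N powr (- (2 * g)) * s\<^sup>2) / (\<tau> * c)\<^sup>2"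
    by (simp add: power_divide g2 algebra_simps)
  also have "N powr (- (2 * g)) * N powr (2 * g) = 1"
    using N by (simp add: powr_add[symmetric])
  also have "(2 * 1 + N powr (- (2 * g)) * s\<^sup>2) / (\<tau> * c)\<^sup>2 \<le> (2 + 1 * s\<^sup>2) / (\<tau> * c)\<^sup>2"
  proof -
    have "N powr (- (2 * g)) \<le> N powr 0" using N pos by (intro powr_mono) auto
    then have "N powr (- (2 * g)) \<le> 1" using N by simp
    then have "N powr (- (2 * g)) * s\<^sup>2 \<le> 1 * s\<^sup>2" by (rule mult_right_mono) simp
    then show ?thesis by (intro divide_right_mono) auto
  qed
  finally have "(N powr (- g) / (\<tau> * c))\<^sup>2 * (2 * N powr (2 * g) + s\<^sup>2) \<le> (2 + s\<^sup>2) / (\<tau> * c)\<^sup>2" by simp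
  then show ?thesis
    unfolding 2 exp_add[symmetric] using 1 by simp
qed

theorem theorem2:
  fixes X M P Q Qp :: "nat \<Rightarrow> real Matrix.mat"
    and \<beta> :: "nat \<Rightarrow> real Matrix.vec"
    and lam :: "nat \<Rightarrow> nat \<Rightarrow> real"
    and p p1 r :: "nat \<Rightarrow> nat"
    and \<rho> b :: "nat \<Rightarrow> real"
    and D :: "real measure"
    and c\<^sub>L C\<^sub>L \<eta> \<alpha>\<^sub>\<theta> \<delta> m \<alpha>\<^sub>p C\<^sub>b \<nu>\<^sub>b c\<^sub>b \<alpha>\<^sub>M c\<^sub>M C\<^sub>M \<alpha>\<^sub>\<sigma> :: real
  (* model set-up: dimensions and thin SVD  X = P Lambda Q^T,  orthonormal complement Qp *)
  assumes dims: "\<forall>\<^sub>F n in sequentially.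
      X n \<in> carrier_mat n (p n) \<and> \<beta> n \<in> carrier_vec (p n) \<and> M n \<in> carrier_mat (p1 n) (p n) \<and>
      P n \<in> carrier_mat n (r n) \<and> Q n \<in> carrier_mat (p n) (r n) \<and>
      Qp n \<in> carrier_mat (p n) (p n - r n)"
    and svd: "\<forall>\<^sub>F n in sequentially.
      X n = P n * Lam_mat (r n) (lam n) * transpose_mat (Q n) \<and>
      transpose_mat (P n) * P n = 1\<^sub>m (r n) \<and> transpose_mat (Q n) * Q n = 1\<^sub>m (r n) \<and>
      (\<forall>k. Suc k < r n \<longrightarrow> lam n (Suc k) \<le> lam n k) \<and> (\<forall>k < r n. 0 < lam n k)"
    and perp: "\<forall>\<^sub>F n in sequentially.
      transpose_mat (Qp n) * Qp n = 1\<^sub>m (p n - r n) \<and>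
      transpose_mat (Q n) * Qp n = 0\<^sub>m (r n) (p n - r n) \<and>
      Q n * transpose_mat (Q n) + Qp n * transpose_mat (Qp n) = 1\<^sub>m (p n)"
  (* Assumption 1 *)
    and A1_const: "0 < c\<^sub>L" "0 < C\<^sub>L" "0 < \<eta>" "\<eta> \<le> 1/2" "0 < \<alpha>\<^sub>\<theta>" "\<alpha>\<^sub>\<theta> < 3 * \<eta>"
    and A1_sv: "\<forall>\<^sub>F n in sequentially. \<forall>k < r n.
      c\<^sub>L * real n powr \<eta> \<le> lam n k \<and> lam n k \<le> C\<^sub>L * real n powr (1/2)"
    and A1_theta: "(\<lambda>n. sqrt (\<Sum>i<p n. (theta_of (Q n) (\<beta> n) $ i)\<^sup>2)) \<in> O(\<lambda>n. real n powr \<alpha>\<^sub>\<theta>)"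
  (* Assumption 2 *)
    and A2_pos: "\<forall>\<^sub>F n in sequentially. 0 < \<rho> n"
    and A2_rate: "\<rho> \<in> O(\<lambda>n. real n powr (2 * \<eta> - \<delta>))"
    and A2_const: "(\<eta> + \<alpha>\<^sub>\<theta>) / 2 < \<delta>" "\<delta> < 2 * \<eta>"
  (* Assumption 3 (errors i.i.d. with law D); sigma^2 > 0 is implicit in the paper *)
    and A3: "prob_space D" "sets D = sets borel"
      "integrable D (\<lambda>x. x)" "(\<integral>x. x \<partial>D) = 0"
      "integrable D (\<lambda>x. \<bar>x\<bar> powr m)" "4 < m"
    and sigma_pos: "0 < err_var D"
  (* Assumption 4 *)
    and A4_p: "(\<lambda>n. real (p n)) \<in> O(\<lambda>n. real n powr \<alpha>\<^sub>p)" "0 \<le> \<alpha>\<^sub>p" "\<alpha>\<^sub>p < m * \<eta>"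
    and A4_b: "\<And>n. b n = C\<^sub>b * real n powr (- \<nu>\<^sub>b)" "0 < C\<^sub>b" "0 < \<nu>\<^sub>b"
      "\<nu>\<^sub>b + \<alpha>\<^sub>p / m - \<eta> < 0"
    and A4_gap: "0 < c\<^sub>b" "c\<^sub>b < 1"
      "\<forall>\<^sub>F n in sequentially. \<forall>i < p n.
         (i \<notin> Nb (Q n) (\<beta> n) (b n) \<longrightarrow> \<bar>theta_of (Q n) (\<beta> n) $ i\<bar> \<le> c\<^sub>b * b n) \<and>
         (i \<in> Nb (Q n) (\<beta> n) (b n) \<longrightarrow> b n / c\<^sub>b \<le> \<bar>theta_of (Q n) (\<beta> n) $ i\<bar>)"
  (* Assumption 5 *)
    and A5_ne: "\<forall>\<^sub>F n in sequentially. Mset (M n) (Q n) (\<beta> n) (b n) \<noteq> {}"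
    and A5_card: "(\<lambda>n. real (card (Mset (M n) (Q n) (\<beta> n) (b n)))) \<in> O(\<lambda>n. real n powr \<alpha>\<^sub>M)"
      "\<alpha>\<^sub>M < m * \<eta>"
    and A5_c: "0 < c\<^sub>M"
      "\<forall>\<^sub>F n in sequentially. \<forall>i \<in> Mset (M n) (Q n) (\<beta> n) (b n).
         c\<^sub>M < (\<Sum>k<r n. (cc (M n) (Q n) (Nb (Q n) (\<beta> n) (b n)) i k)\<^sup>2) \<and>
         (\<Sum>k<r n. (cc (M n) (Q n) (Nb (Q n) (\<beta> n) (b n)) i k)\<^sup>2) \<le> C\<^sub>M"
    and A5_small: "(\<lambda>n. Max ((\<lambda>i. \<bar>\<Sum>j\<in>{..<p n} - Nb (Q n) (\<beta> n) (b n).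
                                M n $$ (i, j) * theta_of (Q n) (\<beta> n) $ j\<bar>) ` {..<p1 n}))
        \<in> o(\<lambda>n. 1 / sqrt (real n * ln (real n)))"
      "(\<lambda>n. Max ((\<lambda>i. \<bar>\<Sum>j<p n. M n $$ (i, j) * theta_of (Qp n) (\<beta> n) $ j\<bar>) ` {..<p1 n}))
        \<in> o(\<lambda>n. 1 / sqrt (real n * ln (real n)))"
  (* Assumption 6 *)
    and A6: "0 < \<alpha>\<^sub>\<sigma>" "\<alpha>\<^sub>\<sigma> \<le> \<eta>"
      "(\<lambda>n. real n powr (- \<nu>\<^sub>b) *
             (\<Sum>j\<in>{..<p n} - Nb (Q n) (\<beta> n) (b n). \<bar>theta_of (Q n) (\<beta> n) $ j\<bar>))
        \<in> O(\<lambda>n. real n powr (- \<alpha>\<^sub>\<sigma>))"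
      "(\<lambda>n. sqrt (real (card (Nb (Q n) (\<beta> n) (b n)))) / real n powr \<eta>)
        \<in> O(\<lambda>n. real n powr (- \<alpha>\<^sub>\<sigma>))"
  (* Assumption 7 *)
    and A7_rank: "\<forall>\<^sub>F n in sequentially.
      card (Mset (M n) (Q n) (\<beta> n) (b n)) \<le> r n \<and>
      vec_space.rank (card (Mset (M n) (Q n) (\<beta> n) (b n))) (C_M_mat (M n) (Q n) (\<beta> n) (b n))
        = card (Mset (M n) (Q n) (\<beta> n) (b n))"
    and A7_t:
      "(\<lambda>n. t_max n (M n) (P n) (Q n) (lam n) (\<beta> n) (\<rho> n) (b n))
          \<in> o(\<lambda>n. min (real n powr ((\<alpha>\<^sub>\<sigma> - 1) / 2) * ln (real n) powr (- 3/2))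
                       (real n powr (- 1/3) * ln (real n) powr (- 3/2)))
       \<or> (\<alpha>\<^sub>\<sigma> < 1/2 \<and>
          (\<lambda>n. real (card (Mset (M n) (Q n) (\<beta> n) (b n))))
            \<in> o(\<lambda>n. real n powr \<alpha>\<^sub>\<sigma> * ln (real n) powr (- 3)) \<and>
          (\<lambda>n. t_max n (M n) (P n) (Q n) (lam n) (\<beta> n) (\<rho> n) (b n))
            \<in> O(\<lambda>n. real n powr (- \<alpha>\<^sub>\<sigma>) * ln (real n) powr (- 3/2)))"
  shows "(\<lambda>n. SUP x\<in>{0..}. \<bar>prob_stat (X n) (\<beta> n) (M n) (Q n) (lam n) (\<rho> n) (b n) D x
                             - H_fun n (M n) (Q n) (lam n) (\<beta> n) (\<rho> n) (b n) (sqrt (err_var D)) x\<bar>)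
         \<longlonglongrightarrow> 0"
proof -
  define s where "s = sqrt (err_var D)"
  have s: "0 < s" "(\<integral>x. x\<^sup>2 \<partial>D) = s\<^sup>2"
    using sigma_pos by (simp_all add: s_def err_var_def)
  define \<Delta> where "\<Delta> n x = \<bar>prob_stat (X n) (\<beta> n) (M n) (Q n) (lam n) (\<rho> n) (b n) D x
      - H_fun n (M n) (Q n) (lam n) (\<beta> n) (\<rho> n) (b n) s x\<bar>" for n x
  define Km where "Km = (\<integral>x. \<bar>x\<bar> powr m \<partial>D)"
  define m3 where "m3 = third_moment D + third_moment (gauss s)"
  have Km: "0 \<le> Km" by (simp add: Km_def)
  define Ms where "Ms n = Mset (M n) (Q n) (\<beta> n) (b n)" for n
  define mc where "mc n = real (card (Ms n))" for n
  define tm where "tm n = t_max n (M n) (P n) (Q n) (lam n) (\<beta> n) (\<rho> n) (b n)" for n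
  define V where "V n = coef_max n (M n) (P n) (Q n) (lam n) (\<beta> n) (\<rho> n) (b n)" for n
  \<comment> \<open>\<open>Max\<close> over an empty set is unspecified; the value 0 keeps
    \<open>B\<close> nonnegative also at the small \<open>n\<close> where \<open>Ms n\<close> may be
    empty.\<close>
  define B where "B n = (if Ms n = {} then 0 else \<Sum>l<n. V n l ^ 3)" for n
  define th where "th n = sqrt (\<Sum>i<p n. (theta_of (Q n) (\<beta> n) $ i)\<^sup>2)" for n

  obtain Ct where Ct: "0 < Ct" "\<forall>\<^sub>F n in sequentially. norm (th n) \<le> Ct * norm (real n powr \<alpha>\<^sub>\<theta>)"
    using A1_theta unfolding th_def by (elim landau_o.bigE)
  obtain Cr where Cr: "0 < Cr" "\<forall>\<^sub>F n in sequentially. norm (\<rho> n) \<le> Cr * norm (real n powr (2 * \<eta> - \<delta>))"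
    using A2_rate by (elim landau_o.bigE)
  obtain Cp where Cp: "0 < Cp" "\<forall>\<^sub>F n in sequentially. norm (real (p n)) \<le> Cp * norm (real n powr \<alpha>\<^sub>p)"
    using A4_p(1) by (elim landau_o.bigE)
  obtain Cm where Cm: "0 < Cm" "\<forall>\<^sub>F n in sequentially. norm (mc n) \<le> Cm * norm (real n powr \<alpha>\<^sub>M)"
    using A5_card(1) unfolding mc_def Ms_def by (elim landau_o.bigE)

  define rb where "rb n = Cr * real n powr (2 * \<eta> - \<delta>)" for n
  define lb where "lb n = c\<^sub>L * real n powr \<eta>" for n
  define Z where "Z n = Ct * real n powr \<alpha>\<^sub>\<theta>" for n
  define g where "g n = (rb n)\<^sup>2 / (lb n) ^ 4" for n
  define G where "G n = (rb n)\<^sup>2 / (lb n) ^ 3" for n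
  define a1 where "a1 n = Max ((\<lambda>i. \<bar>\<Sum>j\<in>{..<p n} - Nb (Q n) (\<beta> n) (b n).
                                M n $$ (i, j) * theta_of (Q n) (\<beta> n) $ j\<bar>) ` {..<p1 n})" for n
  define a2 where "a2 n = Max ((\<lambda>i. \<bar>\<Sum>j<p n. M n $$ (i, j) * theta_of (Qp n) (\<beta> n) $ j\<bar>) ` {..<p1 n})" for n
  \<comment> \<open>The absolute values make \<open>\<kappa>\<close> nonnegative for every
    \<open>n\<close>, including those where \<open>a1\<close> or \<open>a2\<close> is a
    \<open>Max\<close> over the empty set.\<close>
  define \<kappa> where "\<kappa> n = G n * Z n + sqrt (real n) * (\<bar>a1 n\<bar> + \<bar>a2 n\<bar>)" for n
  define \<tau>0 where "\<tau>0 = (1 - c\<^sub>b) * C\<^sub>b / 2"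
  have \<tau>0: "0 < \<tau>0" using A4_b A4_gap by (simp add: \<tau>0_def)
  have half: "(1 - c\<^sub>b) * b n / 2 = \<tau>0 * real n powr (- \<nu>\<^sub>b)" for n
    by (simp add: A4_b(1) \<tau>0_def)
  have m: "0 < m" "3 \<le> m" using A3(6) by auto
  \<comment> \<open>The midpoint of \<open>\<alpha>\<^sub>p / m\<close> and
    \<open>\<eta> - \<nu>\<^sub>b\<close>. Being above the former makes \<open>p\<close> times n^(-m
    \<gamma>) vanish; being below the latter makes the exponential term small.\<close>
  define \<gamma> where "\<gamma> = (\<alpha>\<^sub>p / m + \<eta> - \<nu>\<^sub>b) / 2"
  have \<gamma>: "\<alpha>\<^sub>p / m < \<gamma>" "0 < \<eta> - \<nu>\<^sub>b - \<gamma>" "0 \<le> \<gamma>"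
  proof -
    define am where "am = \<alpha>\<^sub>p / m"
    have "0 \<le> am" "\<nu>\<^sub>b + am < \<eta>" using m A4_p(2) A4_b(4) by (auto simp: am_def)
    then show "\<alpha>\<^sub>p / m < \<gamma>" "0 < \<eta> - \<nu>\<^sub>b - \<gamma>" "0 \<le> \<gamma>"
      unfolding \<gamma>_def am_def[symmetric] by (simp_all add: field_simps)
  qed
  have \<nu>\<eta>: "\<nu>\<^sub>b < \<eta>" using \<gamma> by linarith
  define W where "W n = 1 / lb n" for n
  define c where "c n = real n powr (2 * \<gamma>)" for n :: nat
  \<comment> \<open>Chosen so that \<open>u\<close> times the noise threshold is n^(\<eta> - \<nu>_b
    - \<gamma>).\<close>
  define u where "u n = real n powr (\<eta> - \<nu>\<^sub>b - \<gamma>) / (\<tau>0 * real n powr (- \<nu>\<^sub>b))" for n :: nat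
  \<comment> \<open>Once \<rho> is at most \<lambda>^2, a weight is at least 1 / (2 \<lambda>), and
    \<lambda> is at most \<open>C\<^sub>L\<close> times sqrt n.\<close>
  define w where "w = 1 / (2 * C\<^sub>L)"
  define lo where "lo = sqrt (c\<^sub>M * w\<^sup>2 / (c\<^sub>M * w\<^sup>2 + 1))"
  have w: "0 < w" using A1_const by (simp add: w_def)
  have cw: "0 < c\<^sub>M * w\<^sup>2" using w A5_c(1) by simp
  have lo: "0 < lo" "lo\<^sup>2 = c\<^sub>M * w\<^sup>2 / (c\<^sub>M * w\<^sup>2 + 1)"
    using cw by (auto simp: lo_def intro!: divide_pos_pos add_pos_pos)

  have rm: "\<forall>\<^sub>F n in sequentially. ridge_model n (p n) (p1 n) (r n) (p n - r n) (X n) (M n) (P n) (Q n) (Qp n) (\<beta> n) (lam n) (\<rho> n)"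
    using dims svd perp A2_pos eventually_gt_at_top[of 0] by eventually_elim (simp add: ridge_model_def)
  have ne: "\<forall>\<^sub>F n in sequentially. Ms n \<noteq> {}" using A5_ne by (simp add: Ms_def)

  have B0: "0 \<le> B n" for n
    unfolding B_def V_def Ms_def by (auto intro!: sum_nonneg coef_max_nonneg)
  have Bl: "(\<lambda>n. B n * ln (real n) powr (9/2)) \<longlonglongrightarrow> 0"
  proof -
    have B1: "\<forall>\<^sub>F n in sequentially. B n \<le> real n * tm n ^ 3"
      using rm ne
    proof eventually_elim
      case (elim n)
      then show ?case
        using ridge_model.sum_coef_max_cube_le(1)[OF elim(1)] unfolding B_def V_def tm_def Ms_def by simp
    qed
    have B2: "\<forall>\<^sub>F n in sequentially. B n \<le> tm n * mc n"
      using rm ne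
    proof eventually_elim
      case (elim n)
      then show ?case
        using ridge_model.sum_coef_max_cube_le(2)[OF elim(1)] unfolding B_def V_def tm_def mc_def Ms_def by simp
    qed
    from A7_t show ?thesis
    proof (elim disjE conjE)
      assume "(\<lambda>n. t_max n (M n) (P n) (Q n) (lam n) (\<beta> n) (\<rho> n) (b n))
          \<in> o(\<lambda>n. min (real n powr ((\<alpha>\<^sub>\<sigma> - 1) / 2) * ln (real n) powr (- 3/2))
                       (real n powr (- 1/3) * ln (real n) powr (- 3/2)))"
      then show ?thesis
        unfolding tm_def[symmetric] by (rule cubic_sum_tendsto_1[OF _ B0 B1])
    next
      assume "(\<lambda>n. real (card (Mset (M n) (Q n) (\<beta> n) (b n)))) \<in> o(\<lambda>n. real n powr \<alpha>\<^sub>\<sigma> * ln (real n) powr (- 3))"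
        and "(\<lambda>n. t_max n (M n) (P n) (Q n) (lam n) (\<beta> n) (\<rho> n) (b n))
            \<in> O(\<lambda>n. real n powr (- \<alpha>\<^sub>\<sigma>) * ln (real n) powr (- 3/2))"
      then show ?thesis
        unfolding tm_def[symmetric] mc_def[symmetric] Ms_def[symmetric] by (rule cubic_sum_tendsto_2[OF _ _ B0 B2])
    qed
  qed
  have mc: "0 \<le> mc n" "\<forall>\<^sub>F n in sequentially. mc n \<le> Cm * real n powr \<alpha>\<^sub>M" for n
    using Cm(2) by (auto simp: mc_def)
  have \<kappa>0: "0 \<le> \<kappa> n" for n
    using Ct(1) Cr(1) A1_const by (auto simp: \<kappa>_def G_def Z_def lb_def intro!: add_nonneg_nonneg mult_nonneg_nonneg divide_nonneg_nonneg)
  have \<kappa>l: "(\<lambda>n. \<kappa> n * sqrt (ln (real n))) \<longlonglongrightarrow> 0"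
  proof -
    have small: "(\<lambda>n. sqrt (real n) * \<bar>f n\<bar> * sqrt (ln (real n))) \<longlonglongrightarrow> 0"
      if f: "f \<in> o(\<lambda>n. 1 / sqrt (real n * ln (real n)))" for f :: "nat \<Rightarrow> real"
    proof -
      have "(\<lambda>n. f n / (1 / sqrt (real n * ln (real n)))) \<longlonglongrightarrow> 0" by (rule smalloD_tendsto[OF f])
      then have "(\<lambda>n. \<bar>f n / (1 / sqrt (real n * ln (real n)))\<bar>) \<longlonglongrightarrow> 0" by (rule tendsto_rabs_zero)
      then show ?thesis
      proof (rule Lim_transform_eventually)
        show "\<forall>\<^sub>F n in sequentially. \<bar>f n / (1 / sqrt (real n * ln (real n)))\<bar> = sqrt (real n) * \<bar>f n\<bar> * sqrt (ln (real n))"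
          using eventually_gt_at_top[of 0] by eventually_elim (simp add: abs_mult real_sqrt_mult)
      qed
    qed
    have s1: "(\<lambda>n. sqrt (real n) * \<bar>a1 n\<bar> * sqrt (ln (real n))) \<longlonglongrightarrow> 0"
      and s2: "(\<lambda>n. sqrt (real n) * \<bar>a2 n\<bar> * sqrt (ln (real n))) \<longlonglongrightarrow> 0"
      using A5_small by (auto intro!: small simp: a1_def a2_def)
    \<comment> \<open>The lower bound on \<open>\<delta>\<close> in Assumption 2 says exactly this:
      \<open>G n * Z n\<close> decays polynomially and survives the factor sqrt (log n).\<close>
    have "\<eta> - 2 * \<delta> + \<alpha>\<^sub>\<theta> < 0" using A2_const(1) by (simp add: field_simps)
    then have s3: "(\<lambda>n. (Cr\<^sup>2 * Ct / c\<^sub>L ^ 3) * real n powr (\<eta> - 2 * \<delta> + \<alpha>\<^sub>\<theta>) * sqrt (ln (real n))) \<longlonglongrightarrow> 0"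
      by (rule powr_mult_sqrt_ln_tendsto)
    have GZ: "\<forall>\<^sub>F n in sequentially. (Cr\<^sup>2 * Ct / c\<^sub>L ^ 3) * real n powr (\<eta> - 2 * \<delta> + \<alpha>\<^sub>\<theta>) = G n * Z n"
      using eventually_gt_at_top[of 0]
    proof eventually_elim
      case (elim n)
      have "(real n powr (2 * \<eta> - \<delta>))\<^sup>2 / (real n powr \<eta>) ^ 3 * real n powr \<alpha>\<^sub>\<theta>
          = real n powr ((2 * \<eta> - \<delta>) * 2) / real n powr (\<eta> * 3) * real n powr \<alpha>\<^sub>\<theta>"
        using elim by (simp add: powr_power algebra_simps)
      also have "\<dots> = real n powr ((2 * \<eta> - \<delta>) * 2 - \<eta> * 3 + \<alpha>\<^sub>\<theta>)"
        by (simp only: powr_add powr_diff)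
      also have "(2 * \<eta> - \<delta>) * 2 - \<eta> * 3 + \<alpha>\<^sub>\<theta> = \<eta> - 2 * \<delta> + \<alpha>\<^sub>\<theta>" by simp
      finally have pw: "(real n powr (2 * \<eta> - \<delta>))\<^sup>2 / (real n powr \<eta>) ^ 3 * real n powr \<alpha>\<^sub>\<theta>
          = real n powr (\<eta> - 2 * \<delta> + \<alpha>\<^sub>\<theta>)" .
      show ?case
        unfolding pw[symmetric] by (simp add: G_def Z_def rb_def lb_def power_mult_distrib)
    qed
    have "(\<lambda>n. (Cr\<^sup>2 * Ct / c\<^sub>L ^ 3) * real n powr (\<eta> - 2 * \<delta> + \<alpha>\<^sub>\<theta>) * sqrt (ln (real n))
        + (sqrt (real n) * \<bar>a1 n\<bar> * sqrt (ln (real n)) + sqrt (real n) * \<bar>a2 n\<bar> * sqrt (ln (real n)))) \<longlonglongrightarrow> 0"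
      using tendsto_add[OF s3 tendsto_add[OF s1 s2]] by simp
    then show ?thesis
    proof (rule Lim_transform_eventually)
      show "\<forall>\<^sub>F n in sequentially. (Cr\<^sup>2 * Ct / c\<^sub>L ^ 3) * real n powr (\<eta> - 2 * \<delta> + \<alpha>\<^sub>\<theta>) * sqrt (ln (real n))
        + (sqrt (real n) * \<bar>a1 n\<bar> * sqrt (ln (real n)) + sqrt (real n) * \<bar>a2 n\<bar> * sqrt (ln (real n))) = \<kappa> n * sqrt (ln (real n))"
        using GZ by eventually_elim (simp add: \<kappa>_def algebra_simps)
    qed
  qed
  obtain \<beta>' d x0 where win: "\<forall>\<^sub>F n in sequentially. 0 < \<beta>' n \<and> 0 < \<kappa> n + 2 * d n \<and> \<kappa> n + 2 * d n \<le> x0 n"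
    and win_lim: "(\<lambda>n. swap_error m3 (B n) (mc n) (\<beta>' n) (d n) + window_error s lo (mc n) (\<kappa> n + 2 * d n) (x0 n)) \<longlonglongrightarrow> 0"
    by (rule window_choice[OF B0 Bl mc \<kappa>0 \<kappa>l s(1) lo(1)])
  define R where "R n = swap_error m3 (B n) (mc n) (\<beta>' n) (d n) + window_error s lo (mc n) (\<kappa> n + 2 * d n) (x0 n)" for n
  define E where "E = exp ((2 + s\<^sup>2) / (\<tau>0 * c\<^sub>L)\<^sup>2)"
  define tail where "tail n = real n powr \<alpha>\<^sub>p * ((Cp * Km) * real n powr (- (m * \<gamma>)) + (Cp * 2 * E) * exp (- (real n powr (\<eta> - \<nu>\<^sub>b - \<gamma>))))" for n :: nat
  have tail_lim: "tail \<longlonglongrightarrow> 0"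
    unfolding tail_def using \<gamma>(1,2) m(1) by (intro tail_terms_tendsto) (auto simp: field_simps)

  have lam_lb: "\<forall>\<^sub>F n in sequentially. \<forall>k<r n. 0 < lb n \<and> lb n \<le> lam n k"
    using A1_sv eventually_gt_at_top[of 0] by eventually_elim (use A1_const(1) in \<open>auto simp: lb_def\<close>)
  have rho_le: "\<forall>\<^sub>F n in sequentially. \<rho> n \<le> (lb n)\<^sup>2"
  proof -
    have "\<eta> + \<alpha>\<^sub>\<theta> < 2 * \<delta>" using A2_const(1) by (simp add: field_simps)
    then have "0 < \<delta>" using A1_const by linarith
    then have "\<forall>\<^sub>F n in sequentially. Cr * real n powr (2 * \<eta> - \<delta>) \<le> c\<^sub>L\<^sup>2 * real n powr (2 * \<eta>)"
      using A1_const(1) by (intro powr_less_eventually) auto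
    with Cr(2) eventually_gt_at_top[of 0] show ?thesis
      by eventually_elim (simp add: lb_def power_mult_distrib powr_power mult.commute)
  qed
  have gZ: "\<forall>\<^sub>F n in sequentially. g n * Z n \<le> (1 - c\<^sub>b) * b n / 2"
  proof -
    have "\<eta> + \<alpha>\<^sub>\<theta> < 2 * \<delta>" using A2_const(1) by (simp add: field_simps)
    \<comment> \<open>\<open>g n * Z n\<close> has exponent
      \<open>\<alpha>\<^sub>\<theta> - 2 * \<delta>\<close>, below \<open>- \<eta>\<close> by
      Assumption 2, while the threshold decays only with exponent \<open>- \<nu>\<^sub>b\<close>,
      above \<open>- \<eta>\<close>.\<close>
    then have "\<alpha>\<^sub>\<theta> - 2 * \<delta> < - \<nu>\<^sub>b" using \<nu>\<eta> by linarith
    then have "\<forall>\<^sub>F n in sequentially. (Cr\<^sup>2 * Ct / c\<^sub>L ^ 4) * real n powr (\<alpha>\<^sub>\<theta> - 2 * \<delta>) \<le> \<tau>0 * real n powr (- \<nu>\<^sub>b)"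
      using \<tau>0 by (intro powr_less_eventually)
    with eventually_gt_at_top[of 0] show ?thesis
    proof eventually_elim
      case (elim n)
      have "(real n powr (2 * \<eta> - \<delta>))\<^sup>2 / (real n powr \<eta>) ^ 4 * real n powr \<alpha>\<^sub>\<theta>
          = real n powr ((2 * \<eta> - \<delta>) * 2) / real n powr (\<eta> * 4) * real n powr \<alpha>\<^sub>\<theta>"
        using elim by (simp add: powr_power algebra_simps)
      also have "\<dots> = real n powr ((2 * \<eta> - \<delta>) * 2 - \<eta> * 4 + \<alpha>\<^sub>\<theta>)"
        by (simp only: powr_add powr_diff)
      also have "(2 * \<eta> - \<delta>) * 2 - \<eta> * 4 + \<alpha>\<^sub>\<theta> = \<alpha>\<^sub>\<theta> - 2 * \<delta>" by simp
      finally have pw: "(real n powr (2 * \<eta> - \<delta>))\<^sup>2 / (real n powr \<eta>) ^ 4 * real n powr \<alpha>\<^sub>\<theta>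
          = real n powr (\<alpha>\<^sub>\<theta> - 2 * \<delta>)" .
      have "g n * Z n = (Cr\<^sup>2 * Ct / c\<^sub>L ^ 4) * real n powr (\<alpha>\<^sub>\<theta> - 2 * \<delta>)"
        unfolding pw[symmetric] by (simp add: g_def Z_def rb_def lb_def power_mult_distrib)
      then show ?case using elim by (simp add: half)
    qed
  qed

  have close: "\<forall>\<^sub>F n in sequentially. \<forall>x. \<Delta> n x \<le> tail n + R n"
    using rm ne lam_lb rho_le gZ Ct(2) Cr(2) Cp(2) A1_sv A4_gap(3) A5_c(2) win A2_pos eventually_ge_at_top[of 1]
  proof eventually_elim
    case (elim n)
    interpret ridge_model n "p n" "p1 n" "r n" "p n - r n" "X n" "M n" "P n" "Q n" "Qp n" "\<beta> n" "lam n" "\<rho> n" "b n"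
      using elim by simp
    have n0: "0 < n" using elim by simp
    let ?x = "exp (- u n * ((1 - c\<^sub>b) * b n / 2) + (u n)\<^sup>2 * (W n)\<^sup>2 * (2 * c n + s\<^sup>2))"
    have lamk: "0 < lam n k" "0 < lb n" "lb n \<le> lam n k" if "k < r n" for k
      using elim that by force+
    have lb: "0 < lb n" using n0 A1_const by (simp add: lb_def)
    have rho: "\<rho> n \<le> rb n" "0 < \<rho> n" using elim by (auto simp: rb_def)
    have shrink_num: "(\<rho> n)\<^sup>2 \<le> (rb n)\<^sup>2" using rho by (intro power_mono) auto
    \<comment> \<open>The columns of \<open>Q\<close> are orthonormal, so \<open>zeta\<close> has
      the same norm as \<theta> and inherits its growth bound.\<close>
    have zeta_sq: "(\<Sum>k<r n. (zeta (Q n) (\<beta> n) k)\<^sup>2) \<le> (Z n)\<^sup>2"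
    proof -
      have "(\<Sum>k<r n. (zeta (Q n) (\<beta> n) k)\<^sup>2) = (th n)\<^sup>2"
        using theta_norm[OF Q \<beta> QQ] by (simp add: th_def zeta_def dims sum_nonneg)
      also have "\<dots> \<le> (Z n)\<^sup>2"
        using elim by (intro power_mono) (auto simp: Z_def th_def sum_nonneg)
      finally show ?thesis .
    qed
    have Bn: "B n = (\<Sum>l<n. V n l ^ 3)" using elim by (simp add: B_def)
    have bnd: "\<Delta> n x
      \<le> real (p n) * (Km * c n powr (- m / 2) + 2 * ?x)
        + R n" for x
      unfolding \<Delta>_def Km_def R_def Bn m3_def mc_def Ms_def
    proof (rule prob_stat_close[OF A3(1,2,3,4,5) m(2) s])
      show "\<M> \<noteq> {}" using elim by (simp add: Ms_def)
      show "0 < b n" using A4_b n0 by simp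
      show "\<bar>\<theta> i\<bar> \<le> c\<^sub>b * b n" if "i < p n" "i \<notin> N" for i
        using elim that by simp
      show "b n / c\<^sub>b \<le> \<bar>\<theta> i\<bar>" if "i < p n" "i \<in> N" for i
        using elim that by simp
      show "0 \<le> Z n" using Ct(1) by (simp add: Z_def)
      show "shrink (lam n) (\<rho> n) k \<le> g n" if k: "k < r n" for k
      proof -
        have "shrink (lam n) (\<rho> n) k \<le> (\<rho> n)\<^sup>2 / lam n k ^ 4" by (rule shrink_le[OF lamk(1)[OF k]])
        also have "\<dots> \<le> g n"
          unfolding g_def using lamk[OF k] shrink_num rho by (intro frac_le power_mono) auto
        finally show ?thesis .
      qed
      show "0 \<le> g n" using lb by (simp add: g_def)
      show "shrink (lam n) (\<rho> n) k \<le> G n * wgt (lam n) (\<rho> n) k" if k: "k < r n" for k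
      proof -
        have "shrink (lam n) (\<rho> n) k \<le> (\<rho> n)\<^sup>2 / lam n k ^ 3 * wgt (lam n) (\<rho> n) k"
          by (rule shrink_le_wgt[OF lamk(1)[OF k]])
        also have "\<dots> \<le> G n * wgt (lam n) (\<rho> n) k"
          unfolding G_def using lamk[OF k] shrink_num rho wgt_bounds(2)[OF lamk(1)[OF k]]
          by (intro mult_right_mono frac_le power_mono) auto
        finally show ?thesis .
      qed
      show "0 \<le> G n" using lb by (simp add: G_def)
      show "\<bar>\<Sum>j\<in>{..<p n} - N. M n $$ (i, j) * theta_of (Q n) (\<beta> n) $ j\<bar> \<le> \<bar>a1 n\<bar>" if "i < p1 n" for i
      proof -
        have "\<bar>\<Sum>j\<in>{..<p n} - N. M n $$ (i, j) * theta_of (Q n) (\<beta> n) $ j\<bar> \<le> a1 n"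
          unfolding a1_def using that by (intro Max_ge) auto
        then show ?thesis by linarith
      qed
      show "\<bar>\<Sum>j<p n. M n $$ (i, j) * theta_of (Qp n) (\<beta> n) $ j\<bar> \<le> \<bar>a2 n\<bar>" if "i < p1 n" for i
      proof -
        have "\<bar>\<Sum>j<p n. M n $$ (i, j) * theta_of (Qp n) (\<beta> n) $ j\<bar> \<le> a2 n"
          unfolding a2_def using that by (intro Max_ge) auto
        then show ?thesis by linarith
      qed
      show "G n * Z n + sqrt (real n) * (\<bar>a1 n\<bar> + \<bar>a2 n\<bar>) \<le> \<kappa> n" by (simp add: \<kappa>_def)
      show "wgt (lam n) (\<rho> n) k \<le> W n" if k: "k < r n" for k
      proof -
        have "wgt (lam n) (\<rho> n) k \<le> 1 / lam n k" by (rule wgt_bounds(3)[OF lamk(1)[OF k]])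
        also have "\<dots> \<le> W n" unfolding W_def using lamk[OF k] by (intro divide_left_mono) auto
        finally show ?thesis .
      qed
      show "0 < W n" using lb by (simp add: W_def)
      show "0 < c n" using n0 by (simp add: c_def)
      show "0 < u n" using n0 \<tau>0 by (simp add: u_def)
      show "\<bar>t i l\<bar> \<le> V n l"
        if "i \<in> \<M>" for i l
        unfolding V_def by (rule coef_max_ge[OF that])
      show "0 \<le> V n l" for l
        unfolding V_def using elim by (intro coef_max_nonneg) (simp add: Ms_def)
      show "lo\<^sup>2 \<le> (\<Sum>l<n. (t i l)\<^sup>2)"
        if i: "i \<in> \<M>" for i
        unfolding lo(2)
      proof (rule t_sq_ge[OF w _ A5_c(1)])
        show "c\<^sub>M \<le> (\<Sum>k<r n. (cc (M n) (Q n) N i k)\<^sup>2)"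
          using elim i by (auto intro: less_imp_le)
        show "w / sqrt (real n) \<le> wgt (lam n) (\<rho> n) k" if k: "k < r n" for k
          unfolding w_def
        proof (rule wgt_ge[OF lamk(1)[OF k]])
          have "(lb n)\<^sup>2 \<le> (lam n k)\<^sup>2" using lamk[OF k] by (intro power_mono) auto
          then show "\<rho> n \<le> (lam n k)\<^sup>2" using elim by linarith
          show "lam n k \<le> C\<^sub>L * sqrt (real n)"
            using elim k by (simp add: powr_half_sqrt)
          show "0 < C\<^sub>L" by (rule A1_const(2))
        qed
      qed
    qed (use elim s lo zeta_sq lamk A4_gap in auto)
    have cm: "c n powr (- m / 2) = real n powr (- (m * \<gamma>))"
      using n0 by (simp add: c_def powr_powr mult.commute)
    have ex: "?x \<le> E * exp (- (real n powr (\<eta> - \<nu>\<^sub>b - \<gamma>)))"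
      unfolding half u_def W_def lb_def c_def E_def
      using elim \<tau>0 A1_const(1) \<gamma>(3) by (intro tail_exponent_bound) auto
    have "real (p n) * (Km * c n powr (- m / 2) + 2 * ?x)
        \<le> (Cp * real n powr \<alpha>\<^sub>p) * (Km * real n powr (- (m * \<gamma>)) + 2 * (E * exp (- (real n powr (\<eta> - \<nu>\<^sub>b - \<gamma>)))))"
      using elim ex Km Cp(1) unfolding cm
      by (intro mult_mono add_mono mult_left_mono) (auto intro!: add_nonneg_nonneg mult_nonneg_nonneg)
    also have "\<dots> = tail n" by (simp add: tail_def algebra_simps)
    finally have tl: "real (p n) * (Km * c n powr (- m / 2) + 2 * ?x) \<le> tail n" .
    show ?case
    proof
      fix x
      show "\<Delta> n x \<le> tail n + R n"
        using bnd[of x] tl by linarith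
    qed
  qed

  have lim: "(\<lambda>n. tail n + R n) \<longlonglongrightarrow> 0"
    using tendsto_add[OF tail_lim win_lim] by (simp add: R_def)
  show ?thesis
    unfolding s_def[symmetric] \<Delta>_def[symmetric]
  proof (rule tendsto_sandwich[OF _ _ tendsto_const lim])
    show "\<forall>\<^sub>F n in sequentially. (SUP x\<in>{0..}. \<Delta> n x) \<le> tail n + R n"
      using close by eventually_elim (rule cSUP_least, auto)
    show "\<forall>\<^sub>F n in sequentially. 0 \<le> (SUP x\<in>{0..}. \<Delta> n x)"
      using close
    proof eventually_elim
      case (elim n)
      \<comment> \<open>A real supremum is meaningful only for a set bounded above;
        \<open>close\<close> supplies the bound.\<close>
      have "bdd_above (\<Delta> n ` {0..})" using elim by (intro bdd_aboveI2) blast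
      then show ?case by (rule cSUP_upper2[of _ _ 0]) (auto simp: \<Delta>_def)
    qed
  qed
qed

end
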